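(* Let $\rho$ be a Riemannian metric on the 2-torus $\mathbb{T}^2$ whose geodesic flow has a first integral $F_4$ that is a homogeneous polynomial of degree $4$ in the momenta, and let $\Omega_e\subset\mathbb{T}^2$ be an elliptic region for $F_4$. Write $\rho$ in global conformal coordinates $(q_1,q_2)$ as $ds^2=\Lambda(q_1,q_2)(dq_1^2+dq_2^2)$. Then either the metric $\rho$ is flat on $\Omega_e$, or the conformal factor can be written on $\Omega_e$ in the form $$\Lambda(q_1,q_2)=f(m_1q_1+n_1q_2)+g(m_2q_1+n_2q_2)$$ for some functions $f,g$ of one variable and some nonzero real vectors $(m_1,n_1),(m_2,n_2)$ with $m_1m_2+n_1n_2=0$. If in addition $\rho$ is real analytic, then $\Lambda$ can be written in such a form for all $(q_1,q_2)$ on $\mathbb{T}^2$.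
   Context: All objects are smooth. $\mathbb{T}^2=\mathbb{R}^2/\Gamma$, $\Gamma$ a lattice; $H:T^*\mathbb{T}^2\to\mathbb{R}$ is half the squared norm of the momentum. A first integral is a function $F$ on the cotangent bundle with $\{F,H\}=0$. Conformal coordinates: global coordinates $(q_1,q_2)$ on the covering plane with $ds^2=\Lambda(q_1,q_2)(dq_1^2+dq_2^2)$, $H=\frac{1}{2\Lambda}(p_1^2+p_2^2)$, where $\Lambda>0$ is periodic with respect to the lattice $\Gamma$. Normalized semi-geodesic coordinates (standing assumption; it is known that they exist): using a regular Liouville torus $L$ of the geodesic flow (a common level set of $F_n$ and $H$ on which $dF_n,dH$ are independent) that projects diffeomorphically onto $\mathbb{T}^2$, one has global coordinates $(t,x)$ on the covering plane, with conjugate momenta $(p_1,p_2)$, such that the curves $\{t=\text{const}\}$ are the geodesics of $L$ and $ds^2=g^2(t,x)\,dt^2+dx^2$, $g>0$, $H=\tfrac12(p_1^2/g^2+p_2^2)$ (this $g$ is unrelated to the one-variable function $g$ in the claim). The integral is written $F_n=\sum_{k=0}^n a_k(t,x)\frac{p_1^{n-k}}{g^{n-k}}p_2^k$, normalized so that $a_{n-1}\equiv g$, $a_n\equiv 1$. For $n=4$, with $U=(a_0,a_1,a_2,a_3)^T$ and $a_4=1$, the condition $\{F_4,H\}=0$ becomes $U_t+A(U)U_x=0$ with $$A(U)=\begin{pmatrix}0&0&0&a_1\\ a_3&0&0&2a_2-4a_0\\ 0&a_3&0&3a_3-3a_1\\ 0&0&a_3&4a_4-2a_2\end{pmatrix}.$$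 Elliptic region: a (nonempty) connected component $\Omega_e$ of the set of points of $\mathbb{T}^2$ at which the eigenvalues of $A(U)$ are distinct and two of them are non-real complex conjugates (the other two are then necessarily real). *)

theory Defs
  imports "HOL-Analysis.Analysis"
begin

section \<open>Smooth and real analytic functions\<close>

primrec Ck_on :: "nat \<Rightarrow> ('a::real_normed_vector \<Rightarrow> 'b::real_normed_vector) \<Rightarrow> 'a set \<Rightarrow> bool" where
  "Ck_on 0 f S \<longleftrightarrow> continuous_on S f"
| "Ck_on (Suc k) f S \<longleftrightarrow>
     (\<forall>x\<in>S. f differentiable (at x)) \<and> (\<forall>v. Ck_on k (\<lambda>x. frechet_derivative f (at x) v) S)"

text \<open>Only used with an open set \<open>S\<close> in a finite-dimensional space.\<close>

definition smooth_on :: "('a::real_normed_vector \<Rightarrow> 'b::real_normed_vector) \<Rightarrow> 'a set \<Rightarrow> bool" where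
  "smooth_on f S \<longleftrightarrow> (\<forall>k. Ck_on k f S)"

abbreviation smooth :: "('a::real_normed_vector \<Rightarrow> 'b::real_normed_vector) \<Rightarrow> bool" where
  "smooth f \<equiv> smooth_on f UNIV"

definition real_analytic :: "(real^2 \<Rightarrow> real) \<Rightarrow> bool" where
  "real_analytic f \<longleftrightarrow>
     (\<forall>x. \<exists>r>0. \<exists>c :: nat \<Rightarrow> nat \<Rightarrow> real. \<forall>y\<in>ball x r.
        ((\<lambda>(i, j). c i j * (y$1 - x$1) ^ i * (y$2 - x$2) ^ j) has_sum f y) UNIV)"

definition partial :: "2 \<Rightarrow> (real^2 \<Rightarrow> real) \<Rightarrow> real^2 \<Rightarrow> real" where
  "partial i f x = frechet_derivative f (at x) (axis i 1)"


section \<open>The torus as a quotient of the plane\<close>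

definition is_lattice :: "(real^2) set \<Rightarrow> bool" where
  "is_lattice \<Gamma> \<longleftrightarrow>
     (\<exists>a b. a \<noteq> b \<and> independent {a, b} \<and>
        \<Gamma> = {of_int i *\<^sub>R a + of_int j *\<^sub>R b | i j. True})"

definition periodic :: "(real^2) set \<Rightarrow> (real^2 \<Rightarrow> 'b) \<Rightarrow> bool" where
  "periodic \<Gamma> f \<longleftrightarrow> (\<forall>q. \<forall>\<gamma>\<in>\<Gamma>. f (q + \<gamma>) = f q)"

definition torus_proj :: "(real^2) set \<Rightarrow> real^2 \<Rightarrow> (real^2) set" where
  "torus_proj \<Gamma> q = (\<lambda>\<gamma>. q + \<gamma>) ` \<Gamma>"

definition torus :: "(real^2) set \<Rightarrow> (real^2) set topology" where
  "torus \<Gamma> = topology (\<lambda>U. U \<subseteq> range (torus_proj \<Gamma>) \<and> open (torus_proj \<Gamma> -` U))"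

lemma openin_torus:
  "openin (torus \<Gamma>) U \<longleftrightarrow> U \<subseteq> range (torus_proj \<Gamma>) \<and> open (torus_proj \<Gamma> -` U)"
proof -
  have "istopology (\<lambda>U. U \<subseteq> range (torus_proj \<Gamma>) \<and> open (torus_proj \<Gamma> -` U))"
    unfolding istopology_def by (auto simp: vimage_Union intro!: open_UN)
  then show ?thesis
    unfolding torus_def by simp
qed

lemma topspace_torus: "topspace (torus \<Gamma>) = range (torus_proj \<Gamma>)"
proof -
  have "openin (torus \<Gamma>) (range (torus_proj \<Gamma>))"
    by (simp add: openin_torus vimage_def)
  then show ?thesis
    by (metis openin_subset openin_topspace openin_torus subset_antisym)
qed

lemma quotient_map_torus_proj: "quotient_map euclidean (torus \<Gamma>) (torus_proj \<Gamma>)"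
  unfolding quotient_map_def topspace_torus openin_torus by (auto simp: vimage_def)

text \<open>
  The coordinates \<open>(q\<^sub>1, q\<^sub>2)\<close> are single-valued on the covering plane only. A formula in
  \<open>(q\<^sub>1, q\<^sub>2)\<close> over a region of the torus is read on a lift of the region, i.e. on a
  connected component of its preimage. The lifts of a connected open region are translates of
  one another by lattice vectors.
\<close>

definition lifts :: "(real^2) set \<Rightarrow> (real^2) set set \<Rightarrow> (real^2) set set" where
  "lifts \<Gamma> \<Omega> = components (torus_proj \<Gamma> -` \<Omega>)"


section \<open>Riemannian metrics, pullback and flatness\<close>

definition torus_metric :: "(real^2) set \<Rightarrow> (real^2 \<Rightarrow> real^2^2) \<Rightarrow> bool" where
  "torus_metric \<Gamma> \<rho> \<longleftrightarrow>
     smooth \<rho> \<and> periodic \<Gamma> \<rho> \<and>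
     (\<forall>q. transpose (\<rho> q) = \<rho> q) \<and> (\<forall>q v. v \<noteq> 0 \<longrightarrow> v \<bullet> (\<rho> q *v v) > 0)"

definition real_analytic_metric :: "(real^2 \<Rightarrow> real^2^2) \<Rightarrow> bool" where
  "real_analytic_metric \<rho> \<longleftrightarrow> (\<forall>i j. real_analytic (\<lambda>q. \<rho> q $ i $ j))"

definition pullback_metric ::
    "(real^2 \<Rightarrow> real^2) \<Rightarrow> (real^2 \<Rightarrow> real^2^2) \<Rightarrow> real^2 \<Rightarrow> real^2^2" where
  "pullback_metric \<Phi> \<rho> y =
     transpose (jacobian \<Phi> (at y)) ** \<rho> (\<Phi> y) ** jacobian \<Phi> (at y)"

definition christoffel :: "(real^2 \<Rightarrow> real^2^2) \<Rightarrow> 2 \<Rightarrow> 2 \<Rightarrow> 2 \<Rightarrow> real^2 \<Rightarrow> real" where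
  "christoffel \<rho> k i j q =
     (\<Sum>l\<in>UNIV. matrix_inv (\<rho> q) $ k $ l *
        (partial i (\<lambda>x. \<rho> x $ j $ l) q + partial j (\<lambda>x. \<rho> x $ i $ l) q
          - partial l (\<lambda>x. \<rho> x $ i $ j) q)) / 2"

text \<open>The component \<open>R\<^sup>l\<^bsub>kij\<^esub>\<close> of the Riemann curvature tensor.\<close>

definition riemann_tensor :: "(real^2 \<Rightarrow> real^2^2) \<Rightarrow> 2 \<Rightarrow> 2 \<Rightarrow> 2 \<Rightarrow> 2 \<Rightarrow> real^2 \<Rightarrow> real" where
  "riemann_tensor \<rho> l k i j q =
     partial i (christoffel \<rho> l j k) q - partial j (christoffel \<rho> l i k) q
     + (\<Sum>m\<in>UNIV. christoffel \<rho> l i m q * christoffel \<rho> m j k q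
                 - christoffel \<rho> l j m q * christoffel \<rho> m i k q)"

definition flat_on :: "(real^2 \<Rightarrow> real^2^2) \<Rightarrow> (real^2) set \<Rightarrow> bool" where
  "flat_on \<rho> S \<longleftrightarrow> (\<forall>q\<in>S. \<forall>l k i j. riemann_tensor \<rho> l k i j q = 0)"


section \<open>Geodesic flow and first integrals\<close>

text \<open>
  The cotangent bundle of the covering plane is \<open>real^2 \<times> real^2\<close>, consisting of pairs
  \<open>(q, p)\<close> of position and conjugate momentum; functions on the cotangent bundle of the torus
  are the functions on it that are periodic in \<open>q\<close>.
\<close>

definition hamiltonian :: "(real^2 \<Rightarrow> real^2^2) \<Rightarrow> (real^2) \<times> (real^2) \<Rightarrow> real" where
  "hamiltonian \<rho> z = (snd z \<bullet> (matrix_inv (\<rho> (fst z)) *v snd z)) / 2"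

definition dq :: "((real^2) \<times> (real^2) \<Rightarrow> real) \<Rightarrow> (real^2) \<times> (real^2) \<Rightarrow> real^2" where
  "dq F z = (\<chi> i. frechet_derivative F (at z) (axis i 1, 0))"

definition dp :: "((real^2) \<times> (real^2) \<Rightarrow> real) \<Rightarrow> (real^2) \<times> (real^2) \<Rightarrow> real^2" where
  "dp F z = (\<chi> i. frechet_derivative F (at z) (0, axis i 1))"

definition poisson_bracket ::
    "((real^2) \<times> (real^2) \<Rightarrow> real) \<Rightarrow> ((real^2) \<times> (real^2) \<Rightarrow> real) \<Rightarrow> (real^2) \<times> (real^2) \<Rightarrow> real" where
  "poisson_bracket F G z = dq F z \<bullet> dp G z - dp F z \<bullet> dq G z"

definition geodesic_trajectory ::
    "(real^2 \<Rightarrow> real^2^2) \<Rightarrow> (real \<Rightarrow> (real^2) \<times> (real^2)) \<Rightarrow> bool" where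
  "geodesic_trajectory \<rho> z \<longleftrightarrow>
     (\<forall>s. (z has_vector_derivative (dp (hamiltonian \<rho>) (z s), - dq (hamiltonian \<rho>) (z s))) (at s))"

definition momentum_polynomial ::
    "(real^2) set \<Rightarrow> nat \<Rightarrow> ((real^2) \<times> (real^2) \<Rightarrow> real) \<Rightarrow> bool" where
  "momentum_polynomial \<Gamma> n F \<longleftrightarrow>
     (\<exists>c :: nat \<Rightarrow> real^2 \<Rightarrow> real.
        (\<forall>k\<le>n. smooth (c k) \<and> periodic \<Gamma> (c k)) \<and>
        (\<forall>q p. F (q, p) = (\<Sum>k\<le>n. c k q * (p$1) ^ (n - k) * (p$2) ^ k)))"

definition first_integral ::
    "(real^2 \<Rightarrow> real^2^2) \<Rightarrow> ((real^2) \<times> (real^2) \<Rightarrow> real) \<Rightarrow> bool" where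
  "first_integral \<rho> F \<longleftrightarrow> (\<forall>z. poisson_bracket F (hamiltonian \<rho>) z = 0)"


section \<open>Liouville tori and normalized semi-geodesic coordinates\<close>

definition differentials_independent ::
    "((real^2) \<times> (real^2) \<Rightarrow> real) \<Rightarrow> ((real^2) \<times> (real^2) \<Rightarrow> real) \<Rightarrow> (real^2) \<times> (real^2) \<Rightarrow> bool" where
  "differentials_independent F G z \<longleftrightarrow>
     (\<forall>\<alpha> \<beta>. (\<forall>v. \<alpha> * frechet_derivative F (at z) v + \<beta> * frechet_derivative G (at z) v = 0)
            \<longrightarrow> \<alpha> = 0 \<and> \<beta> = 0)"

text \<open>
  A regular Liouville torus that projects diffeomorphically onto the base torus, given by its
  preimage \<open>L\<close> in the cotangent bundle of the covering plane. Since \<open>F\<close> and the Hamiltonian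
  may be even in the momenta, only a connected component of a common level set can be a graph.
\<close>

definition liouville_torus_graph ::
    "(real^2) set \<Rightarrow> (real^2 \<Rightarrow> real^2^2) \<Rightarrow> ((real^2) \<times> (real^2) \<Rightarrow> real)
      \<Rightarrow> ((real^2) \<times> (real^2)) set \<Rightarrow> bool" where
  "liouville_torus_graph \<Gamma> \<rho> F L \<longleftrightarrow>
     (\<exists>c h. L \<in> components {z. F z = c \<and> hamiltonian \<rho> z = h}) \<and>
     (\<forall>z\<in>L. differentials_independent F (hamiltonian \<rho>) z) \<and>
     (\<exists>P. smooth P \<and> periodic \<Gamma> P \<and> L = {(q, P q) | q. True})"

definition global_coordinates :: "(real^2 \<Rightarrow> real^2) \<Rightarrow> bool" where
  "global_coordinates \<Phi> \<longleftrightarrow> bij \<Phi> \<and> smooth \<Phi> \<and> smooth (inv \<Phi>)"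

text \<open>
  \<open>\<Phi>\<close> maps the coordinates \<open>(t, x)\<close> to \<open>q\<close>; \<open>P\<close> are the momenta conjugate to
  \<open>(t, x)\<close> at the covector \<open>p\<close> over \<open>q = \<Phi> y\<close>.
\<close>

definition semigeodesic_coordinates ::
    "(real^2) set \<Rightarrow> (real^2 \<Rightarrow> real^2^2) \<Rightarrow> ((real^2) \<times> (real^2) \<Rightarrow> real) \<Rightarrow> nat
      \<Rightarrow> ((real^2) \<times> (real^2)) set \<Rightarrow> (real^2 \<Rightarrow> real^2) \<Rightarrow> (real^2 \<Rightarrow> real) \<Rightarrow> (nat \<Rightarrow> real^2 \<Rightarrow> real)
      \<Rightarrow> bool" where
  "semigeodesic_coordinates \<Gamma> \<rho> F n L \<Phi> g a \<longleftrightarrow>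
     liouville_torus_graph \<Gamma> \<rho> F L \<and>
     global_coordinates \<Phi> \<and>
     (\<forall>t. \<exists>z. geodesic_trajectory \<rho> z \<and> range z \<subseteq> L \<and>
            range (\<lambda>s. fst (z s)) = range (\<lambda>x. \<Phi> (vector [t, x]))) \<and>
     smooth g \<and> (\<forall>y. g y > 0) \<and>
     (\<forall>y. pullback_metric \<Phi> \<rho> y = vector [vector [(g y)\<^sup>2, 0], vector [0, 1]]) \<and>
     (\<forall>k\<le>n. smooth (a k)) \<and>
     (\<forall>y p. let P = transpose (jacobian \<Phi> (at y)) *v p in
        F (\<Phi> y, p) = (\<Sum>k\<le>n. a k y * ((P$1) ^ (n - k) / (g y) ^ (n - k)) * (P$2) ^ k))"

definition normalized_semigeodesic_coordinates ::
    "(real^2) set \<Rightarrow> (real^2 \<Rightarrow> real^2^2) \<Rightarrow> ((real^2) \<times> (real^2) \<Rightarrow> real) \<Rightarrow> nat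
      \<Rightarrow> ((real^2) \<times> (real^2)) set \<Rightarrow> (real^2 \<Rightarrow> real^2) \<Rightarrow> (real^2 \<Rightarrow> real) \<Rightarrow> (nat \<Rightarrow> real^2 \<Rightarrow> real)
      \<Rightarrow> bool" where
  "normalized_semigeodesic_coordinates \<Gamma> \<rho> F n L \<Phi> g a \<longleftrightarrow>
     semigeodesic_coordinates \<Gamma> \<rho> F n L \<Phi> g a \<and>
     (\<forall>y. a (n - 1) y = g y) \<and> (\<forall>y. a n y = 1)"


section \<open>Elliptic regions\<close>

text \<open>The matrix \<open>A(U)\<close> of the system \<open>U\<^sub>t + A(U) U\<^sub>x = 0\<close> for degree 4, as a function of
  the values \<open>a 0, \<dots>, a 4\<close> of the coefficients.\<close>

definition quartic_matrix :: "(nat \<Rightarrow> real) \<Rightarrow> real^4^4" where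
  "quartic_matrix a = vector
     [vector [0,   0,   0,   a 1],
      vector [a 3, 0,   0,   2 * a 2 - 4 * a 0],
      vector [0,   a 3, 0,   3 * a 3 - 3 * a 1],
      vector [0,   0,   a 3, 4 * a 4 - 2 * a 2]]"

definition complex_eigenvalues :: "real^'n^'n \<Rightarrow> complex set" where
  "complex_eigenvalues M =
     {\<mu>. \<exists>v. v \<noteq> 0 \<and> (\<chi> i j. complex_of_real (M $ i $ j)) *v v = \<mu> *s v}"

definition elliptic_matrix :: "real^4^4 \<Rightarrow> bool" where
  "elliptic_matrix M \<longleftrightarrow>
     card (complex_eigenvalues M) = 4 \<and>
     (\<exists>\<mu>. \<mu> \<in> complex_eigenvalues M \<and> cnj \<mu> \<in> complex_eigenvalues M \<and> \<mu> \<notin> \<real>)"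

definition elliptic_set ::
    "(real^2) set \<Rightarrow> (real^2 \<Rightarrow> real^2) \<Rightarrow> (nat \<Rightarrow> real^2 \<Rightarrow> real) \<Rightarrow> (real^2) set set" where
  "elliptic_set \<Gamma> \<Phi> a =
     {torus_proj \<Gamma> (\<Phi> y) | y. elliptic_matrix (quartic_matrix (\<lambda>k. a k y))}"

definition elliptic_region ::
    "(real^2) set \<Rightarrow> (real^2 \<Rightarrow> real^2) \<Rightarrow> (nat \<Rightarrow> real^2 \<Rightarrow> real) \<Rightarrow> (real^2) set set \<Rightarrow> bool" where
  "elliptic_region \<Gamma> \<Phi> a \<Omega> \<longleftrightarrow>
     \<Omega> \<in> connected_components_of (subtopology (torus \<Gamma>) (elliptic_set \<Gamma> \<Phi> a))"


section \<open>Separated conformal factors\<close>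

definition separated_along ::
    "(real^2 \<Rightarrow> real) \<Rightarrow> real \<Rightarrow> real \<Rightarrow> real \<Rightarrow> real \<Rightarrow> (real^2) set \<Rightarrow> bool" where
  "separated_along \<Lambda> m\<^sub>1 n\<^sub>1 m\<^sub>2 n\<^sub>2 S \<longleftrightarrow>
     (\<exists>f g :: real \<Rightarrow> real.
        smooth_on f ((\<lambda>q. m\<^sub>1 * q$1 + n\<^sub>1 * q$2) ` S) \<and>
        smooth_on g ((\<lambda>q. m\<^sub>2 * q$1 + n\<^sub>2 * q$2) ` S) \<and>
        (\<forall>q\<in>S. \<Lambda> q = f (m\<^sub>1 * q$1 + n\<^sub>1 * q$2) + g (m\<^sub>2 * q$1 + n\<^sub>2 * q$2)))"

definition orthogonal_directions :: "real \<Rightarrow> real \<Rightarrow> real \<Rightarrow> real \<Rightarrow> bool" where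
  "orthogonal_directions m\<^sub>1 n\<^sub>1 m\<^sub>2 n\<^sub>2 \<longleftrightarrow>
     (m\<^sub>1, n\<^sub>1) \<noteq> (0, 0) \<and> (m\<^sub>2, n\<^sub>2) \<noteq> (0, 0) \<and> m\<^sub>1 * m\<^sub>2 + n\<^sub>1 * n\<^sub>2 = 0"

end

theory Submission
  imports Defs "HOL-Complex_Analysis.Cauchy_Integral_Formula" "HOL-Computational_Algebra.Fundamental_Theorem_Algebra"
begin

text \<open>
  In the complex coordinate \<open>z = q\<^sub>1 + \<i> q\<^sub>2\<close> the integral has the coefficients
  \<open>A, B, C, cnj B, cnj A\<close>, and the vanishing of the Poisson bracket makes \<open>A\<close> antiholomorphic and
  bounded, hence constant. If \<open>A = 0\<close>, the integral reduces to a quadratic one and the metric is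
  globally separated.

  If \<open>A \<noteq> 0\<close>, the eigenvalues of the quasilinear system are the critical points of the integral on
  the unit circle bundle, and ellipticity produces a critical point \<open>w(z)\<close> in the open unit disc.
  The critical value \<open>r\<close> at \<open>w\<close> is a complex Riemann invariant, which satisfies
  \<open>w r\<^sub>z + r\<^sub>b = 0\<close> (\<open>b\<close> marks the derivative by \<open>cnj z\<close>), and \<open>Im r\<close> vanishes on the boundary of the
  elliptic set \<open>E\<close>. Integrating the Jacobian of \<open>r\<close> over a period parallelogram shows that \<open>r\<close> is
  constant where \<open>Im r \<noteq> 0\<close>.

  If there is such a point, \<open>E\<close> is the whole plane. The two remaining real Riemann invariants are
  genuinely nonlinear and, by the Riccati equation for their derivatives, constant too; then the
  conformal factor is constant. Otherwise \<open>r\<close> is real and stationary on \<open>E\<close>, the argument of \<open>w\<close> is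
  locally constant, and with \<open>d\<^sup>2 = sgn w\<close> the functions \<open>\<Lambda> (1 - |w|)\<^sup>2 / |w|\<close> and
  \<open>\<Lambda> (1 + |w|)\<^sup>2 / |w|\<close> are constant along \<open>d\<close> and \<open>\<i> d\<close>. The first of them tends to zero at the
  boundary of \<open>E\<close>, so \<open>E\<close> is a union of parallel lines, and \<open>4 \<Lambda>\<close> is the difference of the two.
\<close>

text \<open>Ellipticity is stated by eigenvalues in semi-geodesic coordinates, everything else
  happens in z. On a cotangent fibre the two descriptions differ by an orthogonal map and a scaling,
  and the Cayley transform \<zeta> = (1 + \<i> s) / (1 - \<i> s) of s = \<mu> / \<open>a 3\<close>
  sends eigenvalues to critical points, real ones to the unit circle. The critical quartic is
  invariant, up to a factor, under reflection in that circle. Hence a root w in the open disc comes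
  with 1 / cnj w, and the two remaining roots are distinct and lie on the circle. So w is unique and
  simple, and at the boundary of E it can only run into the circle. No differentiability of w is
  available there; the Jacobian argument therefore cuts r off where Im r is small, in particular
  near the boundary. The circle roots satisfy the same first-order equation with |\<zeta>| = 1.
  Their critical values are real, so their Jacobian is identically zero and says nothing; this is
  why the Riccati equation takes its place.\<close>

section \<open>Wirtinger calculus\<close>

definition wirt :: "(complex \<Rightarrow> complex) \<Rightarrow> complex \<Rightarrow> complex \<Rightarrow> complex \<Rightarrow> bool" where
  "wirt f a b z \<longleftrightarrow> (f has_derivative (\<lambda>h. a * h + b * cnj h)) (at z)"

lemma wirt_cong: "wirt f a b z \<Longrightarrow> a = a' \<Longrightarrow> b = b' \<Longrightarrow> wirt f a' b' z"
  by simp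

lemma wirt_transform_open:
  assumes "wirt f a b z" "open S" "z \<in> S" "\<And>w. w \<in> S \<Longrightarrow> f w = g w"
  shows "wirt g a b z"
  using has_derivative_transform_within_open[OF assms(1)[unfolded wirt_def] assms(2,3,4)]
  unfolding wirt_def by blast

text \<open>A real-linear map of the plane is h |-> a h + b cnj h for exactly one pair (a, b), which
  its values at 1 and \<i> recover. Coefficients found in two ways can therefore be
  compared.\<close>

lemma wirt_unique:
  assumes "wirt f a b z" "wirt f a' b' z"
  shows "a = a'" "b = b'"
proof -
  have eq: "(\<lambda>h. a * h + b * cnj h) = (\<lambda>h. a' * h + b' * cnj h)"
    using assms unfolding wirt_def by (rule has_derivative_unique)
  have 1: "a + b = a' + b'" using fun_cong[OF eq, of 1] by simp
  have "\<i> * (a - b) = \<i> * (a' - b')" using fun_cong[OF eq, of \<i>] by (simp add: algebra_simps)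
  then have 2: "a - b = a' - b'" by simp
  have "a = ((a + b) + (a - b)) / 2" "b = ((a + b) - (a - b)) / 2" by auto
  with 1 2 show "a = a'" "b = b'" by simp_all
qed

lemma wirt_continuous: "wirt f a b z \<Longrightarrow> isCont f z"
  unfolding wirt_def by (rule has_derivative_continuous)

lemma wirt_const: "wirt (\<lambda>z. c) 0 0 z"
  unfolding wirt_def by (auto intro!: derivative_eq_intros)

lemma wirt_cnj: "wirt f a b z \<Longrightarrow> wirt (\<lambda>z. cnj (f z)) (cnj b) (cnj a) z"
  unfolding wirt_def
  by (drule has_derivative_cnj, erule has_derivative_eq_rhs) (simp add: fun_eq_iff)

lemma wirt_add: "wirt f a b z \<Longrightarrow> wirt g a' b' z \<Longrightarrow> wirt (\<lambda>z. f z + g z) (a + a') (b + b') z"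
  unfolding wirt_def
  by (drule (1) has_derivative_add, erule has_derivative_eq_rhs) (simp add: fun_eq_iff algebra_simps)

lemma wirt_diff: "wirt f a b z \<Longrightarrow> wirt g a' b' z \<Longrightarrow> wirt (\<lambda>z. f z - g z) (a - a') (b - b') z"
  unfolding wirt_def
  by (drule (1) has_derivative_diff, erule has_derivative_eq_rhs) (simp add: fun_eq_iff algebra_simps)

lemma wirt_minus: "wirt f a b z \<Longrightarrow> wirt (\<lambda>z. - f z) (- a) (- b) z"
  unfolding wirt_def
  by (drule has_derivative_minus, erule has_derivative_eq_rhs) (simp add: fun_eq_iff)

lemma wirt_mult:
  "wirt f a b z \<Longrightarrow> wirt g a' b' z \<Longrightarrow>
    wirt (\<lambda>z. f z * g z) (a * g z + f z * a') (b * g z + f z * b') z"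
  unfolding wirt_def
  by (drule (1) has_derivative_mult, erule has_derivative_eq_rhs) (simp add: fun_eq_iff algebra_simps)

lemma wirt_inverse:
  assumes "wirt f a b z" "f z \<noteq> 0"
  shows "wirt (\<lambda>z. inverse (f z)) (- a / (f z)\<^sup>2) (- b / (f z)\<^sup>2) z"
proof -
  have "((\<lambda>z. inverse (f z)) has_derivative
      (\<lambda>h. - (inverse (f z) * (a * h + b * cnj h) * inverse (f z)))) (at z)"
    by (rule Deriv.has_derivative_inverse[OF assms(2) assms(1)[unfolded wirt_def]])
  then show ?thesis unfolding wirt_def
    by (rule has_derivative_eq_rhs) (simp add: fun_eq_iff divide_inverse power2_eq_square algebra_simps)
qed

lemma wirt_divide:
  assumes "wirt f a b z" "wirt g a' b' z" "g z \<noteq> 0"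
  shows "wirt (\<lambda>z. f z / g z) ((a * g z - f z * a') / (g z)\<^sup>2) ((b * g z - f z * b') / (g z)\<^sup>2) z"
proof -
  have "wirt (\<lambda>z. f z * inverse (g z)) (a * inverse (g z) + f z * (- a' / (g z)\<^sup>2))
      (b * inverse (g z) + f z * (- b' / (g z)\<^sup>2)) z"
    by (rule wirt_mult[OF assms(1) wirt_inverse[OF assms(2,3)]])
  then have "wirt (\<lambda>z. f z / g z) (a * inverse (g z) + f z * (- a' / (g z)\<^sup>2))
      (b * inverse (g z) + f z * (- b' / (g z)\<^sup>2)) z"
    by (simp only: divide_inverse)
  then show ?thesis
    by (rule wirt_cong) (use assms(3) in \<open>simp_all add: field_simps power2_eq_square\<close>)
qed

lemma wirt_power:
  assumes "wirt f a b z"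
  shows "wirt (\<lambda>z. f z ^ n) (of_nat n * f z ^ (n - 1) * a) (of_nat n * f z ^ (n - 1) * b) z"
  using has_derivative_power[OF assms[unfolded wirt_def], of n] unfolding wirt_def
  by (rule has_derivative_eq_rhs) (simp add: fun_eq_iff algebra_simps)

lemma has_derivative_Re_wirt: "wirt f a b z \<Longrightarrow> ((\<lambda>z. Re (f z)) has_derivative (\<lambda>h. Re (a * h + b * cnj h))) (at z)"
  unfolding wirt_def by (rule has_derivative_Re)

lemma has_derivative_Im_wirt: "wirt f a b z \<Longrightarrow> ((\<lambda>z. Im (f z)) has_derivative (\<lambda>h. Im (a * h + b * cnj h))) (at z)"
  unfolding wirt_def by (rule has_derivative_Im)

text \<open>Conjugating a function exchanges and conjugates its two derivatives. Combined with the
  equation of a critical value r, reality ties r_z to its own conjugate.\<close>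

lemma wirt_real_valued:
  assumes "wirt f a b z" "open S" "z \<in> S" "\<And>w. w \<in> S \<Longrightarrow> cnj (f w) = f w"
  shows "b = cnj a"
proof -
  have "wirt f (cnj b) (cnj a) z"
    by (rule wirt_transform_open[OF wirt_cnj[OF assms(1)] assms(2,3)]) (use assms(4) in auto)
  from wirt_unique[OF this assms(1)] show ?thesis by simp
qed

subsection \<open>Continuously differentiable functions\<close>

definition C1 :: "complex set \<Rightarrow> (complex \<Rightarrow> complex) \<Rightarrow> bool" where
  "C1 S f \<longleftrightarrow> (\<exists>a b. (\<forall>z\<in>S. wirt f (a z) (b z) z) \<and> continuous_on S a \<and> continuous_on S b)"

lemma C1I:
  "(\<And>z. z \<in> S \<Longrightarrow> wirt f (a z) (b z) z) \<Longrightarrow> continuous_on S a \<Longrightarrow> continuous_on S b \<Longrightarrow> C1 S f"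
  unfolding C1_def by blast

lemma C1_subset:
  assumes "C1 S f" "T \<subseteq> S"
  shows "C1 T f"
proof -
  obtain a b where f: "\<And>z. z \<in> S \<Longrightarrow> wirt f (a z) (b z) z" "continuous_on S a" "continuous_on S b"
    using assms(1) unfolding C1_def by blast
  show ?thesis
    by (rule C1I[of _ _ a b]) (use assms(2) in \<open>auto intro: f(1) continuous_on_subset[OF f(2)] continuous_on_subset[OF f(3)]\<close>)
qed

lemma C1_continuous:
  assumes "C1 S f"
  shows "continuous_on S f"
proof -
  obtain a b where f: "\<And>z. z \<in> S \<Longrightarrow> wirt f (a z) (b z) z"
    using assms unfolding C1_def by blast
  show ?thesis
    by (rule continuous_at_imp_continuous_on) (use f wirt_continuous in blast)
qed

lemma C1_const: "C1 S (\<lambda>z. c)"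
  by (rule C1I[OF wirt_const]) auto

lemma C1_cnj:
  assumes "C1 S f"
  shows "C1 S (\<lambda>z. cnj (f z))"
proof -
  obtain a b where f: "\<And>z. z \<in> S \<Longrightarrow> wirt f (a z) (b z) z" "continuous_on S a" "continuous_on S b"
    using assms unfolding C1_def by blast
  show ?thesis
  proof (rule C1I)
    show "wirt (\<lambda>z. cnj (f z)) (cnj (b z)) (cnj (a z)) z" if "z \<in> S" for z
      using f(1)[OF that] by (rule wirt_cnj)
  qed (intro continuous_on_cnj f)+
qed

lemma C1_add:
  assumes "C1 S f" "C1 S g"
  shows "C1 S (\<lambda>z. f z + g z)"
proof -
  obtain a b where f: "\<And>z. z \<in> S \<Longrightarrow> wirt f (a z) (b z) z" "continuous_on S a" "continuous_on S b"
    using assms(1) unfolding C1_def by blast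
  obtain a' b' where g: "\<And>z. z \<in> S \<Longrightarrow> wirt g (a' z) (b' z) z" "continuous_on S a'" "continuous_on S b'"
    using assms(2) unfolding C1_def by blast
  show ?thesis
  proof (rule C1I)
    show "wirt (\<lambda>z. f z + g z) (a z + a' z) (b z + b' z) z" if "z \<in> S" for z
      using f(1)[OF that] g(1)[OF that] by (rule wirt_add)
  qed (intro continuous_on_add f g)+
qed

lemma C1_mult:
  assumes "C1 S f" "C1 S g"
  shows "C1 S (\<lambda>z. f z * g z)"
proof -
  note cf = C1_continuous[OF assms(1)] C1_continuous[OF assms(2)]
  obtain a b where f: "\<And>z. z \<in> S \<Longrightarrow> wirt f (a z) (b z) z" "continuous_on S a" "continuous_on S b"
    using assms(1) unfolding C1_def by blast
  obtain a' b' where g: "\<And>z. z \<in> S \<Longrightarrow> wirt g (a' z) (b' z) z" "continuous_on S a'" "continuous_on S b'"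
    using assms(2) unfolding C1_def by blast
  show ?thesis
  proof (rule C1I)
    show "wirt (\<lambda>z. f z * g z) (a z * g z + f z * a' z) (b z * g z + f z * b' z) z" if "z \<in> S" for z
      using f(1)[OF that] g(1)[OF that] by (rule wirt_mult)
  qed (intro continuous_on_add continuous_on_mult f g cf)+
qed

lemma C1_minus: "C1 S f \<Longrightarrow> C1 S (\<lambda>z. - f z)"
  using C1_mult[OF C1_const[of S "-1"], of f] by simp

lemma C1_diff: "C1 S f \<Longrightarrow> C1 S g \<Longrightarrow> C1 S (\<lambda>z. f z - g z)"
  using C1_add[OF _ C1_minus, of S f g] by simp

lemma C1_inverse: 
  assumes f: "C1 S f" and nz: "\<And>z. z \<in> S \<Longrightarrow> f z \<noteq> 0" 
  shows "C1 S (\<lambda>z. inverse (f z))"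
proof -
  note cf = C1_continuous[OF f]
  obtain a b where ab: "\<And>z. z \<in> S \<Longrightarrow> wirt f (a z) (b z) z" "continuous_on S a" "continuous_on S b"
    using f unfolding C1_def by blast
  show ?thesis
  proof (rule C1I)
    show "wirt (\<lambda>z. inverse (f z)) (- a z / (f z)\<^sup>2) (- b z / (f z)\<^sup>2) z" if "z \<in> S" for z
      using ab(1)[OF that] nz[OF that] by (rule wirt_inverse)
  qed (intro continuous_on_minus continuous_on_divide continuous_on_power ab cf; simp add: nz)+
qed

lemma C1_divide: "C1 S f \<Longrightarrow> C1 S g \<Longrightarrow> (\<And>z. z \<in> S \<Longrightarrow> g z \<noteq> 0) \<Longrightarrow> C1 S (\<lambda>z. f z / g z)"
  using C1_mult[OF _ C1_inverse, of S f g] by (simp add: divide_inverse)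

lemma C1_power: "C1 S f \<Longrightarrow> C1 S (\<lambda>z. f z ^ n)"
proof (induction n)
  case 0
  then show ?case using C1_const[of S 1] by simp
next
  case (Suc n)
  then show ?case using C1_mult[OF Suc.prems Suc.IH[OF Suc.prems]] by simp
qed

lemmas C1_intros = C1_const C1_cnj C1_add C1_diff C1_minus C1_mult C1_inverse C1_divide C1_power

subsection \<open>Symmetry of second derivatives\<close>

text \<open>The mean value theorem is used twice, first for the increment along k as a function of
  s, then for the derivative along h as a function of s'. The left-hand side is symmetric in h and
  k.\<close>

lemma mixed_difference:
  fixes f :: "'a::real_normed_vector \<Rightarrow> real"
  assumes t: "t > 0"
    and S: "\<And>s s'. s \<in> {0..t} \<Longrightarrow> s' \<in> {0..t} \<Longrightarrow> x + s *\<^sub>R h + s' *\<^sub>R k \<in> S"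
    and f: "\<And>z. z \<in> S \<Longrightarrow> (f has_derivative f' z) (at z)"
    and g: "\<And>z. z \<in> S \<Longrightarrow> ((\<lambda>z. f' z h) has_derivative g z) (at z)"
  shows "\<exists>s\<in>{0<..<t}. \<exists>s'\<in>{0<..<t}.
    f (x + t *\<^sub>R h + t *\<^sub>R k) - f (x + t *\<^sub>R h) - f (x + t *\<^sub>R k) + f x = t\<^sup>2 * g (x + s *\<^sub>R h + s' *\<^sub>R k) k"
proof -
  define \<phi> where "\<phi> s = f (x + s *\<^sub>R h + t *\<^sub>R k) - f (x + s *\<^sub>R h + 0 *\<^sub>R k)" for s
  have lin: "linear (f' z)" if "z \<in> S" for z using f[OF that] by (rule has_derivative_linear)
  have d1: "((\<lambda>s. f (x + s *\<^sub>R h + s' *\<^sub>R k)) has_real_derivative f' (x + s *\<^sub>R h + s' *\<^sub>R k) h) (at s)"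
    if "s \<in> {0..t}" "s' \<in> {0..t}" for s s'
  proof -
    have "((\<lambda>s. x + s *\<^sub>R h + s' *\<^sub>R k) has_derivative (\<lambda>r. r *\<^sub>R h)) (at s)"
      by (auto intro!: derivative_eq_intros)
    from diff_chain_at[OF this f[OF S[OF that]]]
    have "((\<lambda>s. f (x + s *\<^sub>R h + s' *\<^sub>R k)) has_derivative (\<lambda>r. f' (x + s *\<^sub>R h + s' *\<^sub>R k) (r *\<^sub>R h))) (at s)"
      by (simp add: o_def)
    then show ?thesis
      unfolding has_field_derivative_def
      by (rule has_derivative_eq_rhs) (simp add: fun_eq_iff linear_cmul[OF lin[OF S[OF that]]])
  qed
  have d2: "((\<lambda>s'. f' (x + s *\<^sub>R h + s' *\<^sub>R k) h) has_real_derivative g (x + s *\<^sub>R h + s' *\<^sub>R k) k) (at s')"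
    if "s \<in> {0..t}" "s' \<in> {0..t}" for s s'
  proof -
    have "((\<lambda>s'. x + s *\<^sub>R h + s' *\<^sub>R k) has_derivative (\<lambda>r. r *\<^sub>R k)) (at s')"
      by (auto intro!: derivative_eq_intros)
    from diff_chain_at[OF this g[OF S[OF that]]]
    have "((\<lambda>s'. f' (x + s *\<^sub>R h + s' *\<^sub>R k) h) has_derivative (\<lambda>r. g (x + s *\<^sub>R h + s' *\<^sub>R k) (r *\<^sub>R k))) (at s')"
      by (simp add: o_def)
    then show ?thesis
      unfolding has_field_derivative_def
      by (rule has_derivative_eq_rhs)
         (simp add: fun_eq_iff linear_cmul[OF has_derivative_linear[OF g[OF S[OF that]]]])
  qed
  have "\<exists>s. 0 < s \<and> s < t \<and> \<phi> t - \<phi> 0 = (t - 0) * (f' (x + s *\<^sub>R h + t *\<^sub>R k) h - f' (x + s *\<^sub>R h + 0 *\<^sub>R k) h)"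
    using t unfolding \<phi>_def by (intro MVT2 DERIV_diff d1) auto
  then obtain s where s: "0 < s" "s < t"
    "\<phi> t - \<phi> 0 = t * (f' (x + s *\<^sub>R h + t *\<^sub>R k) h - f' (x + s *\<^sub>R h + 0 *\<^sub>R k) h)" by auto
  have "\<exists>s'. 0 < s' \<and> s' < t \<and> f' (x + s *\<^sub>R h + t *\<^sub>R k) h - f' (x + s *\<^sub>R h + 0 *\<^sub>R k) h
      = (t - 0) * g (x + s *\<^sub>R h + s' *\<^sub>R k) k"
    using t s by (intro MVT2 d2) auto
  then obtain s' where s': "0 < s'" "s' < t"
    "f' (x + s *\<^sub>R h + t *\<^sub>R k) h - f' (x + s *\<^sub>R h + 0 *\<^sub>R k) h = t * g (x + s *\<^sub>R h + s' *\<^sub>R k) k" by auto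
  have "f (x + t *\<^sub>R h + t *\<^sub>R k) - f (x + t *\<^sub>R h) - f (x + t *\<^sub>R k) + f x = \<phi> t - \<phi> 0"
    by (simp add: \<phi>_def)
  also have "\<dots> = t\<^sup>2 * g (x + s *\<^sub>R h + s' *\<^sub>R k) k"
    using s(3) s'(3) by (simp add: power2_eq_square)
  finally show ?thesis using s s' by (intro bexI[of _ s] bexI[of _ s']) auto
qed

text \<open>Both sides are limits, as t tends to 0, of one and the same second difference divided by
  t^2. The values are real because the mean value theorem is behind it.\<close>

lemma symmetric_second_derivative:
  fixes f :: "'a::real_normed_vector \<Rightarrow> real"
  assumes S: "open S" "x \<in> S"
    and f: "\<And>z. z \<in> S \<Longrightarrow> (f has_derivative f' z) (at z)"
    and g: "\<And>z. z \<in> S \<Longrightarrow> ((\<lambda>z. f' z h) has_derivative g z) (at z)"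
    and g': "\<And>z. z \<in> S \<Longrightarrow> ((\<lambda>z. f' z k) has_derivative g' z) (at z)"
    and c: "isCont (\<lambda>z. g z k) x" "isCont (\<lambda>z. g' z h) x"
  shows "g x k = g' x h"
proof (rule ccontr)
  assume ne: "g x k \<noteq> g' x h"
  define e where "e = \<bar>g x k - g' x h\<bar> / 2"
  have e: "e > 0" using ne by (simp add: e_def)
  obtain d0 where d0: "d0 > 0" "ball x d0 \<subseteq> S" using S openE by blast
  obtain d1 where d1: "d1 > 0" "\<And>z. dist z x < d1 \<Longrightarrow> \<bar>g z k - g x k\<bar> < e"
    using c(1) e unfolding continuous_at_eps_delta by (metis dist_real_def)
  obtain d2 where d2: "d2 > 0" "\<And>z. dist z x < d2 \<Longrightarrow> \<bar>g' z h - g' x h\<bar> < e"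
    using c(2) e unfolding continuous_at_eps_delta by (metis dist_real_def)
  define d where "d = min d0 (min d1 d2)"
  have d: "d > 0" using d0 d1 d2 by (simp add: d_def)
  \<comment> \<open>Both steps are at most t, so the parallelogram stays within d of x; the summand
    1 keeps the denominator positive when h = k = 0.\<close>
  define t where "t = d / (2 * (norm h + norm k + 1))"
  have nn: "norm h + norm k + 1 > 0" by (smt (verit) norm_ge_zero)
  have t: "t > 0" using d nn unfolding t_def by simp
  have bnd: "norm (s *\<^sub>R h + s' *\<^sub>R k) < d" if "s \<in> {0..t}" "s' \<in> {0..t}" for s s'
  proof -
    have "norm (s *\<^sub>R h + s' *\<^sub>R k) \<le> s * norm h + s' * norm k"
      using that by (intro order_trans[OF norm_triangle_ineq]) auto
    also have "\<dots> \<le> t * norm h + t * norm k"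
      using that by (intro add_mono mult_right_mono) auto
    also have "\<dots> \<le> t * (norm h + norm k + 1)" using t by (simp add: algebra_simps)
    also have "\<dots> = d / 2" using nn unfolding t_def by (simp add: field_simps)
    finally show ?thesis using d by simp
  qed
  have inb: "x + s *\<^sub>R h + s' *\<^sub>R k \<in> ball x d" if "s \<in> {0..t}" "s' \<in> {0..t}" for s s'
  proof -
    have "dist x (x + s *\<^sub>R h + s' *\<^sub>R k) = norm (s *\<^sub>R h + s' *\<^sub>R k)"
      by (metis add.assoc add_diff_cancel_left' dist_commute dist_norm)
    then show ?thesis using bnd[OF that] by simp
  qed
  have inS: "x + s *\<^sub>R h + s' *\<^sub>R k \<in> S" if "s \<in> {0..t}" "s' \<in> {0..t}" for s s'
    using inb[OF that] d0 by (auto simp: d_def)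
  obtain s s' where s: "s \<in> {0<..<t}" "s' \<in> {0<..<t}"
    "f (x + t *\<^sub>R h + t *\<^sub>R k) - f (x + t *\<^sub>R h) - f (x + t *\<^sub>R k) + f x = t\<^sup>2 * g (x + s *\<^sub>R h + s' *\<^sub>R k) k"
    using mixed_difference[where S=S and f=f and f'=f' and g=g, OF t inS f g] by metis
  have inS': "x + s *\<^sub>R k + s' *\<^sub>R h \<in> S" if "s \<in> {0..t}" "s' \<in> {0..t}" for s s'
    using inS[OF that(2,1)] by (simp add: algebra_simps)
  obtain r r' where r: "r \<in> {0<..<t}" "r' \<in> {0<..<t}"
    "f (x + t *\<^sub>R k + t *\<^sub>R h) - f (x + t *\<^sub>R k) - f (x + t *\<^sub>R h) + f x = t\<^sup>2 * g' (x + r *\<^sub>R k + r' *\<^sub>R h) h"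
    using mixed_difference[where S=S and f=f and f'=f' and g=g', OF t inS' f g'] by metis
  define X where "X = x + s *\<^sub>R h + s' *\<^sub>R k"
  define Z where "Z = x + r' *\<^sub>R h + r *\<^sub>R k"
  have Z': "x + r *\<^sub>R k + r' *\<^sub>R h = Z" unfolding Z_def by (metis add.assoc add.commute)
  have T': "x + t *\<^sub>R k + t *\<^sub>R h = x + t *\<^sub>R h + t *\<^sub>R k" by (metis add.assoc add.commute)
  have "t\<^sup>2 * g X k = t\<^sup>2 * g' Z h"
    using s(3) r(3) unfolding Z' T' X_def[symmetric] by linarith
  then have eq: "g X k = g' Z h" using t by simp
  have "X \<in> ball x d" "Z \<in> ball x d" unfolding X_def Z_def using s r inb[of s s'] inb[of r' r] by auto
  then have "\<bar>g X k - g x k\<bar> < e" "\<bar>g' Z h - g' x h\<bar> < e"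
    using d1(2)[of X] d2(2)[of Z] by (auto simp: d_def dist_commute)
  then have "\<bar>g x k - g' x h\<bar> < 2 * e" using eq by linarith
  then show False by (simp add: e_def)
qed

text \<open>Symmetry of the second derivative in the directions 1 and \<i>, for real and imaginary
  part; everything but a2 and b1 cancels. This is the compatibility condition that turns a
  first-order equation for a critical value into one for its derivative.\<close>

lemma wirt_mixed:
  assumes S: "open S" "x \<in> S"
    and f: "\<And>z. z \<in> S \<Longrightarrow> wirt f (a z) (b z) z"
    and a: "C1 S a" "wirt a a1 a2 x"
    and b: "C1 S b" "wirt b b1 b2 x"
  shows "a2 = b1"
proof -
  obtain p q where a': "\<And>z. z \<in> S \<Longrightarrow> wirt a (p z) (q z) z" "continuous_on S p" "continuous_on S q"
    using a(1) unfolding C1_def by blast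
  obtain p' q' where b': "\<And>z. z \<in> S \<Longrightarrow> wirt b (p' z) (q' z) z" "continuous_on S p'" "continuous_on S q'"
    using b(1) unfolding C1_def by blast
  have eq: "a2 = q x" "b1 = p' x"
    using wirt_unique[OF a(2) a'(1)] wirt_unique[OF b(2) b'(1)] S by auto
  have cont: "isCont p x" "isCont q x" "isCont p' x" "isCont q' x"
    using a' b' S by (auto simp: continuous_on_eq_continuous_at)
  have fd: "(f has_derivative (\<lambda>h. a z * h + b z * cnj h)) (at z)" if "z \<in> S" for z
    using f[OF that] by (simp add: wirt_def)
  have d1: "((\<lambda>z. a z * h + b z * cnj h) has_derivative
      (\<lambda>k. (p z * k + q z * cnj k) * h + (p' z * k + q' z * cnj k) * cnj h)) (at z)" if "z \<in> S" for z h
    using a'(1)[OF that] b'(1)[OF that] unfolding wirt_def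
    by (intro has_derivative_add has_derivative_mult_left)
  define G where "G h z k = (p z * k + q z * cnj k) * h + (p' z * k + q' z * cnj k) * cnj h" for h z k
  have cG: "isCont (\<lambda>z. G h z k) x" for h k unfolding G_def by (intro continuous_intros cont)
  have "Re (G 1 x \<i>) = Re (G \<i> x 1)"
  proof (rule symmetric_second_derivative[OF S, where f = "\<lambda>z. Re (f z)" and f' = "\<lambda>z h. Re (a z * h + b z * cnj h)"
      and h = 1 and k = \<i> and g = "\<lambda>z k. Re (G 1 z k)" and g' = "\<lambda>z k. Re (G \<i> z k)"])
    show "((\<lambda>z. Re (f z)) has_derivative (\<lambda>h. Re (a z * h + b z * cnj h))) (at z)" if "z \<in> S" for z
      using fd[OF that] by (rule has_derivative_Re)
    show "((\<lambda>z. Re (a z * 1 + b z * cnj 1)) has_derivative (\<lambda>k. Re (G 1 z k))) (at z)" if "z \<in> S" for z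
      using d1[OF that, of 1] unfolding G_def by (rule has_derivative_Re)
    show "((\<lambda>z. Re (a z * \<i> + b z * cnj \<i>)) has_derivative (\<lambda>k. Re (G \<i> z k))) (at z)" if "z \<in> S" for z
      using d1[OF that, of \<i>] unfolding G_def by (rule has_derivative_Re)
    show "isCont (\<lambda>z. Re (G 1 z \<i>)) x" "isCont (\<lambda>z. Re (G \<i> z 1)) x"
      by (intro isCont_Re isCont_Im cG)+
  qed
  moreover have "Im (G 1 x \<i>) = Im (G \<i> x 1)"
  proof (rule symmetric_second_derivative[OF S, where f = "\<lambda>z. Im (f z)" and f' = "\<lambda>z h. Im (a z * h + b z * cnj h)"
      and h = 1 and k = \<i> and g = "\<lambda>z k. Im (G 1 z k)" and g' = "\<lambda>z k. Im (G \<i> z k)"])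
    show "((\<lambda>z. Im (f z)) has_derivative (\<lambda>h. Im (a z * h + b z * cnj h))) (at z)" if "z \<in> S" for z
      using fd[OF that] by (rule has_derivative_Im)
    show "((\<lambda>z. Im (a z * 1 + b z * cnj 1)) has_derivative (\<lambda>k. Im (G 1 z k))) (at z)" if "z \<in> S" for z
      using d1[OF that, of 1] unfolding G_def by (rule has_derivative_Im)
    show "((\<lambda>z. Im (a z * \<i> + b z * cnj \<i>)) has_derivative (\<lambda>k. Im (G \<i> z k))) (at z)" if "z \<in> S" for z
      using d1[OF that, of \<i>] unfolding G_def by (rule has_derivative_Im)
    show "isCont (\<lambda>z. Im (G 1 z \<i>)) x" "isCont (\<lambda>z. Im (G \<i> z 1)) x"
      by (intro isCont_Re isCont_Im cG)+
  qed
  ultimately have "G 1 x \<i> = G \<i> x 1" by (simp add: complex_eq_iff)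
  then have "\<i> * (q x - p' x) = - \<i> * (q x - p' x)" unfolding G_def by (simp add: algebra_simps)
  then have "q x - p' x = 0" by (simp add: complex_eq_iff)
  with eq show ?thesis by simp
qed

subsection \<open>Periodic functions\<close>

text \<open>Cramer's rule with determinant \<open>D\<close>. Besides reducing modulo periods, it
  finds the intersection of two lines that are not parallel.\<close>

lemma period_coordinates:
  assumes "Im (o1 * cnj o2) \<noteq> 0"
  obtains s t :: real where "z = of_real s * o1 + of_real t * o2"
proof -
  define D where "D = Im (o1 * cnj o2)"
  have D: "D \<noteq> 0" "D = Im o1 * Re o2 - Re o1 * Im o2" using assms by (auto simp: D_def)
  define s t where "s = (Im z * Re o2 - Re z * Im o2) / D" and "t = (Im o1 * Re z - Re o1 * Im z) / D"
  have "Re z * D = (Im z * Re o2 - Re z * Im o2) * Re o1 + (Im o1 * Re z - Re o1 * Im z) * Re o2"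
    "Im z * D = (Im z * Re o2 - Re z * Im o2) * Im o1 + (Im o1 * Re z - Re o1 * Im z) * Im o2"
    unfolding D(2) by algebra+
  then have "Re z = s * Re o1 + t * Re o2" "Im z = s * Im o1 + t * Im o2"
    using D(1) unfolding s_def t_def by (simp_all add: add_divide_distrib[symmetric] eq_divide_eq)
  then have "z = of_real s * o1 + of_real t * o2" by (simp add: complex_eq_iff)
  then show ?thesis by (rule that)
qed

lemma period_multiple:
  fixes f :: "complex \<Rightarrow> 'a"
  assumes "\<And>z. f (z + o1) = f z"
  shows "f (z + of_int n * o1) = f z"
proof -
  have nat: "f (z + of_nat k * o1) = f z" for k z
  proof (induction k)
    case (Suc k)
    have "z + of_nat (Suc k) * o1 = (z + of_nat k * o1) + o1" by (simp add: algebra_simps)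
    then show ?case using assms Suc by metis
  qed simp
  show ?thesis
  proof (cases n)
    case (nonneg k)
    then show ?thesis using nat[of z k] by simp
  next
    case (neg k)
    then have "of_int n + of_nat (Suc k) = (0 :: complex)" by simp
    then have "z + of_int n * o1 + of_nat (Suc k) * o1 = z" by (metis add.assoc add.right_neutral distrib_right mult_zero_left)
    then show ?thesis using nat[of "z + of_int n * o1" "Suc k"] by metis
  qed
qed

lemma period_reduce:
  fixes f :: "complex \<Rightarrow> 'a"
  assumes o: "Im (o1 * cnj o2) \<noteq> 0" and per: "\<And>z. f (z + o1) = f z" "\<And>z. f (z + o2) = f z"
  obtains s t :: real where "s \<in> {0..1}" "t \<in> {0..1}" "f z = f (of_real s * o1 + of_real t * o2)"
proof -
  obtain s t :: real where st: "z = of_real s * o1 + of_real t * o2" using period_coordinates[OF o] .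
  have "f z = f (z + of_int (- floor s) * o1)" using period_multiple[of f o1, OF per(1)] by metis
  also have "\<dots> = f (z + of_int (- floor s) * o1 + of_int (- floor t) * o2)"
    using period_multiple[of f o2, OF per(2)] by metis
  also have "z + of_int (- floor s) * o1 + of_int (- floor t) * o2 = of_real (frac s) * o1 + of_real (frac t) * o2"
    unfolding st frac_def by (simp add: algebra_simps)
  finally show ?thesis
    using that[of "frac s" "frac t"] less_imp_le[OF frac_lt_1] by auto
qed

lemma periodic_range_compact:
  fixes f :: "complex \<Rightarrow> 'a::metric_space"
  assumes o: "Im (o1 * cnj o2) \<noteq> 0" and per: "\<And>z. f (z + o1) = f z" "\<And>z. f (z + o2) = f z"
    and c: "continuous_on UNIV f"
  shows "compact (range f)"
proof -
  let ?h = "\<lambda>p::real \<times> real. of_real (fst p) * o1 + of_real (snd p) * o2"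
  have "range f = (f \<circ> ?h) ` ({0..1} \<times> {0..1})"
  proof
    show "range f \<subseteq> (f \<circ> ?h) ` ({0..1} \<times> {0..1})"
    proof
      fix y assume "y \<in> range f"
      then obtain z where z: "y = f z" by auto
      obtain s t :: real where "s \<in> {0..1}" "t \<in> {0..1}" "f z = f (of_real s * o1 + of_real t * o2)"
        using period_reduce[of o1 o2 f z, OF o per] .
      then show "y \<in> (f \<circ> ?h) ` ({0..1} \<times> {0..1})" unfolding z by (intro image_eqI[of _ _ "(s, t)"]) auto
    qed
  qed auto
  moreover have "compact ((f \<circ> ?h) ` ({0..1} \<times> {0..1}))"
  proof (rule compact_continuous_image)
    show "continuous_on ({0..1} \<times> {0..1}) (f \<circ> ?h)"
      by (rule continuous_on_compose, intro continuous_intros, rule continuous_on_subset[OF c]) simp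
  qed (simp add: compact_Times)
  ultimately show ?thesis by simp
qed

lemma integral_periodic_derivative:
  fixes P :: "complex \<Rightarrow> real"
  assumes d: "\<And>z. (P has_derivative P' z) (at z)" and per: "\<And>z. P (z + o1) = P z"
  shows "integral {0..1} (\<lambda>s. P' (z + of_real s * o1) o1) = 0"
proof -
  have "((\<lambda>s. P (z + of_real s * o1)) has_vector_derivative P' (z + of_real s * o1) o1) (at s within {0..1})" for s
  proof -
    have "((\<lambda>s. z + of_real s * o1) has_derivative (\<lambda>h. of_real h * o1)) (at s within {0..1})"
      by (auto intro!: derivative_eq_intros)
    from has_derivative_compose[OF this, of P "P' (z + of_real s * o1)", OF d]
    show ?thesis unfolding has_vector_derivative_def
      by (rule has_derivative_eq_rhs)
        (simp add: fun_eq_iff linear_cmul[OF has_derivative_linear[OF d]] flip: scaleR_conv_of_real)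
  qed
  then have "((\<lambda>s. P' (z + of_real s * o1) o1) has_integral P (z + of_real 1 * o1) - P (z + of_real 0 * o1)) {0..1}"
    by (intro fundamental_theorem_of_calculus) auto
  then show ?thesis using per[of z] by (simp add: integral_unique)
qed

text \<open>A periodic divergence has mean value zero, so it cannot have a sign unless it vanishes.\<close>

lemma periodic_divergence_zero:
  fixes P Q :: "complex \<Rightarrow> real"
  assumes P: "\<And>z. (P has_derivative P' z) (at z)" "\<And>z. P (z + o1) = P z" "continuous_on UNIV (\<lambda>z. P' z o1)"
    and Q: "\<And>z. (Q has_derivative Q' z) (at z)" "\<And>z. Q (z + o2) = Q z" "continuous_on UNIV (\<lambda>z. Q' z o2)"
    and nonneg: "\<And>z. P' z o1 + Q' z o2 \<ge> 0"
  shows "P' z o1 + Q' z o2 = 0"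
proof -
  \<comment> \<open>The parallelogram starts at the given z, so the pointwise conclusion read at s =
    t = 0 is the claim.\<close>
  define h where "h s t = z + of_real t * o2 + of_real s * o1" for s t :: real
  have c: "continuous_on S (\<lambda>x. f (h (u x) (v x)))"
    if "continuous_on UNIV f" "continuous_on S u" "continuous_on S v"
    for f :: "complex \<Rightarrow> real" and S :: "'b::topological_space set" and u v
    unfolding h_def
    by (rule continuous_on_compose2[OF that(1), where f = "\<lambda>x. z + of_real (v x) * o2 + of_real (u x) * o1"])
       (intro continuous_on_add continuous_on_mult continuous_on_const continuous_on_of_real that, simp)
  define p q where "p s t = P' (h s t) o1" and "q s t = Q' (h s t) o2" for s t
  have p0: "integral {0..1} (\<lambda>s. p s t) = 0" for t
    unfolding p_def h_def using integral_periodic_derivative[of P P' o1 "z + of_real t * o2", OF P(1,2)] .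
  have q0: "integral {0..1} (\<lambda>t. q s t) = 0" for s
    using integral_periodic_derivative[of Q Q' o2 "z + of_real s * o1", OF Q(1,2)]
    unfolding q_def h_def by (simp add: add.assoc add.commute[of "of_real s * o1"])
  have cc: "continuous_on (cbox (0,0) (1,1)) (snd :: real \<times> real \<Rightarrow> real)" "continuous_on (cbox (0,0) (1,1)) (fst :: real \<times> real \<Rightarrow> real)"
    by (simp_all add: continuous_on_fst continuous_on_snd)
  have cq2: "continuous_on (cbox (0,0) (1,1)) (\<lambda>(t,s). q s t)"
    unfolding p_def q_def case_prod_beta using c[OF Q(3) cc] .
  have ci: "continuous_on {0..1} (\<lambda>s. s)" "continuous_on {0..1} (\<lambda>s. t)" for t :: real
    by simp_all
  have cp: "continuous_on {0..1} (\<lambda>s. p s t)" "continuous_on {0..1} (\<lambda>s. q s t)" for t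
    unfolding p_def q_def using c[OF P(3) ci(1) ci(2)[of t]] c[OF Q(3) ci(1) ci(2)[of t]] .
  \<comment> \<open>P integrates to zero along o1 and Q along o2; exchanging the order makes both
    facts apply to one double integral.\<close>
  have "integral (cbox 0 1) (\<lambda>t. integral (cbox 0 1) (\<lambda>s. q s t)) = integral (cbox 0 1) (\<lambda>s. integral (cbox 0 1) (\<lambda>t. q s t))"
    by (rule integral_swap_continuous[OF cq2(1)])
  then have qq: "integral {0..1} (\<lambda>t. integral {0..1} (\<lambda>s. q s t)) = 0" by (simp add: q0)
  define \<phi> where "\<phi> t = integral {0..1} (\<lambda>s. p s t + q s t)" for t
  have \<phi>: "\<phi> t = integral {0..1} (\<lambda>s. q s t)" for t
    unfolding \<phi>_def using p0[of t] by (subst integral_add) (auto intro!: integrable_continuous_real cp)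
  have cpq: "continuous_on {0..1} (\<lambda>s. p s t + q s t)" for t by (intro continuous_on_add cp)
  have \<phi>0: "\<phi> t \<ge> 0" for t
    unfolding \<phi>_def by (intro integral_nonneg integrable_continuous_real cpq) (simp add: p_def q_def nonneg)
  have \<phi>': "\<phi> = (\<lambda>t. integral {0..1} (\<lambda>s. q s t))" by (rule ext) (rule \<phi>)
  have c\<phi>: "continuous_on {0..1} \<phi>"
  proof -
    have "continuous_on (cbox 0 1) (\<lambda>t. integral (cbox 0 1) (\<lambda>s. q s t))"
      by (rule integral_continuous_on_param) (use cq2(1) in \<open>simp add: cbox_Pair_eq\<close>)
    then show ?thesis by (simp add: \<phi>')
  qed
  have "integral {0..1} \<phi> = 0" using qq by (simp add: \<phi>')
  then have "\<phi> 0 = 0" using integral_eq_0_iff[OF c\<phi>] \<phi>0 by auto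
  then have "p 0 0 + q 0 0 = 0"
    unfolding \<phi>_def using integral_eq_0_iff[OF cpq[of 0]] nonneg by (auto simp: p_def q_def)
  then show ?thesis by (simp add: p_def q_def h_def)
qed

subsection \<open>Roots depending on a parameter\<close>

text \<open>The modulus of the value at x is that of the leading coefficient times the product of
  the distances to the roots; if none of these were below e, it would be too large. This yields
  continuity of roots.\<close>

lemma poly_root_near:
  fixes p :: "complex poly"
  assumes "e > 0" "cmod (poly p x) < cmod (lead_coeff p) * e ^ degree p"
  shows "\<exists>\<zeta>. poly p \<zeta> = 0 \<and> dist \<zeta> x < e"
proof (rule ccontr)
  assume no: "\<not> ?thesis"
  obtain root where root: "smult (lead_coeff p) (\<Prod>i<degree p. [:- root i, 1:]) = p"
    using complex_poly_decompose' by metis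
  have px: "poly p y = lead_coeff p * (\<Prod>i<degree p. y - root i)" for y
    using arg_cong[OF root, of "\<lambda>p. poly p y"] by (simp add: poly_prod)
  have "e \<le> cmod (x - root i)" if "i < degree p" for i
  proof -
    have "poly p (root i) = 0" unfolding px using that by (auto simp: prod_zero_iff)
    then show ?thesis using no by (auto simp: dist_norm norm_minus_commute not_less)
  qed
  then have "e ^ degree p \<le> (\<Prod>i<degree p. cmod (x - root i))"
    using prod_mono[of "{..<degree p}" "\<lambda>_. e" "\<lambda>i. cmod (x - root i)"] assms(1) by (simp add: less_imp_le)
  then have "cmod (lead_coeff p) * e ^ degree p \<le> cmod (poly p x)"
    unfolding px by (simp add: norm_mult prod_norm[symmetric] mult_left_mono)
  then show False using assms(2) by simp
qed

text \<open>When one factor vanishes at x, the product rule needs only continuity of the other. That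
  is the situation in implicit differentiation, before the root is known to be
  differentiable.\<close>

lemma has_derivative_mult_vanishing:
  fixes f h :: "'a::real_normed_vector \<Rightarrow> 'b::real_normed_algebra"
  assumes f: "(f has_derivative f') (at x)" and fx: "f x = 0" and h: "isCont h x"
  shows "((\<lambda>z. f z * h z) has_derivative (\<lambda>k. f' k * h x)) (at x)"
proof -
  have bl: "bounded_linear f'" using f by (rule has_derivative_bounded_linear)
  obtain K where K: "\<And>y. norm (f' y) \<le> norm y * K" using bounded_linear.bounded[OF bl] by blast
  define e where "e y = norm ((f y - f x) - f' (y - x)) / norm (y - x)" for y
  have e: "(e \<longlongrightarrow> 0) (at x)" using f unfolding e_def has_derivative_iff_norm by simp
  have hh: "((\<lambda>y. norm (h y)) \<longlongrightarrow> norm (h x)) (at x)" "((\<lambda>y. norm (h y - h x)) \<longlongrightarrow> 0) (at x)"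
    using h by (auto simp: isCont_def intro!: tendsto_norm tendsto_norm_zero LIM_zero)
  have lim: "((\<lambda>y. e y * norm (h y) + K * norm (h y - h x)) \<longlongrightarrow> 0 * norm (h x) + K * 0) (at x)"
    by (intro tendsto_add tendsto_mult tendsto_const e hh)
  have bound: "norm ((f y * h y - f x * h x) - f' (y - x) * h x) / norm (y - x) \<le> e y * norm (h y) + K * norm (h y - h x)"
    if "y \<noteq> x" for y
  proof -
    have n: "norm (y - x) > 0" using that by simp
    have "(f y * h y - f x * h x) - f' (y - x) * h x = ((f y - f x) - f' (y - x)) * h y + f' (y - x) * (h y - h x)"
      by (simp add: fx algebra_simps)
    then have "norm ((f y * h y - f x * h x) - f' (y - x) * h x)
        \<le> norm ((f y - f x) - f' (y - x)) * norm (h y) + norm (f' (y - x)) * norm (h y - h x)"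
      by (metis norm_triangle_le norm_mult_ineq add_mono)
    also have "\<dots> \<le> norm ((f y - f x) - f' (y - x)) * norm (h y) + norm (y - x) * K * norm (h y - h x)"
      by (intro add_left_mono mult_right_mono K) auto
    also have "\<dots> = (e y * norm (h y) + K * norm (h y - h x)) * norm (y - x)"
      using n by (simp add: e_def field_simps)
    finally show ?thesis using n by (simp add: pos_divide_le_eq)
  qed
  have "((\<lambda>y. norm ((f y * h y - f x * h x) - f' (y - x) * h x) / norm (y - x)) \<longlongrightarrow> 0) (at x)"
  proof (rule tendsto_sandwich[OF _ _ tendsto_const])
    show "((\<lambda>y. e y * norm (h y) + K * norm (h y - h x)) \<longlongrightarrow> 0) (at x)" using lim by simp
    show "\<forall>\<^sub>F y in at x. norm ((f y * h y - f x * h x) - f' (y - x) * h x) / norm (y - x) \<le> e y * norm (h y) + K * norm (h y - h x)"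
      using bound by (auto simp: eventually_at intro: exI[of _ 1])
  qed auto
  moreover have "bounded_linear (\<lambda>k. f' k * h x)"
    by (rule bounded_linear_compose[OF bounded_linear_mult_left bl])
  ultimately show ?thesis unfolding has_derivative_iff_norm by blast
qed

subsection \<open>The critical quartic\<close>

text \<open>
  On the unit circle bundle, with \<open>\<zeta> = exp (2 \<i> \<phi>)\<close>, the integral is proportional to
  \<open>A \<zeta>\<^sup>2 + B \<zeta> + C + cnj B / \<zeta> + cnj A / \<zeta>\<^sup>2\<close>; its critical points are the roots of
  \<open>crit_poly A B\<close>.
\<close>

definition crit_poly :: "complex \<Rightarrow> complex \<Rightarrow> complex \<Rightarrow> complex" where
  "crit_poly A B \<zeta> = 2 * A * \<zeta> ^ 4 + B * \<zeta> ^ 3 - cnj B * \<zeta> - 2 * cnj A"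

definition crit_deriv :: "complex \<Rightarrow> complex \<Rightarrow> complex \<Rightarrow> complex" where
  "crit_deriv A B \<zeta> = 8 * A * \<zeta> ^ 3 + 3 * B * \<zeta> ^ 2 - cnj B"

lemma crit_poly_root_near:
  assumes "A \<noteq> 0" "e > 0" "cmod (crit_poly A B x) < 2 * cmod A * e ^ 4"
  shows "\<exists>\<zeta>. crit_poly A B \<zeta> = 0 \<and> dist \<zeta> x < e"
proof -
  define p where "p = [:- 2 * cnj A, - cnj B, 0, B, 2 * A:]"
  have "degree p = 4" "lead_coeff p = 2 * A" using assms(1) by (auto simp: p_def)
  moreover have "poly p y = crit_poly A B y" for y
    by (simp add: p_def crit_poly_def algebra_simps power4_eq_xxxx power3_eq_cube)
  ultimately show ?thesis using poly_root_near[of e p x] assms by (simp add: norm_mult)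
qed

text \<open>Dividing the difference of the polynomial's values at \<zeta> y and at x = \<zeta> z by
  \<zeta> y - x leaves the quotient \<open>q\<close>, so that \<zeta> y = x - f y / q y. Here
  \<open>f\<close> depends on y through B alone and vanishes at z, while \<open>q\<close> inherits
  mere continuity from \<zeta> and equals \<open>crit_deriv\<close> at z.\<close>

lemma wirt_root:
  assumes B: "wirt B b1 b2 z" and S: "open S" "z \<in> S" and c: "isCont \<zeta> z"
    and root: "\<And>y. y \<in> S \<Longrightarrow> crit_poly A (B y) (\<zeta> y) = 0"
    and nz: "crit_deriv A (B z) (\<zeta> z) \<noteq> 0"
  shows "wirt \<zeta> (- (b1 * \<zeta> z ^ 3 - cnj b2 * \<zeta> z) / crit_deriv A (B z) (\<zeta> z))
    (- (b2 * \<zeta> z ^ 3 - cnj b1 * \<zeta> z) / crit_deriv A (B z) (\<zeta> z)) z"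
proof -
  define x where "x = \<zeta> z"
  define q where "q y = 2 * A * (\<zeta> y ^ 3 + \<zeta> y ^ 2 * x + \<zeta> y * x ^ 2 + x ^ 3)
      + B y * (\<zeta> y ^ 2 + \<zeta> y * x + x ^ 2) - cnj (B y)" for y
  define f where "f y = crit_poly A (B y) x" for y
  have cB: "isCont B z" using wirt_continuous[OF B] .
  have qz: "q z = crit_deriv A (B z) x"
    by (simp add: q_def x_def crit_deriv_def power2_eq_square power3_eq_cube)
  have cq: "isCont q z" unfolding q_def by (intro continuous_intros c cB)
  then obtain d where d: "d > 0" "\<And>y. dist y z < d \<Longrightarrow> q y \<noteq> 0"
    using continuous_at_avoid[OF cq, of 0] nz qz by (auto simp: x_def dist_commute)
  have fac: "(\<zeta> y - x) * q y = crit_poly A (B y) (\<zeta> y) - f y" for y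
    unfolding q_def f_def crit_poly_def by algebra
  have eq: "x - f y * inverse (q y) = \<zeta> y" if "y \<in> S \<inter> ball z d" for y
  proof -
    have "(\<zeta> y - x) * q y = - f y" "q y \<noteq> 0" using fac[of y] root d that by (auto simp: dist_commute)
    then show ?thesis by (simp add: field_simps)
  qed
  have "wirt f (b1 * x ^ 3 - cnj b2 * x) (b2 * x ^ 3 - cnj b1 * x) z"
    unfolding f_def crit_poly_def
    by (rule wirt_cong[OF wirt_diff[OF wirt_diff[OF wirt_add[OF wirt_const wirt_mult[OF B wirt_const]]
        wirt_mult[OF wirt_cnj[OF B] wirt_const]] wirt_const]]) auto
  moreover have "f z = 0" using root[OF S(2)] by (simp add: f_def x_def)
  moreover have "isCont (\<lambda>y. inverse (q y)) z" using cq nz qz by (intro continuous_intros) (auto simp: x_def)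
  ultimately have "((\<lambda>y. f y * inverse (q y)) has_derivative
      (\<lambda>h. ((b1 * x ^ 3 - cnj b2 * x) * h + (b2 * x ^ 3 - cnj b1 * x) * cnj h) * inverse (q z))) (at z)"
    unfolding wirt_def by (rule has_derivative_mult_vanishing)
  then have "wirt (\<lambda>y. f y * inverse (q y)) ((b1 * x ^ 3 - cnj b2 * x) * inverse (q z)) ((b2 * x ^ 3 - cnj b1 * x) * inverse (q z)) z"
    unfolding wirt_def by (rule has_derivative_eq_rhs) (simp add: fun_eq_iff algebra_simps)
  from wirt_diff[OF wirt_const[of x] this]
  have "wirt (\<lambda>y. x - f y * inverse (q y)) (- (b1 * x ^ 3 - cnj b2 * x) / q z) (- (b2 * x ^ 3 - cnj b1 * x) / q z) z"
    by (rule wirt_cong) (simp_all add: divide_inverse algebra_simps)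
  from wirt_transform_open[OF this, of "S \<inter> ball z d" \<zeta>] eq S d(1)
  show ?thesis by (auto simp: qz x_def)
qed

text \<open>Completing the square gives (\<alpha> \<zeta> + \<i> b)^2 = |\<alpha>|^2 - b^2, a
  non-negative real x^2. Hence \<alpha> \<zeta> is x - \<i> b or - x - \<i> b, of modulus
  |\<alpha>|.\<close>

lemma circle_quadratic:
  fixes b :: real
  assumes "\<alpha> * \<zeta>\<^sup>2 + 2 * \<i> * b * \<zeta> - cnj \<alpha> = 0" "\<bar>b\<bar> \<le> cmod \<alpha>" "\<alpha> \<noteq> 0"
  shows "cmod \<zeta> = 1"
proof -
  define x where "x = sqrt ((cmod \<alpha>)\<^sup>2 - b\<^sup>2)"
  have x2: "x\<^sup>2 = (cmod \<alpha>)\<^sup>2 - b\<^sup>2"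
    using assms(2) unfolding x_def by (simp add: abs_le_square_iff[symmetric])
  have "(\<alpha> * \<zeta> + \<i> * b)\<^sup>2 = \<alpha> * (\<alpha> * \<zeta>\<^sup>2 + 2 * \<i> * b * \<zeta> - cnj \<alpha>) + \<alpha> * cnj \<alpha> + (\<i> * b)\<^sup>2"
    by algebra
  also have "\<dots> = (of_real x)\<^sup>2"
    using x2 assms(1) by (simp add: complex_norm_square power_mult_distrib flip: of_real_power)
  finally have "\<alpha> * \<zeta> + \<i> * b = of_real x \<or> \<alpha> * \<zeta> + \<i> * b = - of_real x"
    by (simp add: power2_eq_iff)
  then have "\<alpha> * \<zeta> = Complex x (- b) \<or> \<alpha> * \<zeta> = Complex (- x) (- b)"
    by (auto simp: complex_eq_iff)
  then have "(cmod (\<alpha> * \<zeta>))\<^sup>2 = x\<^sup>2 + b\<^sup>2"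
    unfolding cmod_power2 by (elim disjE) (simp_all del: times_complex.simps)
  then have "(cmod \<alpha> * cmod \<zeta>)\<^sup>2 = (cmod \<alpha>)\<^sup>2" using x2 by (simp add: norm_mult)
  then have "cmod \<alpha> * cmod \<zeta> = cmod \<alpha>" by (rule power2_eq_imp_eq) auto
  then show ?thesis using assms(3) by simp
qed

text \<open>Reflection in the unit circle permutes the roots of the quartic, so 1 / cnj w is a root
  as well. The remaining quadratic has the same symmetry, whence its shape with b real; \<alpha> is
  read off the leading coefficient, and b makes the coefficient of \<zeta>^2 vanish. The bound on b
  puts the roots of the quadratic on the circle, and its factor 2 keeps them apart.\<close>

lemma crit_factor:
  assumes A: "A \<noteq> 0" and root: "crit_poly A B w = 0" and w: "cmod w < 1"
  defines "\<alpha> \<equiv> - 2 * A / cnj w" and "b \<equiv> Im (w * (- 2 * A / cnj w)) / (1 + (cmod w)\<^sup>2)"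
  shows "w \<noteq> 0" "\<alpha> \<noteq> 0" "2 * \<bar>b\<bar> \<le> cmod \<alpha>" "- cnj w * \<alpha> = 2 * A"
    "B = (1 + w * cnj w) * \<alpha> - 2 * \<i> * b * cnj w"
    "(1 + w * cnj w) * (2 * \<i> * b) = w * \<alpha> - cnj w * cnj \<alpha>"
    "\<And>\<zeta>. crit_poly A B \<zeta> = (\<zeta> - w) * (1 - cnj w * \<zeta>) * (\<alpha> * \<zeta>\<^sup>2 + 2 * \<i> * b * \<zeta> - cnj \<alpha>)"
proof -
  show w0: "w \<noteq> 0" using root A by (auto simp: crit_poly_def)
  show a0: "\<alpha> \<noteq> 0" using A w0 by (simp add: \<alpha>_def)
  have b: "b = Im (w * \<alpha>) / (1 + (cmod w)\<^sup>2)" by (simp add: b_def \<alpha>_def)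
  have pos: "1 + (cmod w)\<^sup>2 > 0" by (smt (verit) zero_le_power2)
  have "2 * \<bar>Im (w * \<alpha>)\<bar> \<le> 2 * (cmod w * cmod \<alpha>)" using abs_Im_le_cmod[of "w * \<alpha>"] by (simp add: norm_mult)
  also have "\<dots> \<le> (1 + (cmod w)\<^sup>2) * cmod \<alpha>"
    using mult_right_mono[of "2 * cmod w" "1 + (cmod w)\<^sup>2" "cmod \<alpha>"] sum_squares_bound[of 1 "cmod w"]
    by (simp add: algebra_simps)
  finally show "2 * \<bar>b\<bar> \<le> cmod \<alpha>" using pos by (simp add: b field_simps)
  show e4: "- cnj w * \<alpha> = 2 * A" using w0 by (simp add: \<alpha>_def)
  then have e4': "- w * cnj \<alpha> = 2 * cnj A" by (metis complex_cnj_mult complex_cnj_minus complex_cnj_cnj complex_cnj_numeral)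
  have s: "w * cnj w = of_real ((cmod w)\<^sup>2)" by (simp add: complex_norm_square flip: of_real_power)
  have "complex_of_real ((1 + (cmod w)\<^sup>2) * b) = of_real (Im (w * \<alpha>))" using pos by (simp add: b)
  then have "(1 + w * cnj w) * of_real b = of_real (Im (w * \<alpha>))" unfolding s by simp
  moreover have "2 * \<i> * of_real (Im (w * \<alpha>)) = w * \<alpha> - cnj w * cnj \<alpha>"
    using complex_diff_cnj[of "w * \<alpha>"] by (simp add: mult.commute)
  ultimately show e2: "(1 + w * cnj w) * (2 * \<i> * b) = w * \<alpha> - cnj w * cnj \<alpha>"
    by (metis mult.left_commute)
  have h1: "2 * A * w ^ 4 + B * w ^ 3 - cnj B * w - 2 * cnj A = 0" using root by (simp add: crit_poly_def)
  have h2: "2 * cnj A * cnj w ^ 4 + cnj B * cnj w ^ 3 - B * cnj w - 2 * A = 0"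
    using arg_cong[OF h1, of cnj] by simp
  have s1: "w * cnj w \<noteq> 1" "w * cnj w \<noteq> 0" "1 + w * cnj w \<noteq> 0"
  proof -
    have "(cmod w)\<^sup>2 \<noteq> 1" using w norm_ge_zero[of w] unfolding power2_eq_1_iff by linarith
    then show "w * cnj w \<noteq> 1" unfolding s by (metis of_real_eq_1_iff)
    show "1 + w * cnj w \<noteq> 0" unfolding s using pos by (metis of_real_1 of_real_add of_real_eq_0_iff less_irrefl)
  qed (use w0 in auto)
  \<comment> \<open>This combination of the root equation and its conjugate eliminates
    \<open>cnj B\<close>.\<close>
  have "(w * cnj w - 1) * (B * (w * cnj w) * (1 + w * cnj w) + 2 * cnj A * cnj w ^ 3 + 2 * A * w * (1 + w * cnj w + (w * cnj w)\<^sup>2))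
    = cnj w ^ 3 * (2 * A * w ^ 4 + B * w ^ 3 - cnj B * w - 2 * cnj A)
      + w * (2 * cnj A * cnj w ^ 4 + cnj B * cnj w ^ 3 - B * cnj w - 2 * A)" by algebra
  then have "B * (w * cnj w) * (1 + w * cnj w) + 2 * cnj A * cnj w ^ 3 + 2 * A * w * (1 + w * cnj w + (w * cnj w)\<^sup>2) = 0"
    using h1 h2 s1(1) by simp
  then have "(w * cnj w) * (1 + w * cnj w) * (B - ((1 + w * cnj w) * \<alpha> - 2 * \<i> * b * cnj w)) = 0"
    using e4 e4' e2 by algebra
  then show e3: "B = (1 + w * cnj w) * \<alpha> - 2 * \<i> * b * cnj w" using s1 by simp
  have e1: "cnj B = (1 + w * cnj w) * cnj \<alpha> + 2 * \<i> * b * w" unfolding e3 by (simp add: mult.commute)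
  show "crit_poly A B \<zeta> = (\<zeta> - w) * (1 - cnj w * \<zeta>) * (\<alpha> * \<zeta>\<^sup>2 + 2 * \<i> * b * \<zeta> - cnj \<alpha>)" for \<zeta>
    unfolding crit_poly_def using e4 e4' e3 e2 e1 by algebra
qed

text \<open>In the factorization, the second factor vanishes only outside the closed disc and the
  quadratic only on the circle.\<close>

lemma crit_root_unique:
  assumes A: "A \<noteq> 0" and w: "crit_poly A B w = 0" "cmod w < 1" and \<zeta>: "crit_poly A B \<zeta> = 0" "cmod \<zeta> < 1"
  shows "\<zeta> = w"
proof -
  note f = crit_factor[OF A w]
  have "cmod (cnj w * \<zeta>) < 1"
    using mult_strict_mono[of "cmod w" 1 "cmod \<zeta>" 1] w(2) \<zeta>(2) by (simp add: norm_mult)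
  then have 1: "1 - cnj w * \<zeta> \<noteq> 0" by auto
  define \<alpha> where "\<alpha> = - 2 * A / cnj w"
  define b where "b = Im (w * (- 2 * A / cnj w)) / (1 + (cmod w)\<^sup>2)"
  note f' = f[folded \<alpha>_def b_def]
  have 2: "\<alpha> * \<zeta>\<^sup>2 + 2 * \<i> * b * \<zeta> - cnj \<alpha> \<noteq> 0"
    using circle_quadratic[of \<alpha> \<zeta> b] f'(2,3) \<zeta>(2) by fastforce
  have "(\<zeta> - w) = 0" using f'(7)[of \<zeta>] \<zeta>(1) 1 2 by simp
  then show ?thesis by simp
qed

lemma crit_root_simple:
  assumes A: "A \<noteq> 0" and w: "crit_poly A B w = 0" "cmod w < 1"
  shows "crit_deriv A B w \<noteq> 0"
proof -
  note f = crit_factor[OF A w]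
  define \<alpha> where "\<alpha> = - 2 * A / cnj w"
  define b where "b = Im (w * (- 2 * A / cnj w)) / (1 + (cmod w)\<^sup>2)"
  note f' = f[folded \<alpha>_def b_def]
  have e1: "cnj B = (1 + w * cnj w) * cnj \<alpha> + 2 * \<i> * b * w" unfolding f'(5) by (simp add: mult.commute)
  have "crit_deriv A B w = (1 - cnj w * w) * (\<alpha> * w\<^sup>2 + 2 * \<i> * b * w - cnj \<alpha>)"
    unfolding crit_deriv_def using f'(4-6) e1 by algebra
  moreover have "cmod (cnj w * w) < 1"
    using mult_strict_mono[of "cmod w" 1 "cmod w" 1] w(2) by (simp add: norm_mult)
  then have "cnj w * w \<noteq> 1" by auto
  moreover have "\<alpha> * w\<^sup>2 + 2 * \<i> * b * w - cnj \<alpha> \<noteq> 0"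
    using circle_quadratic[of \<alpha> w b] f'(2,3) w(2) by fastforce
  ultimately show ?thesis by simp
qed

subsection \<open>A quartic integral in a conformal coordinate\<close>

text \<open>
  \<open>L\<close> is the conformal factor, and the integral is
  \<open>A p^4 + B p^3 cnj p + C p^2 (cnj p)^2 + cnj B p (cnj p)^3 + cnj A (cnj p)^4\<close> for the complex
  momentum \<open>p\<close>. The suffixes \<open>z\<close> and \<open>b\<close> mark derivatives by \<open>z\<close> and by \<open>cnj z\<close>.
\<close>

locale conformal_quartic =
  fixes A :: complex and L B C Lz Bz Bb Cz :: "complex \<Rightarrow> complex" and o1 o2 :: complex
  assumes wirt_L: "\<And>z. wirt L (Lz z) (cnj (Lz z)) z"
    and wirt_B: "\<And>z. wirt B (Bz z) (Bb z) z"
    and wirt_C: "\<And>z. wirt C (Cz z) (cnj (Cz z)) z"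
    and C1_derivs: "C1 UNIV Lz" "C1 UNIV Bz" "C1 UNIV Bb" "C1 UNIV Cz"
    and cnj_L: "\<And>z. cnj (L z) = L z" and pos_L: "\<And>z. Re (L z) > 0"
    and cnj_C: "\<And>z. cnj (C z) = C z"
    and eq2: "\<And>z. L z * Bz z + B z * Lz z + 4 * A * cnj (Lz z) = 0"
    and eq1: "\<And>z. L z * Cz z + 2 * C z * Lz z + L z * Bb z + 3 * B z * cnj (Lz z) = 0"
    and periods: "Im (o1 * cnj o2) > 0"
    and periodic_L: "\<And>z. L (z + o1) = L z" "\<And>z. L (z + o2) = L z"
    and periodic_B: "\<And>z. B (z + o1) = B z" "\<And>z. B (z + o2) = B z"
    and periodic_C: "\<And>z. C (z + o1) = C z" "\<And>z. C (z + o2) = C z"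
    and A_nz: "A \<noteq> 0"
begin

lemma L_nz: "L z \<noteq> 0"
  using pos_L[of z] by auto

lemma eq2': "L z * cnj (Bz z) + cnj (B z) * cnj (Lz z) + 4 * cnj A * Lz z = 0"
  using arg_cong[OF eq2[of z], of cnj] by (simp add: cnj_L)

lemma eq1': "L z * cnj (Cz z) + 2 * C z * cnj (Lz z) + L z * cnj (Bb z) + 3 * cnj (B z) * Lz z = 0"
  using arg_cong[OF eq1[of z], of cnj] by (simp add: cnj_L cnj_C)

lemma C1_L: "C1 UNIV L"
  using wirt_L C1_continuous[OF C1_derivs(1)] by (intro C1I[where a = Lz and b = "\<lambda>z. cnj (Lz z)"] continuous_on_cnj) auto

lemma C1_B: "C1 UNIV B"
  using wirt_B C1_continuous[OF C1_derivs(2)] C1_continuous[OF C1_derivs(3)]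
  by (intro C1I[where a = Bz and b = Bb]) auto

lemma C1_C: "C1 UNIV C"
  using wirt_C C1_continuous[OF C1_derivs(4)] by (intro C1I[where a = Cz and b = "\<lambda>z. cnj (Cz z)"] continuous_on_cnj) auto

text \<open>The values of \<open>(\<zeta> d/d\<zeta>)^j\<close> applied to the integral on the unit circle bundle and its derivatives.\<close>

definition g :: "nat \<Rightarrow> complex \<Rightarrow> complex \<Rightarrow> complex" where
  "g j z \<zeta> = 2 ^ j * A * \<zeta>\<^sup>2 + B z * \<zeta> + (if j = 0 then C z else 0)
     + (- 1) ^ j * (cnj (B z) * inverse \<zeta> + 2 ^ j * cnj A * (inverse \<zeta>)\<^sup>2)"

text \<open>On the level where the energy is 1/2, |p|^2 is the conformal factor, so a quartic form
  carries its square.\<close>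

definition G :: "nat \<Rightarrow> complex \<Rightarrow> complex \<Rightarrow> complex" where
  "G j z \<zeta> = (L z)\<^sup>2 * g j z \<zeta>"

text \<open>The derivatives are partial, with \<zeta> held fixed; a moving \<zeta> adds the term
  with \<open>G (Suc j)\<close>, as in \<open>wirt_G\<close>.\<close>

definition Gz :: "nat \<Rightarrow> complex \<Rightarrow> complex \<Rightarrow> complex" where
  "Gz j z \<zeta> = 2 * L z * Lz z * g j z \<zeta> + (L z)\<^sup>2 *
     (Bz z * \<zeta> + (if j = 0 then Cz z else 0) + (- 1) ^ j * cnj (Bb z) * inverse \<zeta>)"

definition Gb :: "nat \<Rightarrow> complex \<Rightarrow> complex \<Rightarrow> complex" where
  "Gb j z \<zeta> = 2 * L z * cnj (Lz z) * g j z \<zeta> + (L z)\<^sup>2 *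
     (Bb z * \<zeta> + (if j = 0 then cnj (Cz z) else 0) + (- 1) ^ j * cnj (Bz z) * inverse \<zeta>)"

lemma g1_crit: "\<zeta> \<noteq> 0 \<Longrightarrow> g 1 z \<zeta> = crit_poly A (B z) \<zeta> / \<zeta>\<^sup>2"
  by (simp add: g_def crit_poly_def field_simps power2_eq_square power3_eq_cube power4_eq_xxxx)

lemma g2_crit:
  assumes "\<zeta> \<noteq> 0" "crit_poly A (B z) \<zeta> = 0"
  shows "g 2 z \<zeta> * \<zeta> = crit_deriv A (B z) \<zeta>"
proof -
  have i: "inverse \<zeta> * \<zeta> = 1" using assms(1) by simp
  show ?thesis
    using assms(2) i unfolding g_def crit_poly_def crit_deriv_def by simp algebra
qed

lemma wirt_g:
  assumes \<zeta>: "wirt \<zeta> a b z" "\<zeta> z \<noteq> 0"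
  shows "wirt (\<lambda>y. g j y (\<zeta> y))
     (Bz z * \<zeta> z + (if j = 0 then Cz z else 0) + (- 1) ^ j * cnj (Bb z) * inverse (\<zeta> z) + g (Suc j) z (\<zeta> z) * a / \<zeta> z)
     (Bb z * \<zeta> z + (if j = 0 then cnj (Cz z) else 0) + (- 1) ^ j * cnj (Bz z) * inverse (\<zeta> z) + g (Suc j) z (\<zeta> z) * b / \<zeta> z) z"
proof -
  have C: "wirt (\<lambda>y. if j = 0 then C y else 0) (if j = 0 then Cz z else 0) (if j = 0 then cnj (Cz z) else 0) z"
    using wirt_C wirt_const[of 0 z] by (cases "j = 0") auto
  note i = wirt_inverse[OF \<zeta>]
  show ?thesis unfolding g_def
    by (rule wirt_cong[OF wirt_add[OF wirt_add[OF wirt_add[OF wirt_mult[OF wirt_const wirt_power[OF \<zeta>(1)]]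
          wirt_mult[OF wirt_B \<zeta>(1)]] C]
        wirt_mult[OF wirt_const wirt_add[OF wirt_mult[OF wirt_cnj[OF wirt_B] i]
          wirt_mult[OF wirt_const wirt_power[OF i]]]]]])
       (use \<zeta>(2) in \<open>simp_all add: field_simps power2_eq_square\<close>)
qed

lemma wirt_G:
  assumes \<zeta>: "wirt \<zeta> a b z" "\<zeta> z \<noteq> 0"
  shows "wirt (\<lambda>y. G j y (\<zeta> y)) (Gz j z (\<zeta> z) + G (Suc j) z (\<zeta> z) * a / \<zeta> z)
     (Gb j z (\<zeta> z) + G (Suc j) z (\<zeta> z) * b / \<zeta> z) z"
  unfolding G_def
  by (rule wirt_cong[OF wirt_mult[OF wirt_power[OF wirt_L] wirt_g[OF \<zeta>]]])
     (simp_all add: Gz_def Gb_def algebra_simps)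

text \<open>The first equation is the vanishing Poisson bracket on the unit circle bundle; applying
  \<zeta> d/d\<zeta> to it once and twice gives the other two.\<close>

lemma transport:
  assumes "\<zeta> \<noteq> 0"
  shows "\<zeta> * Gz 0 z \<zeta> + Gb 0 z \<zeta> + L z * (cnj (Lz z) - \<zeta> * Lz z) * g 1 z \<zeta> = 0"
    "\<zeta> * Gz 0 z \<zeta> + \<zeta> * Gz 1 z \<zeta> + Gb 1 z \<zeta> - L z * \<zeta> * Lz z * g 1 z \<zeta>
      + L z * (cnj (Lz z) - \<zeta> * Lz z) * g 2 z \<zeta> = 0"
    "\<zeta> * Gz 0 z \<zeta> + 2 * \<zeta> * Gz 1 z \<zeta> + \<zeta> * Gz 2 z \<zeta> + Gb 2 z \<zeta> - L z * \<zeta> * Lz z * g 1 z \<zeta>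
      - 2 * L z * \<zeta> * Lz z * g 2 z \<zeta> + L z * (cnj (Lz z) - \<zeta> * Lz z) * g 3 z \<zeta> = 0"
proof -
  define \<eta> where "\<eta> = inverse \<zeta>"
  have i: "\<eta> * \<zeta> = 1" using assms by (simp add: \<eta>_def)
  note e = eq2[of z] eq1[of z] eq2'[of z] eq1'[of z]
  note d = Gz_def Gb_def g_def \<eta>_def[symmetric]
  show "\<zeta> * Gz 0 z \<zeta> + Gb 0 z \<zeta> + L z * (cnj (Lz z) - \<zeta> * Lz z) * g 1 z \<zeta> = 0"
    using e i unfolding d by simp algebra
  show "\<zeta> * Gz 0 z \<zeta> + \<zeta> * Gz 1 z \<zeta> + Gb 1 z \<zeta> - L z * \<zeta> * Lz z * g 1 z \<zeta>
      + L z * (cnj (Lz z) - \<zeta> * Lz z) * g 2 z \<zeta> = 0"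
    using e i unfolding d by simp algebra
  show "\<zeta> * Gz 0 z \<zeta> + 2 * \<zeta> * Gz 1 z \<zeta> + \<zeta> * Gz 2 z \<zeta> + Gb 2 z \<zeta> - L z * \<zeta> * Lz z * g 1 z \<zeta>
      - 2 * L z * \<zeta> * Lz z * g 2 z \<zeta> + L z * (cnj (Lz z) - \<zeta> * Lz z) * g 3 z \<zeta> = 0"
    using e i unfolding d by simp algebra
qed

lemma C1_g:
  assumes \<zeta>: "C1 S \<zeta>" "\<And>z. z \<in> S \<Longrightarrow> \<zeta> z \<noteq> 0"
  shows "C1 S (\<lambda>z. Gz j z (\<zeta> z))" "C1 S (\<lambda>z. G j z (\<zeta> z))"
proof -
  note sub = C1_subset[OF _ subset_UNIV, of _ S]
  have C: "C1 S (\<lambda>z. if j = 0 then C z else 0)" "C1 S (\<lambda>z. if j = 0 then Cz z else 0)"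
    using sub[OF C1_C] sub[OF C1_derivs(4)] C1_const[of S 0] by (cases "j = 0"; simp)+
  have i: "C1 S (\<lambda>z. inverse (\<zeta> z))" using \<zeta> by (rule C1_inverse)
  have g: "C1 S (\<lambda>z. g j z (\<zeta> z))"
    unfolding g_def by (intro C1_add C1_mult C1_const C1_cnj C1_power \<zeta>(1) i C sub[OF C1_B])
  show "C1 S (\<lambda>z. G j z (\<zeta> z))"
    unfolding G_def by (intro C1_mult C1_power g sub[OF C1_L])
  show "C1 S (\<lambda>z. Gz j z (\<zeta> z))"
    unfolding Gz_def
    by (intro C1_add C1_mult C1_const C1_cnj C1_power g \<zeta>(1) i C sub[OF C1_L] C1_derivs(1-3)[THEN sub])
qed

subsection \<open>Branches of critical points\<close>

text \<open>Covers at once the root \<open>w\<close> in the disc and the roots \<open>circ 1\<close>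
  and \<open>circ (- 1)\<close> on the circle. Simplicity of the root is what makes a continuous
  branch differentiable.\<close>

definition branch :: "complex set \<Rightarrow> (complex \<Rightarrow> complex) \<Rightarrow> bool" where
  "branch S \<zeta> \<longleftrightarrow> open S \<and> continuous_on S \<zeta> \<and>
    (\<forall>z\<in>S. \<zeta> z \<noteq> 0 \<and> crit_poly A (B z) (\<zeta> z) = 0 \<and> crit_deriv A (B z) (\<zeta> z) \<noteq> 0)"

lemma branch_wirt:
  assumes "branch S \<zeta>" "z \<in> S"
  shows "wirt \<zeta> (- (Bz z * \<zeta> z ^ 3 - cnj (Bb z) * \<zeta> z) / crit_deriv A (B z) (\<zeta> z))
    (- (Bb z * \<zeta> z ^ 3 - cnj (Bz z) * \<zeta> z) / crit_deriv A (B z) (\<zeta> z)) z"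
  using assms unfolding branch_def
  by (intro wirt_root[OF wirt_B, of S]) (auto simp: continuous_on_eq_continuous_at)

lemma branch_C1:
  assumes "branch S \<zeta>"
  shows "C1 S \<zeta>"
proof (rule C1I[OF branch_wirt[OF assms]])
  have b: "continuous_on S \<zeta>" "\<forall>z\<in>S. crit_deriv A (B z) (\<zeta> z) \<noteq> 0"
    using assms by (auto simp: branch_def)
  have c: "continuous_on S B" "continuous_on S Bz" "continuous_on S Bb"
    using C1_continuous[OF C1_B] C1_continuous[OF C1_derivs(2)] C1_continuous[OF C1_derivs(3)]
    by (auto elim: continuous_on_subset)
  have d: "continuous_on S (\<lambda>z. crit_deriv A (B z) (\<zeta> z))"
    unfolding crit_deriv_def by (intro continuous_intros b c)
  show "continuous_on S (\<lambda>z. - (Bz z * \<zeta> z ^ 3 - cnj (Bb z) * \<zeta> z) / crit_deriv A (B z) (\<zeta> z))"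
    "continuous_on S (\<lambda>z. - (Bb z * \<zeta> z ^ 3 - cnj (Bz z) * \<zeta> z) / crit_deriv A (B z) (\<zeta> z))"
    by (rule continuous_on_divide; (rule d b)?; intro continuous_intros b c)+
qed

lemma branch_g1: "branch S \<zeta> \<Longrightarrow> z \<in> S \<Longrightarrow> g 1 z (\<zeta> z) = 0"
  by (simp add: g1_crit[unfolded One_nat_def] branch_def)

text \<open>At a critical point the motion of \<zeta> does not affect the value to first order, and
  the last term of the transport equation drops out; the rest ties the two derivatives by the factor
  - \<zeta>.\<close>

lemma branch_value:
  assumes b: "branch S \<zeta>" and z: "z \<in> S"
  shows "wirt (\<lambda>z. G 0 z (\<zeta> z)) (Gz 0 z (\<zeta> z)) (- \<zeta> z * Gz 0 z (\<zeta> z)) z"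
proof -
  have nz: "\<zeta> z \<noteq> 0" using assms by (auto simp: branch_def)
  note g1 = branch_g1[OF assms]
  have "Gb 0 z (\<zeta> z) = - \<zeta> z * Gz 0 z (\<zeta> z)"
    using transport(1)[OF nz, of z] unfolding g1 by (simp add: add_eq_0_iff)
  then show ?thesis
    using wirt_G[OF branch_wirt[OF assms] nz, of 0] g1 by (simp add: G_def)
qed

text \<open>The first two equations say that \<open>G 1\<close> stays zero along the branch.
  Inserted into the transport equation differentiated once by \<zeta>, they give the last one, which
  relates the first derivatives of L, of the branch and of its critical value.\<close>

lemma branch_first_order:
  assumes b: "branch S \<zeta>" and z: "z \<in> S" and ac: "wirt \<zeta> a c z"
  defines "\<gamma> \<equiv> G 2 z (\<zeta> z)" and "\<eta> \<equiv> inverse (\<zeta> z)"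
  shows "Gz 1 z (\<zeta> z) = - \<gamma> * a * \<eta>" "Gb 1 z (\<zeta> z) = - \<gamma> * c * \<eta>" "\<gamma> \<noteq> 0"
    "L z * (\<zeta> z * Gz 0 z (\<zeta> z) - \<gamma> * a - \<gamma> * c * \<eta>) + (cnj (Lz z) - \<zeta> z * Lz z) * \<gamma> = 0"
proof -
  have nz: "\<zeta> z \<noteq> 0" using assms by (auto simp: branch_def)
  have i: "\<eta> * \<zeta> z = 1" using nz by (simp add: \<eta>_def)
  define D where "D = crit_deriv A (B z) (\<zeta> z)"
  have D: "D \<noteq> 0" using assms by (auto simp: branch_def D_def)
  have g2: "g 2 z (\<zeta> z) * \<zeta> z = D" using b z nz by (simp add: g2_crit branch_def D_def)
  have "D * a = - (Bz z * \<zeta> z ^ 3 - cnj (Bb z) * \<zeta> z)" "D * c = - (Bb z * \<zeta> z ^ 3 - cnj (Bz z) * \<zeta> z)"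
    using wirt_unique[OF ac branch_wirt[OF b z]] D by (auto simp: D_def)
  then have ag: "g 2 z (\<zeta> z) * \<zeta> z * a = - (Bz z * \<zeta> z ^ 3 - cnj (Bb z) * \<zeta> z)"
    "g 2 z (\<zeta> z) * \<zeta> z * c = - (Bb z * \<zeta> z ^ 3 - cnj (Bz z) * \<zeta> z)"
    unfolding g2 .
  note g1 = branch_g1[OF b z]
  have \<gamma>: "\<gamma> = (L z)\<^sup>2 * g 2 z (\<zeta> z)" by (simp add: \<gamma>_def G_def)
  show "\<gamma> \<noteq> 0" unfolding \<gamma> using g2 D L_nz[of z] by auto
  have "Bz z * \<zeta> z - cnj (Bb z) * \<eta> = - g 2 z (\<zeta> z) * a * \<eta>"
    using ag(1) i by algebra
  then show Gz1: "Gz 1 z (\<zeta> z) = - \<gamma> * a * \<eta>"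
    unfolding Gz_def g1 \<gamma> by (simp add: \<eta>_def[symmetric])
  have "Bb z * \<zeta> z - cnj (Bz z) * \<eta> = - g 2 z (\<zeta> z) * c * \<eta>"
    using ag(2) i by algebra
  then show Gb1: "Gb 1 z (\<zeta> z) = - \<gamma> * c * \<eta>"
    unfolding Gb_def g1 \<gamma> by (simp add: \<eta>_def[symmetric])
  show "L z * (\<zeta> z * Gz 0 z (\<zeta> z) - \<gamma> * a - \<gamma> * c * \<eta>) + (cnj (Lz z) - \<zeta> z * Lz z) * \<gamma> = 0"
    using transport(2)[OF nz, of z] i unfolding g1 Gz1 Gb1 \<gamma> by algebra
qed

text \<open>
  The critical values are Riemann invariants. This is the Riccati equation along
  characteristics for the derivative of one of them, multiplied by an integrating factor.
\<close>

lemma branch_riccati: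
  assumes b: "branch S \<zeta>" and z: "z \<in> S"
  defines "Y \<equiv> \<lambda>z. \<zeta> z * (Gz 0 z (\<zeta> z))\<^sup>2 * G 2 z (\<zeta> z) / L z"
  shows "C1 S Y"
    "wirt Y Yz Yb z \<Longrightarrow> (\<zeta> z * Yz + Yb) * G 2 z (\<zeta> z) * L z = (\<zeta> z)\<^sup>2 * (Gz 0 z (\<zeta> z)) ^ 3 * G 3 z (\<zeta> z)"
proof -
  have S: "open S" and nzS: "\<And>z. z \<in> S \<Longrightarrow> \<zeta> z \<noteq> 0" using b by (auto simp: branch_def)
  have nz: "\<zeta> z \<noteq> 0" using nzS z by auto
  note C\<zeta> = branch_C1[OF b]
  note CG = C1_g[OF C\<zeta> nzS]
  show "C1 S Y" unfolding Y_def
    by (intro C1_divide C1_mult C1_power C\<zeta> CG C1_subset[OF C1_L] L_nz) auto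
  assume Y: "wirt Y Yz Yb z"
  obtain a c where ac: "wirt \<zeta> a c z" using branch_wirt[OF b z] by blast
  obtain p q where pq: "wirt (\<lambda>z. Gz 0 z (\<zeta> z)) p q z" using CG(1)[of 0] z unfolding C1_def by blast
  have "wirt (\<lambda>z. - \<zeta> z * Gz 0 z (\<zeta> z)) (- a * Gz 0 z (\<zeta> z) + - \<zeta> z * p) (- c * Gz 0 z (\<zeta> z) + - \<zeta> z * q) z"
    by (rule wirt_mult[OF wirt_minus[OF ac] pq])
  \<comment> \<open>By equality of mixed derivatives, the second derivatives of the critical value
    enter the claim only through \<zeta> p + q, which is a first-order expression.\<close>
  from wirt_mixed[OF S z branch_value[OF b] CG(1) pq C1_mult[OF C1_minus[OF C\<zeta>] CG(1)] this]
  have q: "q = - a * Gz 0 z (\<zeta> z) - \<zeta> z * p" by simp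
  have G2: "wirt (\<lambda>z. G 2 z (\<zeta> z)) (Gz 2 z (\<zeta> z) + G 3 z (\<zeta> z) * a / \<zeta> z) (Gb 2 z (\<zeta> z) + G 3 z (\<zeta> z) * c / \<zeta> z) z"
    using wirt_G[OF ac nz, of 2] by (simp add: eval_nat_numeral)
  define \<psi> \<gamma> t \<eta> where "\<psi> = Gz 0 z (\<zeta> z)" and "\<gamma> = G 2 z (\<zeta> z)" and "t = G 3 z (\<zeta> z)" and "\<eta> = inverse (\<zeta> z)"
  have i: "\<eta> * \<zeta> z = 1" using nz by (simp add: \<eta>_def)
  note Yw = wirt_divide[OF wirt_mult[OF wirt_mult[OF ac wirt_power[OF pq, of 2]] G2] wirt_L L_nz]
  have Y1: "Yz * (L z)\<^sup>2 = ((a * \<psi>\<^sup>2 + \<zeta> z * (2 * \<psi> * p)) * \<gamma> + \<zeta> z * \<psi>\<^sup>2 * (Gz 2 z (\<zeta> z) + t * a * \<eta>)) * L z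
      - \<zeta> z * \<psi>\<^sup>2 * \<gamma> * Lz z"
    "Yb * (L z)\<^sup>2 = ((c * \<psi>\<^sup>2 + \<zeta> z * (2 * \<psi> * q)) * \<gamma> + \<zeta> z * \<psi>\<^sup>2 * (Gb 2 z (\<zeta> z) + t * c * \<eta>)) * L z
      - \<zeta> z * \<psi>\<^sup>2 * \<gamma> * cnj (Lz z)"
    using wirt_unique[OF Y Yw[folded Y_def]] L_nz[of z]
    by (simp_all add: \<psi>_def \<gamma>_def t_def \<eta>_def divide_inverse)
  note g1 = branch_g1[OF b z]
  have \<gamma>: "\<gamma> = (L z)\<^sup>2 * g 2 z (\<zeta> z)" "t = (L z)\<^sup>2 * g 3 z (\<zeta> z)" by (simp_all add: \<gamma>_def t_def G_def)
  note first = branch_first_order[OF b z ac, folded \<gamma>_def \<eta>_def \<psi>_def]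
  note T1 = first(4)
  have T2: "L z * (\<zeta> z * \<psi> - 2 * \<gamma> * a + \<zeta> z * Gz 2 z (\<zeta> z) + Gb 2 z (\<zeta> z)) - 2 * \<zeta> z * Lz z * \<gamma>
      + (cnj (Lz z) - \<zeta> z * Lz z) * t = 0"
    using transport(3)[OF nz, of z] i unfolding g1 first(1,2) \<psi>_def[symmetric] \<gamma> by algebra
  have "L z * ((\<zeta> z * Yz + Yb) * \<gamma> * L z - (\<zeta> z)\<^sup>2 * \<psi> ^ 3 * t) = 0"
    using Y1 q[folded \<psi>_def] T1 T2 i by algebra
  then show "(\<zeta> z * Yz + Yb) * G 2 z (\<zeta> z) * L z = (\<zeta> z)\<^sup>2 * (Gz 0 z (\<zeta> z)) ^ 3 * G 3 z (\<zeta> z)"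
    using L_nz[of z] by (simp add: \<psi>_def \<gamma>_def t_def)
qed

subsection \<open>The elliptic region\<close>

text \<open>Being given by roots in the disc, E refers to conformal coordinates alone;
  \<open>elliptic_in_Ell\<close> places the elliptic points in this set.\<close>

definition E :: "complex set" where
  "E = {z. \<exists>\<zeta>. cmod \<zeta> < 1 \<and> crit_poly A (B z) \<zeta> = 0}"

definition w :: "complex \<Rightarrow> complex" where
  "w z = (SOME \<zeta>. cmod \<zeta> < 1 \<and> crit_poly A (B z) \<zeta> = 0)"

lemma w_root: "z \<in> E \<Longrightarrow> cmod (w z) < 1" "z \<in> E \<Longrightarrow> crit_poly A (B z) (w z) = 0"
  using someI_ex[of "\<lambda>\<zeta>. cmod \<zeta> < 1 \<and> crit_poly A (B z) \<zeta> = 0"] unfolding E_def w_def by blast+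

lemma w_eqI:
  assumes "cmod \<zeta> < 1" "crit_poly A (B z) \<zeta> = 0"
  shows "z \<in> E" "w z = \<zeta>"
proof -
  show z: "z \<in> E" using assms by (auto simp: E_def)
  show "w z = \<zeta>" using crit_root_unique[OF A_nz assms(2,1) w_root(2,1)[OF z]] .
qed

lemmas w_factor = crit_factor[OF A_nz w_root(2,1)]

lemma w_nz: "z \<in> E \<Longrightarrow> w z \<noteq> 0"
  using w_factor(1) by blast

lemma cont_B: "isCont B z"
  using wirt_continuous[OF wirt_B] .

lemma w_near:
  assumes z0: "z0 \<in> E" and e: "e > 0"
  shows "\<forall>\<^sub>F z in nhds z0. z \<in> E \<and> dist (w z) (w z0) < e"
proof -
  \<comment> \<open>The second bound keeps the nearby root inside the open disc, where uniqueness
    identifies it with \<open>w z\<close>.\<close>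
  define d where "d = min e (1 - cmod (w z0))"
  have d: "d > 0" using e w_root(1)[OF z0] by (simp add: d_def)
  have "isCont (\<lambda>z. cmod (crit_poly A (B z) (w z0))) z0"
    unfolding crit_poly_def by (intro continuous_intros cont_B)
  then have "((\<lambda>z. cmod (crit_poly A (B z) (w z0))) \<longlongrightarrow> cmod (crit_poly A (B z0) (w z0))) (nhds z0)"
    unfolding isCont_def by (rule tendsto_at_iff_tendsto_nhds[THEN iffD1])
  then have "((\<lambda>z. cmod (crit_poly A (B z) (w z0))) \<longlongrightarrow> 0) (nhds z0)"
    using w_root(2)[OF z0] by simp
  moreover have "2 * cmod A * d ^ 4 > 0" using d A_nz by simp
  ultimately have "\<forall>\<^sub>F z in nhds z0. cmod (crit_poly A (B z) (w z0)) < 2 * cmod A * d ^ 4"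
    by (rule order_tendstoD)
  then show ?thesis
  proof (rule eventually_mono)
    fix z assume "cmod (crit_poly A (B z) (w z0)) < 2 * cmod A * d ^ 4"
    then obtain \<zeta> where \<zeta>: "crit_poly A (B z) \<zeta> = 0" "dist \<zeta> (w z0) < d"
      using crit_poly_root_near[OF A_nz d] by blast
    have "cmod \<zeta> \<le> cmod (w z0) + dist \<zeta> (w z0)"
      by (metis dist_norm norm_triangle_sub)
    then have "cmod \<zeta> < 1" using \<zeta>(2) by (simp add: d_def)
    from w_eqI[OF this \<zeta>(1)] \<zeta>(2) show "z \<in> E \<and> dist (w z) (w z0) < e" by (simp add: d_def)
  qed
qed

lemma open_E: "open E"
proof (rule open_subopen[THEN iffD2], rule ballI)
  fix z0 assume "z0 \<in> E"
  from w_near[OF this zero_less_one] show "\<exists>T. open T \<and> z0 \<in> T \<and> T \<subseteq> E"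
    unfolding eventually_nhds by blast
qed

lemma cont_w: "continuous_on E w"
proof (rule continuous_at_imp_continuous_on, rule ballI)
  fix z assume z: "z \<in> E"
  show "isCont w z" unfolding isCont_def tendsto_iff
  proof (intro allI impI)
    fix e :: real assume "e > 0"
    from w_near[OF z this] show "\<forall>\<^sub>F y in at z. dist (w y) (w z) < e"
      unfolding eventually_at_filter by (rule eventually_mono) simp
  qed
qed

lemma branch_w: "branch E w"
  unfolding branch_def
proof (intro conjI ballI)
  fix z assume z: "z \<in> E"
  show "crit_deriv A (B z) (w z) \<noteq> 0" using crit_root_simple[OF A_nz w_root(2,1)[OF z]] .
qed (auto simp: open_E cont_w w_nz w_root)

text \<open>The points with a root in the closed disc of radius k form a closed set, as a projection
  along a compact factor, and z0 is not one of them.\<close>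

lemma w_modulus_boundary:
  assumes z0: "z0 \<notin> E" and k: "k < 1"
  shows "\<forall>\<^sub>F z in nhds z0. z \<in> E \<longrightarrow> cmod (w z) > k"
proof -
  let ?F = "{z. \<exists>\<zeta>. \<zeta> \<in> cball 0 k \<and> (\<zeta>, z) \<in> {(\<zeta>, z). crit_poly A (B z) \<zeta> = 0}}"
  have c: "isCont (\<lambda>p. B (snd p)) p" for p :: "complex \<times> complex"
    by (rule isCont_o2[where f = snd and g = B]) (auto intro: cont_B continuous_intros)
  have "isCont (\<lambda>p. crit_poly A (B (snd p)) (fst p)) p" for p
    unfolding crit_poly_def by (intro continuous_intros c)
  then have "closed ((\<lambda>p. crit_poly A (B (snd p)) (fst p)) -` {0})"
    by (intro continuous_closed_vimage) auto
  also have "(\<lambda>p. crit_poly A (B (snd p)) (fst p)) -` {0} = {(\<zeta>, z). crit_poly A (B z) \<zeta> = 0}"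
    by auto
  finally have "closed ?F" by (intro closed_compact_projection compact_cball)
  moreover have "z0 \<notin> ?F" using z0 k by (auto simp: E_def)
  ultimately have "\<forall>\<^sub>F z in nhds z0. z \<notin> ?F"
    by (intro eventually_nhds[THEN iffD2] exI[of _ "- ?F"]) (auto simp: open_Compl)
  moreover have "z \<in> E \<longrightarrow> cmod (w z) > k" if "z \<notin> ?F" for z
  proof
    assume "z \<in> E"
    with that have "w z \<notin> cball 0 k" using w_root(2) by blast
    then show "cmod (w z) > k" by simp
  qed
  ultimately show ?thesis by (rule eventually_mono)
qed

lemma periodic_w: "w (z + o1) = w z" "w (z + o2) = w z"
  by (simp_all add: w_def periodic_B)

lemma periodic_E: "z + o1 \<in> E \<longleftrightarrow> z \<in> E" "z + o2 \<in> E \<longleftrightarrow> z \<in> E"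
  by (simp_all add: E_def periodic_B)

text \<open>Only the imaginary part of the complex Riemann invariant matters for the maximum principle below.\<close>

lemma Im_value:
  assumes z: "z \<in> E"
  defines "s \<equiv> (cmod (w z))\<^sup>2"
  shows "Im (g 0 z (w z)) * (s\<^sup>2 * (1 + s)) = Im (A * (w z)\<^sup>2) * (1 - s) ^ 3"
proof -
  note f = w_factor(4-6)[OF z z]
  define \<omega> v where "\<omega> = w z" and "v = cnj (w z)"
  have nz: "\<omega> \<noteq> 0" "v \<noteq> 0" using w_nz[OF z] by (auto simp: \<omega>_def v_def)
  define \<alpha> \<beta> where "\<alpha> = - 2 * A / cnj (w z)" and "\<beta> = 2 * \<i> * complex_of_real (Im (w z * (- 2 * A / cnj (w z))) / (1 + (cmod (w z))\<^sup>2))"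
  have f2: "- v * \<alpha> = 2 * A" and f3: "B z = (1 + \<omega> * v) * \<alpha> - \<beta> * v" and f4: "(1 + \<omega> * v) * \<beta> = \<omega> * \<alpha> - v * cnj \<alpha>"
    using f unfolding \<alpha>_def \<beta>_def \<omega>_def v_def by auto
  have "cnj \<beta> = - \<beta>" by (simp add: \<beta>_def)
  then have f3': "cnj (B z) = (1 + \<omega> * v) * cnj \<alpha> + \<beta> * \<omega>" and f2': "- \<omega> * cnj \<alpha> = 2 * cnj A"
    using arg_cong[OF f3, of cnj] arg_cong[OF f2, of cnj] by (simp_all add: \<omega>_def v_def mult.commute)
  define X where "X = g 0 z (w z)"
  have X: "X * \<omega>\<^sup>2 = A * \<omega> ^ 4 + B z * \<omega> ^ 3 + C z * \<omega>\<^sup>2 + cnj (B z) * \<omega> + cnj A"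
    using nz unfolding X_def g_def \<omega>_def[symmetric] by (simp add: field_simps power2_eq_square power3_eq_cube power4_eq_xxxx)
  have X': "cnj X * v\<^sup>2 = cnj A * v ^ 4 + cnj (B z) * v ^ 3 + C z * v\<^sup>2 + B z * v + A"
    using arg_cong[OF X, of cnj] by (simp add: \<omega>_def v_def cnj_C)
  define \<kappa> where "\<kappa> = - \<alpha> / 2"
  have \<kappa>: "\<alpha> = - 2 * \<kappa>" "cnj \<alpha> = - 2 * cnj \<kappa>" by (simp_all add: \<kappa>_def)
  have A2: "A = v * \<kappa>" "cnj A = \<omega> * cnj \<kappa>" using f2 f2' unfolding \<kappa> by simp_all
  \<comment> \<open>The factor 1 + \<omega> v removes the denominator of \<beta>. The claim becomes
    a polynomial identity in which v and cnj \<kappa> count as independent of \<omega> and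
    \<kappa>.\<close>
  have B2: "(1 + \<omega> * v) * B z = (1 + \<omega> * v)\<^sup>2 * \<alpha> - v * (\<omega> * \<alpha> - v * cnj \<alpha>)"
    "(1 + \<omega> * v) * cnj (B z) = (1 + \<omega> * v)\<^sup>2 * cnj \<alpha> + \<omega> * (\<omega> * \<alpha> - v * cnj \<alpha>)"
    unfolding f4[symmetric] f3' unfolding f3 by algebra+
  have "(X - cnj X) * ((\<omega> * v)\<^sup>2 * (1 + \<omega> * v))
      = (1 + \<omega> * v) * v\<^sup>2 * (X * \<omega>\<^sup>2) - (1 + \<omega> * v) * \<omega>\<^sup>2 * (cnj X * v\<^sup>2)"
    by algebra
  also have "\<dots> = (1 + \<omega> * v) * (v\<^sup>2 * \<omega> ^ 4 - \<omega>\<^sup>2) * A + (v\<^sup>2 * \<omega> ^ 3 - \<omega>\<^sup>2 * v) * ((1 + \<omega> * v) * B z)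
      + (v\<^sup>2 * \<omega> - \<omega>\<^sup>2 * v ^ 3) * ((1 + \<omega> * v) * cnj (B z)) + (1 + \<omega> * v) * (v\<^sup>2 - \<omega>\<^sup>2 * v ^ 4) * cnj A"
    unfolding X X' by algebra
  also have "\<dots> = (A * \<omega>\<^sup>2 - cnj A * v\<^sup>2) * (1 - \<omega> * v) ^ 3"
    unfolding B2 A2(2) \<kappa>(2) unfolding A2(1) \<kappa>(1)
    by (simp add: algebra_simps power2_eq_square power3_eq_cube power4_eq_xxxx)
  finally have "(X - cnj X) * ((\<omega> * v)\<^sup>2 * (1 + \<omega> * v)) = (A * \<omega>\<^sup>2 - cnj A * v\<^sup>2) * (1 - \<omega> * v) ^ 3" .
  moreover have "\<omega> * v = of_real s" by (simp add: \<omega>_def v_def s_def complex_norm_square flip: of_real_power)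
  moreover have "X - cnj X = 2 * \<i> * of_real (Im X)" "A * \<omega>\<^sup>2 - cnj A * v\<^sup>2 = 2 * \<i> * of_real (Im (A * \<omega>\<^sup>2))"
    using complex_diff_cnj[of X] complex_diff_cnj[of "A * \<omega>\<^sup>2"] by (simp_all add: \<omega>_def v_def mult.commute)
  ultimately have "2 * \<i> * of_real (Im X * (s\<^sup>2 * (1 + s))) = 2 * \<i> * of_real (Im (A * \<omega>\<^sup>2) * (1 - s) ^ 3)"
    by (simp add: mult.assoc)
  then have "complex_of_real (Im X * (s\<^sup>2 * (1 + s))) = of_real (Im (A * \<omega>\<^sup>2) * (1 - s) ^ 3)" by simp
  then show ?thesis unfolding of_real_eq_iff X_def \<omega>_def .
qed

end

subsection \<open>The complex Riemann invariant\<close>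

lemma DERIV_max_square: "((\<lambda>x. (max 0 x)\<^sup>2) has_real_derivative 2 * max 0 x) (at x)"
proof -
  consider "x > 0" | "x < 0" | "x = 0" by linarith
  then show ?thesis
  proof cases
    case 1
    have "((\<lambda>x. x\<^sup>2) has_real_derivative 2 * max 0 x) (at x)"
      using 1 by (auto intro!: derivative_eq_intros)
    then show ?thesis
      by (rule has_field_derivative_transform_within_open[where S = "{0<..}"]) (use 1 in auto)
  next
    case 2
    have "((\<lambda>x. 0) has_real_derivative 2 * max 0 x) (at x)"
      using 2 by auto
    then show ?thesis
      by (rule has_field_derivative_transform_within_open[where S = "{..<0}"]) (use 2 in auto)
  next
    case 3
    have "((\<lambda>h::real. max 0 h) \<longlongrightarrow> max 0 0) (at 0)" by (intro tendsto_intros)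
    then have "((\<lambda>h::real. max 0 h) \<longlongrightarrow> 0) (at 0)" by simp
    then have "((\<lambda>h. ((max 0 (0 + h))\<^sup>2 - (max 0 0)\<^sup>2) / h) \<longlongrightarrow> (0::real)) (at 0)"
      by (rule Lim_transform_eventually)
         (auto simp: eventually_at power2_eq_square max_def intro!: exI[of _ 1])
    then show ?thesis using 3 by (simp add: DERIV_def)
  qed
qed

text \<open>A continuously differentiable, non-decreasing function that vanishes on [- e, e] and is
  strictly increasing beyond. Squaring the maximum gives the smoothness; the odd factor y makes the
  derivative non-negative on both sides.\<close>

definition cutoff :: "real \<Rightarrow> real \<Rightarrow> real" where
  "cutoff e y = (max 0 (y\<^sup>2 - e\<^sup>2))\<^sup>2 * y"

definition cutoff' :: "real \<Rightarrow> real \<Rightarrow> real" where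
  "cutoff' e y = (max 0 (y\<^sup>2 - e\<^sup>2))\<^sup>2 + 4 * y\<^sup>2 * max 0 (y\<^sup>2 - e\<^sup>2)"

lemma DERIV_cutoff: "(cutoff e has_real_derivative cutoff' e y) (at y)"
proof -
  have "((\<lambda>y. y\<^sup>2 - e\<^sup>2) has_real_derivative 2 * y) (at y)"
    by (auto intro!: derivative_eq_intros)
  from DERIV_chain2[OF DERIV_max_square this]
  have "((\<lambda>y. (max 0 (y\<^sup>2 - e\<^sup>2))\<^sup>2) has_real_derivative 2 * max 0 (y\<^sup>2 - e\<^sup>2) * (2 * y)) (at y)" .
  from DERIV_mult[OF this DERIV_ident]
  show ?thesis unfolding cutoff_def[abs_def] cutoff'_def
    by (rule DERIV_cong) (simp add: power2_eq_square algebra_simps)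
qed

lemma cutoff_zero:
  assumes "\<bar>y\<bar> < e"
  shows "cutoff e y = 0" "cutoff' e y = 0"
proof -
  have "y\<^sup>2 \<le> e\<^sup>2" using assms by (intro power2_le_iff_abs_le[THEN iffD2]) auto
  then show "cutoff e y = 0" "cutoff' e y = 0" by (simp_all add: cutoff_def cutoff'_def)
qed

lemma cutoff'_nonneg: "cutoff' e y \<ge> 0"
  by (simp add: cutoff'_def)

lemma cutoff'_pos:
  assumes "\<bar>y\<bar> > e" "e \<ge> 0"
  shows "cutoff' e y > 0"
proof -
  have "y\<^sup>2 > e\<^sup>2" using assms abs_le_square_iff[of y e] by (simp add: not_le)
  then show ?thesis unfolding cutoff'_def by (intro add_pos_nonneg) auto
qed

context conformal_quartic
begin

lemma Im_G:
  "Im (G 0 z \<zeta>) = (Re (L z))\<^sup>2 * Im (g 0 z \<zeta>)"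
proof -
  have "L z = of_real (Re (L z))" using cnj_L[of z] by (simp add: complex_eq_iff)
  then have "G 0 z \<zeta> = of_real ((Re (L z))\<^sup>2) * g 0 z \<zeta>" unfolding G_def by (metis of_real_power)
  then show ?thesis by simp
qed

lemma Im_value_zero_iff:
  assumes z: "z \<in> E"
  shows "Im (G 0 z (w z)) = 0 \<longleftrightarrow> Im (A * (w z)\<^sup>2) = 0"
proof -
  have "(cmod (w z))\<^sup>2 < 1" using w_root(1)[OF z] by (simp add: power_less_one_iff)
  moreover have "(cmod (w z))\<^sup>2 > 0" using w_nz[OF z] by simp
  ultimately show ?thesis using Im_value[OF z] pos_L[of z] unfolding Im_G
    by (metis add_pos_pos diff_gt_0_iff_gt less_irrefl mult_eq_0_iff power_eq_0_iff zero_less_one)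
qed

text \<open>By \<open>Im_value\<close> the imaginary part carries the factor (1 - |w|^2)^3, and |w|
  tends to 1 at the boundary, while L stays bounded near z0.\<close>

lemma Im_value_boundary:
  assumes z0: "z0 \<notin> E" and e: "e > 0"
  shows "\<forall>\<^sub>F z in nhds z0. z \<in> E \<longrightarrow> \<bar>Im (G 0 z (w z))\<bar> < e"
proof -
  define M where "M = (Re (L z0) + 1)\<^sup>2 * cmod A"
  have M: "M > 0" using pos_L[of z0] A_nz by (auto simp: M_def)
  \<comment> \<open>k \<ge> 1/2 keeps s = |w|^2 above 1/4, and 1 - k \<le> e / (16 M) gives 1 - s
    \<le> e / (8 M), so the final bound 4 M (1 - s) is at most e / 2.\<close>
  define k where "k = max (1/2) (1 - e / (16 * M))"
  have k: "k < 1" "k \<ge> 1/2" "1 - k \<le> e / (16 * M)" using M e by (auto simp: k_def)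
  have "isCont L z0" using wirt_continuous[OF wirt_L] .
  then have "isCont (\<lambda>z. Re (L z)) z0" by (rule isCont_Re)
  then have "((\<lambda>z. Re (L z)) \<longlongrightarrow> Re (L z0)) (nhds z0)"
    unfolding isCont_def by (rule tendsto_at_iff_tendsto_nhds[THEN iffD1])
  then have "\<forall>\<^sub>F z in nhds z0. Re (L z) < Re (L z0) + 1" by (rule order_tendstoD) simp
  with w_modulus_boundary[OF z0 k(1)] show ?thesis
  proof eventually_elim
    case (elim z)
    show ?case
    proof
      assume z: "z \<in> E"
      define s where "s = (cmod (w z))\<^sup>2"
      have wk: "cmod (w z) > k" "cmod (w z) < 1" using elim z w_root(1) by auto
      have s1: "s < 1" using wk by (simp add: s_def power_less_one_iff)
      have sk: "s \<ge> k\<^sup>2" using wk k unfolding s_def by (intro power_mono) auto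
      have "(1/2)\<^sup>2 \<le> k\<^sup>2" using k(2) by (intro power_mono) auto
      then have s4: "s \<ge> 1/4" using sk by (simp add: power2_eq_square)
      have "1 - k\<^sup>2 = (1 - k) * (1 + k)" by (simp add: power2_eq_square algebra_simps)
      also have "\<dots> \<le> e / (16 * M) * 2" using k by (intro mult_mono) auto
      finally have s2: "1 - s \<le> e / (8 * M)" using sk by simp
      have "\<bar>Im (A * (w z)\<^sup>2)\<bar> \<le> cmod A * s"
        using abs_Im_le_cmod[of "A * (w z)\<^sup>2"] by (simp add: norm_mult norm_power s_def)
      moreover have "(1 - s) ^ 3 \<le> 1 - s" using s1 s4
        by (metis diff_ge_0_iff_ge diff_le_eq le_add_same_cancel1 less_eq_real_def less_le_not_le linorder_not_le order_trans power_decreasing[of 1 3 "1 - s"] power_one_right one_le_numeral zero_le_divide_1_iff zero_le_numeral)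
      ultimately have "\<bar>Im (A * (w z)\<^sup>2)\<bar> * (1 - s) ^ 3 \<le> cmod A * s * (1 - s)"
        using s1 s4 by (intro mult_mono) auto
      then have "\<bar>Im (g 0 z (w z))\<bar> * (s\<^sup>2 * (1 + s)) \<le> cmod A * s * (1 - s)"
        using arg_cong[OF Im_value[OF z], of abs] s1 s4 unfolding s_def[symmetric] by (simp add: abs_mult)
      then have "s * (\<bar>Im (g 0 z (w z))\<bar> * (s * (1 + s))) \<le> s * (cmod A * (1 - s))"
        by (simp add: power2_eq_square algebra_simps)
      then have 1: "\<bar>Im (g 0 z (w z))\<bar> * (s * (1 + s)) \<le> cmod A * (1 - s)"
        using s4 by (simp add: mult_le_cancel_left)
      have "1/4 * 1 \<le> s * (1 + s)" using s4 by (intro mult_mono) auto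
      then have "\<bar>Im (g 0 z (w z))\<bar> * (1/4) \<le> \<bar>Im (g 0 z (w z))\<bar> * (s * (1 + s))"
        by (intro mult_left_mono) auto
      then have 2: "\<bar>Im (g 0 z (w z))\<bar> \<le> 4 * (cmod A * (1 - s))" using 1 by simp
      have "(Re (L z))\<^sup>2 \<le> (Re (L z0) + 1)\<^sup>2" using elim pos_L[of z] by (intro power_mono) auto
      then have "(Re (L z))\<^sup>2 * \<bar>Im (g 0 z (w z))\<bar> \<le> (Re (L z0) + 1)\<^sup>2 * (4 * (cmod A * (1 - s)))"
        using 2 by (intro mult_mono) auto
      also have "\<dots> = 4 * M * (1 - s)" by (simp add: M_def)
      also have "\<dots> \<le> 4 * M * (e / (8 * M))" using M by (intro mult_left_mono s2) auto
      also have "\<dots> < e" using M e by simp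
      finally show "\<bar>Im (G 0 z (w z))\<bar> < e" unfolding Im_G by (simp add: abs_mult)
    qed
  qed
qed

text \<open>
  The equation \<open>w r\<^sub>z + r\<^sub>b = 0\<close> makes \<open>r\<close> quasiregular, with Jacobian
  \<open>(1 - |w|\<^sup>2) |r\<^sub>z|\<^sup>2\<close>. Since \<open>Im r\<close> vanishes at the boundary of \<open>E\<close>, the Jacobian times a
  function of \<open>Im r\<close> that vanishes near zero is the divergence of a periodic field.
\<close>

lemma value_locally_constant:
  assumes z0: "z0 \<in> E" and ne: "Im (G 0 z0 (w z0)) \<noteq> 0"
  shows "Gz 0 z0 (w z0) = 0"
proof -
  define r \<psi> where "r z = G 0 z (w z)" and "\<psi> z = Gz 0 z (w z)" for z
  note C\<psi> = C1_g(1)[OF branch_C1[OF branch_w] w_nz, of 0, folded \<psi>_def]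
  note Cw = branch_C1[OF branch_w]
  have r: "wirt r (\<psi> z) (- w z * \<psi> z) z" if "z \<in> E" for z
    using branch_value[OF branch_w that] unfolding r_def \<psi>_def .
  obtain p q where pq: "\<And>z. z \<in> E \<Longrightarrow> wirt \<psi> (p z) (q z) z" "continuous_on E p" "continuous_on E q"
    using C\<psi> unfolding C1_def by blast
  have C2: "C1 E (\<lambda>z. - w z * \<psi> z)" by (rule C1_mult[OF C1_minus[OF Cw] C\<psi>])
  obtain q' s where qs': "\<And>z. z \<in> E \<Longrightarrow> wirt (\<lambda>z. - w z * \<psi> z) (q' z) (s z) z" "continuous_on E q'" "continuous_on E s"
    using C2 unfolding C1_def by blast
  have "q z = q' z" if "z \<in> E" for z
    by (rule wirt_mixed[OF open_E that r C\<psi> pq(1)[OF that] C2 qs'(1)[OF that]])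
  then have qs: "wirt (\<lambda>z. - w z * \<psi> z) (q z) (s z) z" if "z \<in> E" for z using qs'(1) that by simp
  \<comment> \<open>Up to taking real parts, \<open>W k\<close> is the derivative of r in the
    direction k, and \<open>V k z h\<close> that of \<open>W k\<close> in the direction h.\<close>
  define W where "W k z = \<psi> z * k + (- w z * \<psi> z) * cnj k" for k z
  define V where "V k z h = (p z * k + q z * cnj k) * h + (q z * k + s z * cnj k) * cnj h" for k z h
  have W: "((\<lambda>z. Re (W k z)) has_derivative (\<lambda>h. Re (V k z h))) (at z)" if "z \<in> E" for k z
  proof -
    have "wirt (W k) (p z * k + q z * cnj k) (q z * k + s z * cnj k) z"
      unfolding W_def
      by (rule wirt_cong[OF wirt_add[OF wirt_mult[OF pq(1)[OF that] wirt_const] wirt_mult[OF qs[OF that] wirt_const]]]) auto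
    then show ?thesis unfolding V_def by (rule has_derivative_Re_wirt)
  qed
  define e where "e = \<bar>Im (r z0)\<bar> / 2"
  have e: "e > 0" using ne by (simp add: e_def r_def)
  \<comment> \<open>The one-form cutoff(Im r) d(Re r) evaluated on k, extended by zero off E. Its
    exterior derivative on (o1, o2) is, up to orientation, \<open>cutoff'\<close> times the Jacobian
    of r; this is the divergence to be integrated.\<close>
  define P where "P k z = (if z \<in> E then cutoff e (Im (r z)) * Re (W k z) else 0)" for k z
  define P' where "P' k z h = (if z \<in> E then cutoff' e (Im (r z)) * Im (W h z) * Re (W k z)
      + cutoff e (Im (r z)) * Re (V k z h) else 0)" for k z h
  have contE: "continuous_on E (\<lambda>z. cutoff' e (Im (r z)))" "continuous_on E (\<lambda>z. cutoff e (Im (r z)))"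
    "continuous_on E (W k)" "continuous_on E (\<lambda>z. V k z h)" for k h
  proof -
    have c: "continuous_on E r" "continuous_on E \<psi>"
      using C1_continuous[OF C1_g(2)[OF Cw w_nz]] C1_continuous[OF C\<psi>] unfolding r_def by auto
    show "continuous_on E (\<lambda>z. cutoff' e (Im (r z)))" "continuous_on E (\<lambda>z. cutoff e (Im (r z)))"
      unfolding cutoff_def cutoff'_def by (intro continuous_intros c)+
    show "continuous_on E (W k)" unfolding W_def by (intro continuous_intros c cont_w)
    show "continuous_on E (\<lambda>z. V k z h)" unfolding V_def
      using continuous_on_subset[OF qs'(3)] pq by (intro continuous_intros qs'(3) pq(2,3))
  qed
  have off: "\<exists>T. open T \<and> z \<in> T \<and> (\<forall>y\<in>T. \<forall>k h. P k y = 0 \<and> P' k y h = 0)" if "z \<notin> E" for z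
    using Im_value_boundary[OF that e] unfolding eventually_nhds P_def P'_def r_def[symmetric]
    by (metis (no_types, lifting) cutoff_zero mult_zero_left add_0)
  have P: "(P k has_derivative P' k z) (at z)" for k z
  proof (cases "z \<in> E")
    case True
    have "((\<lambda>z. cutoff e (Im (r z))) has_derivative (\<lambda>h. cutoff' e (Im (r z)) * Im (W h z))) (at z)"
      using has_derivative_compose[OF has_derivative_Im_wirt[OF r[OF True]] DERIV_cutoff[unfolded has_field_derivative_def]]
      unfolding W_def .
    from has_derivative_mult[OF this W[OF True]]
    have "((\<lambda>z. cutoff e (Im (r z)) * Re (W k z)) has_derivative P' k z) (at z)"
      by (rule has_derivative_eq_rhs) (use True in \<open>simp add: P'_def fun_eq_iff algebra_simps\<close>)
    then show ?thesis
      by (rule has_derivative_transform_within_open[OF _ open_E True]) (simp add: P_def)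
  next
    case False
    then obtain T where T: "open T" "z \<in> T" "\<forall>y\<in>T. \<forall>k h. P k y = 0 \<and> P' k y h = 0"
      using off[OF False] by (elim exE conjE)
    have "P' k z = (\<lambda>h. 0)" using T by auto
    then show ?thesis
      using has_derivative_transform_within_open[OF has_derivative_const[of 0] T(1,2), of "P k"] T(3) by auto
  qed
  have cP: "continuous_on UNIV (\<lambda>z. P' k z h)" for k h
  proof (rule continuous_at_imp_continuous_on, rule ballI)
    fix z
    show "isCont (\<lambda>z. P' k z h) z"
    proof (cases "z \<in> E")
      case True
      have "continuous_on E (\<lambda>z. P' k z h) \<longleftrightarrow> continuous_on E (\<lambda>z. cutoff' e (Im (r z)) * Im (W h z) * Re (W k z)
          + cutoff e (Im (r z)) * Re (V k z h))"
        by (rule continuous_on_cong) (auto simp: P'_def)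
      moreover have "continuous_on E (\<lambda>z. cutoff' e (Im (r z)) * Im (W h z) * Re (W k z) + cutoff e (Im (r z)) * Re (V k z h))"
        by (intro continuous_on_add continuous_on_mult continuous_on_Re continuous_on_Im contE)
      ultimately show ?thesis using True open_E by (simp add: continuous_on_eq_continuous_at)
    next
      case False
      then obtain T where T: "open T" "z \<in> T" "\<forall>y\<in>T. \<forall>k h. P k y = 0 \<and> P' k y h = 0"
        using off[OF False] by (elim exE conjE)
      then have "continuous_on T (\<lambda>z. P' k z h) \<longleftrightarrow> continuous_on T (\<lambda>z. 0 :: real)"
        by (intro continuous_on_cong) auto
      then have "continuous_on T (\<lambda>z. P' k z h)" by simp
      then show ?thesis using T(1,2) by (simp add: continuous_on_eq_continuous_at)
    qed
  qed
  have per_r: "r (z + o1) = r z" "r (z + o2) = r z" for z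
    by (simp_all add: r_def G_def g_def periodic_w periodic_L periodic_B periodic_C)
  have per_\<psi>: "\<psi> (z + c) = \<psi> z" if "\<And>y. r (y + c) = r y" "z \<in> E" "z + c \<in> E" for z c
  proof -
    have "((\<lambda>y. y + c) has_derivative (\<lambda>h. h)) (at z)" by (auto intro!: derivative_eq_intros)
    from has_derivative_compose[OF this r[OF that(3), unfolded wirt_def]]
    have "wirt r (\<psi> (z + c)) (- w (z + c) * \<psi> (z + c)) z"
      unfolding wirt_def that(1) .
    from wirt_unique(1)[OF this r[OF that(2)]] show ?thesis .
  qed
  have per: "P k (z + o1) = P k z" "P k (z + o2) = P k z" for k z
    using per_\<psi>[of o1 z] per_\<psi>[of o2 z] by (auto simp: P_def per_r periodic_E W_def periodic_w)
  have jac: "P' o2 z o1 + - P' o1 z o2 = (if z \<in> E then cutoff' e (Im (r z)) * ((cmod (\<psi> z))\<^sup>2 * (1 - (cmod (w z))\<^sup>2) * Im (o1 * cnj o2)) else 0)" for z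
  proof -
    \<comment> \<open>The second derivatives of r cancel because q is both of its mixed
      derivatives.\<close>
    have V: "V o2 z o1 = V o1 z o2" unfolding V_def by (simp add: algebra_simps)
    have "Im (W o1 z) * Re (W o2 z) - Im (W o2 z) * Re (W o1 z) = (cmod (\<psi> z))\<^sup>2 * (1 - (cmod (w z))\<^sup>2) * Im (o1 * cnj o2)"
      unfolding W_def cmod_power2 by (simp add: power2_eq_square) algebra
    moreover have "P' o2 z o1 + - P' o1 z o2
        = (if z \<in> E then cutoff' e (Im (r z)) * (Im (W o1 z) * Re (W o2 z) - Im (W o2 z) * Re (W o1 z)) else 0)"
      unfolding P'_def V by (simp add: algebra_simps)
    ultimately show ?thesis by simp
  qed
  have "P' o2 z0 o1 + - P' o1 z0 o2 = 0"
  proof (rule periodic_divergence_zero[where P = "P o2" and P' = "P' o2" and Q = "\<lambda>z. - P o1 z" and Q' = "\<lambda>z h. - P' o1 z h"])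
    show "P' o2 z o1 + - P' o1 z o2 \<ge> 0" for z
    proof (cases "z \<in> E")
      case True
      have "(cmod (w z))\<^sup>2 \<le> 1" using w_root(1)[OF True] by (simp add: power_le_one_iff less_imp_le)
      then show ?thesis unfolding jac using True periods by (auto intro!: mult_nonneg_nonneg simp: cutoff'_nonneg)
    qed (simp add: P'_def)
    show "continuous_on UNIV (\<lambda>z. - P' o1 z o2)" by (intro continuous_on_minus cP)
    show "((\<lambda>z. - P o1 z) has_derivative (\<lambda>h. - P' o1 z h)) (at z)" for z by (rule has_derivative_minus[OF P])
  qed (auto simp: P per cP)
  moreover have "cutoff' e (Im (r z0)) > 0" using e by (intro cutoff'_pos) (auto simp: e_def)
  moreover have "(cmod (w z0))\<^sup>2 \<noteq> 1" using w_root(1)[OF z0] norm_ge_zero[of "w z0"] unfolding power2_eq_1_iff by linarith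
  ultimately have "cmod (\<psi> z0) = 0" unfolding jac using z0 periods by simp
  then show ?thesis by (simp add: \<psi>_def)
qed

text \<open>The level set \<open>S\<close> of Im r is open and closed in the plane: r is locally
  constant where Im r is not zero, and no point outside E is a limit of \<open>S\<close>, since Im r
  tends to zero there.\<close>

lemma elliptic_everywhere:
  assumes z0: "z0 \<in> E" and ne: "Im (G 0 z0 (w z0)) \<noteq> 0"
  shows "z \<in> E" "Im (G 0 z (w z)) \<noteq> 0"
proof -
  define r where "r z = G 0 z (w z)" for z
  define S where "S = {z \<in> E. Im (r z) = Im (r z0)}"
  have cr: "continuous_on E (\<lambda>z. Im (r z))"
    using C1_continuous[OF C1_g(2)[OF branch_C1[OF branch_w] w_nz]] unfolding r_def by (intro continuous_on_Im) auto
  have opn: "open {z \<in> E. Im (r z) \<in> U}" if "open U" for U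
    using continuous_open_preimage[OF cr open_E that] by (simp add: vimage_def Int_def)
  have "open S"
  proof (rule open_subopen[THEN iffD2], rule ballI)
    fix z assume z: "z \<in> S"
    have o: "open {z \<in> E. Im (r z) \<in> - {0}}" by (intro opn open_Compl closed_singleton)
    moreover have "z \<in> {z \<in> E. Im (r z) \<in> - {0}}" using z ne by (auto simp: S_def r_def)
    ultimately obtain d where d: "d > 0" "ball z d \<subseteq> {z \<in> E. Im (r z) \<in> - {0}}"
      by (meson openE)
    have "\<exists>c. \<forall>y\<in>ball z d. r y = c"
    proof (rule has_derivative_zero_constant)
      fix y assume y: "y \<in> ball z d"
      then have "wirt r (Gz 0 y (w y)) (- w y * Gz 0 y (w y)) y" "Gz 0 y (w y) = 0"
        using d(2) branch_value[OF branch_w, of y] value_locally_constant[of y] unfolding r_def by auto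
      then show "(r has_derivative (\<lambda>h. 0)) (at y within ball z d)"
        unfolding wirt_def by (auto intro: has_derivative_at_withinI)
    qed simp
    then have "ball z d \<subseteq> S" using d z by (force simp: S_def)
    then show "\<exists>T. open T \<and> z \<in> T \<and> T \<subseteq> S" using d(1) by (intro exI[of _ "ball z d"]) auto
  qed
  moreover have "open (- S)"
  proof (rule open_subopen[THEN iffD2], rule ballI)
    fix z assume z: "z \<in> - S"
    show "\<exists>T. open T \<and> z \<in> T \<and> T \<subseteq> - S"
    proof (cases "z \<in> E")
      case True
      have "open {z \<in> E. Im (r z) \<in> - {Im (r z0)}}" by (intro opn open_Compl closed_singleton)
      then show ?thesis
        using True z by (intro exI[of _ "{z \<in> E. Im (r z) \<in> - {Im (r z0)}}"]) (auto simp: S_def)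
    next
      case False
      have "\<bar>Im (r z0)\<bar> > 0" using ne by (simp add: r_def)
      from Im_value_boundary[OF False this] obtain T where
        "open T" "z \<in> T" "\<forall>y\<in>T. y \<in> E \<longrightarrow> \<bar>Im (r y)\<bar> < \<bar>Im (r z0)\<bar>"
        unfolding eventually_nhds r_def by blast
      then show ?thesis by (intro exI[of _ T]) (auto simp: S_def)
    qed
  qed
  ultimately have "S = {} \<or> S = UNIV" using clopen by (auto simp: closed_def)
  then have "z \<in> S" using z0 by (auto simp: S_def)
  then show "z \<in> E" "Im (G 0 z (w z)) \<noteq> 0" using ne by (auto simp: S_def r_def)
qed

end

subsection \<open>The real Riemann invariants\<close>

lemma cubic_four_roots:
  fixes c0 c1 c2 c3 :: complex
  assumes "\<And>x. x \<in> X \<Longrightarrow> c0 + c1 * x + c2 * x\<^sup>2 + c3 * x ^ 3 = 0" "card X = 4"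
  shows "c0 = 0"
proof -
  define p where "p = [:c0, c1, c2, c3:]"
  have "p = 0"
  proof (rule ccontr)
    assume "p \<noteq> 0"
    have "X \<subseteq> {x. poly p x = 0}"
    proof
      fix x assume "x \<in> X"
      from assms(1)[OF this] show "x \<in> {x. poly p x = 0}"
        by (simp add: p_def algebra_simps power2_eq_square power3_eq_cube)
    qed
    then have "card X \<le> card {x. poly p x = 0}"
      by (rule card_mono[OF poly_roots_finite[OF \<open>p \<noteq> 0\<close>]])
    also have "\<dots> \<le> degree p" using \<open>p \<noteq> 0\<close> by (rule card_poly_roots_bound)
    also have "\<dots> \<le> 3" by (simp add: p_def)
    finally show False using assms(2) by simp
  qed
  then show ?thesis by (simp add: p_def)
qed

context conformal_quartic
begin

definition al :: "complex \<Rightarrow> complex" where "al z = - 2 * A / cnj (w z)"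
definition be :: "complex \<Rightarrow> real" where "be z = Im (w z * (- 2 * A / cnj (w z))) / (1 + (cmod (w z))\<^sup>2)"
definition xi :: "complex \<Rightarrow> real" where "xi z = sqrt ((cmod (al z))\<^sup>2 - (be z)\<^sup>2)"
text \<open>For \<sigma> = 1 and \<sigma> = - 1, the two solutions of (al \<zeta> + \<i> be)^2 =
  xi^2, that is, the roots of the quadratic factor in \<open>crit_factor\<close>.\<close>

definition circ :: "real \<Rightarrow> complex \<Rightarrow> complex" where
  "circ \<sigma> z = (of_real (\<sigma> * xi z) - \<i> * of_real (be z)) / al z"

lemmas al_be = w_factor[folded al_def be_def]

lemma xi_pos:
  assumes "z \<in> E" shows "xi z > 0"
proof -
  have "\<bar>be z\<bar> < cmod (al z)" using al_be(2,3)[OF assms assms] by (smt (verit) zero_less_norm_iff)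
  then have "(be z)\<^sup>2 < (cmod (al z))\<^sup>2" using abs_le_square_iff[of "cmod (al z)" "be z"] by (simp add: not_le)
  then show ?thesis by (simp add: xi_def)
qed

lemma xi_square: "z \<in> E \<Longrightarrow> (xi z)\<^sup>2 + (be z)\<^sup>2 = (cmod (al z))\<^sup>2"
  using xi_pos[of z] unfolding xi_def by simp

lemma al_circ: "z \<in> E \<Longrightarrow> al z * circ \<sigma> z = of_real (\<sigma> * xi z) - \<i> * of_real (be z)"
  using al_be(2) by (simp add: circ_def)

lemma circ_quadratic:
  assumes "z \<in> E" "\<sigma>\<^sup>2 = 1"
  shows "al z * (circ \<sigma> z)\<^sup>2 + 2 * \<i> * of_real (be z) * circ \<sigma> z - cnj (al z) = 0"
proof -
  have "of_real ((xi z)\<^sup>2 + (be z)\<^sup>2) = al z * cnj (al z)"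
    unfolding xi_square[OF assms(1)] by (rule complex_norm_square)
  then have 1: "(of_real (xi z))\<^sup>2 + (of_real (be z))\<^sup>2 = al z * cnj (al z)" by simp
  have 2: "(of_real \<sigma>)\<^sup>2 = (1 :: complex)" using assms(2) by (metis of_real_1 of_real_power)
  have "al z * (al z * (circ \<sigma> z)\<^sup>2 + 2 * \<i> * of_real (be z) * circ \<sigma> z - cnj (al z))
      = (al z * circ \<sigma> z)\<^sup>2 + 2 * \<i> * of_real (be z) * (al z * circ \<sigma> z) - al z * cnj (al z)"
    by algebra
  also have "\<dots> = (of_real \<sigma>)\<^sup>2 * (of_real (xi z))\<^sup>2 + (of_real (be z))\<^sup>2 - al z * cnj (al z)"
    unfolding al_circ[OF assms(1)] by (simp add: algebra_simps power2_eq_square)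
  also have "\<dots> = 0" unfolding 2 using 1 by simp
  finally show ?thesis using al_be(2)[OF assms(1,1)] by simp
qed

lemma circ_unit:
  assumes "z \<in> E" "\<sigma>\<^sup>2 = 1"
  shows "cmod (circ \<sigma> z) = 1" "inverse (circ \<sigma> z) = cnj (circ \<sigma> z)"
proof -
  show 1: "cmod (circ \<sigma> z) = 1"
    using circle_quadratic[OF circ_quadratic[OF assms]] al_be(2,3)[OF assms(1,1)] by fastforce
  show "inverse (circ \<sigma> z) = cnj (circ \<sigma> z)"
    using 1 complex_norm_square[of "circ \<sigma> z"] by (intro inverse_unique) simp
qed

lemma circ_root:
  assumes "z \<in> E" "\<sigma>\<^sup>2 = 1"
  shows "crit_poly A (B z) (circ \<sigma> z) = 0" "crit_deriv A (B z) (circ \<sigma> z) \<noteq> 0"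
proof -
  note f = al_be(4-6)[OF assms(1,1)]
  note q = circ_quadratic[OF assms]
  show "crit_poly A (B z) (circ \<sigma> z) = 0"
    unfolding al_be(7)[OF assms(1,1)] q by simp
  have e1: "cnj (B z) = (1 + w z * cnj (w z)) * cnj (al z) + 2 * \<i> * be z * w z"
    unfolding f(2) by (simp add: mult.commute)
  have "crit_deriv A (B z) (circ \<sigma> z) = (circ \<sigma> z - w z) * (1 - cnj (w z) * circ \<sigma> z) * (2 * (al z * circ \<sigma> z) + 2 * \<i> * be z)
     + (1 + w z * cnj (w z) - 2 * cnj (w z) * circ \<sigma> z)
       * (al z * (circ \<sigma> z)\<^sup>2 + 2 * \<i> * of_real (be z) * circ \<sigma> z - cnj (al z))"
    unfolding crit_deriv_def e1 using f by algebra
  also have "\<dots> = (circ \<sigma> z - w z) * (1 - cnj (w z) * circ \<sigma> z) * (2 * \<sigma> * xi z)"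
    unfolding q al_circ[OF assms(1)] by simp
  finally have d: "crit_deriv A (B z) (circ \<sigma> z) = (circ \<sigma> z - w z) * (1 - cnj (w z) * circ \<sigma> z) * (2 * \<sigma> * xi z)" .
  have "circ \<sigma> z \<noteq> w z" using circ_unit(1)[OF assms] w_root(1)[OF assms(1)] by auto
  moreover have "cmod (cnj (w z) * circ \<sigma> z) < 1" using circ_unit(1)[OF assms] w_root(1)[OF assms(1)] by (simp add: norm_mult)
  then have "1 - cnj (w z) * circ \<sigma> z \<noteq> 0" by auto
  moreover have "\<sigma> \<noteq> 0" using assms(2) by auto
  ultimately show "crit_deriv A (B z) (circ \<sigma> z) \<noteq> 0" unfolding d using xi_pos[OF assms(1)] by simp
qed

text \<open>Genuine nonlinearity of the real characteristics.\<close>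

lemma circ_G3:
  assumes z: "z \<in> E" and \<sigma>: "\<sigma>\<^sup>2 = 1" and ne: "Im (A * (w z)\<^sup>2) \<noteq> 0"
  shows "G 3 z (circ \<sigma> z) \<noteq> 0"
proof
  assume "G 3 z (circ \<sigma> z) = 0"
  then have 0: "g 3 z (circ \<sigma> z) = 0" using L_nz[of z] by (simp add: G_def)
  note f = al_be(4-6)[OF z z]
  have e1: "cnj (B z) = (1 + w z * cnj (w z)) * cnj (al z) + 2 * \<i> * be z * w z"
    unfolding f(2) by (simp add: mult.commute)
  have e4: "- w z * cnj (al z) = 2 * cnj A" using arg_cong[OF f(1), of cnj] by simp
  define \<zeta> \<eta> where "\<zeta> = circ \<sigma> z" and "\<eta> = cnj (circ \<sigma> z)"
  have i: "\<eta> * \<zeta> = 1" using circ_unit(1)[OF z \<sigma>] complex_norm_square[of \<zeta>] by (simp add: \<zeta>_def \<eta>_def mult.commute)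
  have q: "al z * \<zeta> + 2 * \<i> * be z - cnj (al z) * \<eta> = 0"
    using circ_quadratic[OF z \<sigma>] i unfolding \<zeta>_def[symmetric] by algebra
  \<comment> \<open>All quantities are turned by \<zeta>: cnj w \<zeta> = m + \<i> n and al \<zeta>
    = x - \<i> be. In these terms \<open>g 3\<close> is purely imaginary and its vanishing is one
    real equation.\<close>
  define m n where "m = Re (cnj (w z) * \<zeta>)" and "n = Im (cnj (w z) * \<zeta>)"
  define x where "x = \<sigma> * xi z"
  have al: "al z * \<zeta> = of_real x - \<i> * be z" using al_circ[OF z] by (simp add: \<zeta>_def x_def)
  have "cnj (al z * \<zeta>) = cnj (of_real x - \<i> * be z)" unfolding al ..
  then have al': "cnj (al z) * \<eta> = of_real x + \<i> * be z" by (simp add: \<zeta>_def \<eta>_def del: complex_cnj_cancel_iff)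
  have v: "cnj (w z) * \<zeta> = of_real m + \<i> * of_real n" by (simp add: m_def n_def complex_eq_iff)
  have "cnj (cnj (w z) * \<zeta>) = cnj (of_real m + \<i> * of_real n)" unfolding v ..
  then have v': "w z * \<eta> = of_real m - \<i> * of_real n" by (simp add: \<zeta>_def \<eta>_def del: complex_cnj_cancel_iff)
  define s where "s = (cmod (w z))\<^sup>2"
  have s: "w z * cnj (w z) = of_real s" by (simp add: s_def complex_norm_square flip: of_real_power)
  have smn: "s = m\<^sup>2 + n\<^sup>2" using circ_unit(1)[OF z \<sigma>] cmod_power2[of "cnj (w z) * \<zeta>"]
    by (simp add: m_def n_def s_def norm_mult \<zeta>_def)
  have iv: "inverse \<zeta> = \<eta>" using circ_unit(2)[OF z \<sigma>] by (simp add: \<zeta>_def \<eta>_def)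
  have "g 3 z \<zeta> = 2 * (w z * \<eta> - cnj (w z) * \<zeta>) * (al z * \<zeta> + cnj (al z) * \<eta>)
      + (1 + w z * cnj (w z) - cnj (w z) * \<zeta> - w z * \<eta>) * (al z * \<zeta> - cnj (al z) * \<eta>)
      - (w z * \<eta> + cnj (w z) * \<zeta>) * (al z * \<zeta> + 2 * \<i> * be z - cnj (al z) * \<eta>)"
    unfolding g_def iv e1 using f e4 i by simp algebra
  also have "\<dots> = - 2 * \<i> * of_real (4 * n * x + be z * (1 + s - 2 * m))"
    unfolding q unfolding al al' v v' s by (simp add: algebra_simps)
  finally have "4 * n * x + be z * (1 + s - 2 * m) = 0" using 0 unfolding \<zeta>_def by (simp del: of_real_add of_real_mult of_real_diff)
  moreover have np: "1 + s \<noteq> 0" unfolding s_def by (smt (verit) zero_le_power2)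
  moreover have b1: "be z * (1 + s) = - x * n - be z * m"
  proof -
    have "be z * (1 + s) = Im (w z * al z)"
      using np unfolding be_def al_def s_def by simp
    also have "w z * al z = (w z * \<eta>) * (al z * \<zeta>)" using i by algebra
    finally show ?thesis unfolding al v' by simp
  qed
  ultimately have nx: "n * x = be z * m" by (simp add: algebra_simps)
  then have "be z * (1 + s + 2 * m) = 0" using b1 by (simp add: algebra_simps)
  \<comment> \<open>This is |1 + cnj w \<zeta>|^2, which is positive because |w| < 1.\<close>
  moreover have "1 + s + 2 * m > 0"
  proof -
    have "s < 1" using w_root(1)[OF z] by (simp add: s_def power_less_one_iff)
    then have "\<not> (m = - 1 \<and> n = 0)" using smn by auto
    then have "(1 + m)\<^sup>2 + n\<^sup>2 > 0" by (metis add.commute add.inverse_inverse eq_neg_iff_add_eq_0 sum_power2_gt_zero_iff)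
    then show ?thesis using smn by (simp add: power2_eq_square algebra_simps)
  qed
  ultimately have b0: "be z = 0" by simp
  then have "Im (w z * al z) = 0"
    using np unfolding be_def al_def s_def by simp
  moreover have "s \<noteq> 0" using w_nz[OF z] by (simp add: s_def)
  \<comment> \<open>w / cnj w is w^2 / |w|^2, so be = 0 would make A w^2 real.\<close>
  then have "w z * al z = of_real (- 2 / s) * (A * (w z)\<^sup>2)"
    using w_nz[OF z] s unfolding al_def by (simp add: field_simps power2_eq_square)
  ultimately have "(- 2 / s) * Im (A * (w z)\<^sup>2) = 0" by (metis Im_complex_of_real Re_complex_of_real add_0 mult_zero_left times_complex.sel(2) mult.commute add.commute)
  then show False using ne w_nz[OF z] by (simp add: s_def)
qed

lemma cont_circ: "continuous_on E (circ \<sigma>)"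
proof -
  have c: "continuous_on E al" unfolding al_def using w_nz by (intro continuous_intros cont_w) auto
  have "1 + (cmod x)\<^sup>2 \<noteq> 0" for x :: complex by (smt (verit) zero_le_power2)
  then have b: "continuous_on E be"
    using w_nz unfolding be_def by (intro continuous_intros cont_w) auto
  show ?thesis unfolding circ_def xi_def
    using al_be(2) by (intro continuous_intros c b) auto
qed

lemma branch_circ: "\<sigma>\<^sup>2 = 1 \<Longrightarrow> branch E (circ \<sigma>)"
  unfolding branch_def using open_E cont_circ circ_root circ_unit(1) by fastforce

lemma periodic_circ: "circ \<sigma> (z + o1) = circ \<sigma> z" "circ \<sigma> (z + o2) = circ \<sigma> z"
  by (simp_all add: circ_def xi_def al_def be_def periodic_w)

lemma cnj_g_unit:
  assumes "inverse \<zeta> = cnj \<zeta>"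
  shows "cnj (g j z \<zeta>) = (- 1) ^ j * g j z \<zeta>"
proof -
  have "((- 1) ^ j) * ((- 1) ^ j) = (1 :: complex)" by (simp flip: power_mult_distrib)
  then show ?thesis unfolding g_def assms by (cases "j = 0") (simp_all add: cnj_C algebra_simps)
qed

text \<open>
  The left-hand side of the Riccati equation vanishes where the periodic function \<open>Y\<close> is
  extremal, hence \<open>Y = 0\<close>.
\<close>

lemma real_value_constant:
  assumes EU: "E = UNIV" and ne: "\<And>z. Im (A * (w z)\<^sup>2) \<noteq> 0" and \<sigma>: "\<sigma>\<^sup>2 = 1"
  shows "Gz 0 z (circ \<sigma> z) = 0"
proof -
  define \<zeta> where "\<zeta> = circ \<sigma>"
  have b: "branch UNIV \<zeta>" using branch_circ[OF \<sigma>] by (simp add: EU \<zeta>_def)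
  have u: "inverse (\<zeta> z) = cnj (\<zeta> z)" for z using circ_unit(2)[OF _ \<sigma>] by (simp add: EU \<zeta>_def)
  define r \<psi> where "r z = G 0 z (\<zeta> z)" and "\<psi> z = Gz 0 z (\<zeta> z)" for z
  define Y where "Y z = \<zeta> z * (\<psi> z)\<^sup>2 * G 2 z (\<zeta> z) / L z" for z
  have r: "wirt r (\<psi> z) (- \<zeta> z * \<psi> z) z" for z
    using branch_value[OF b, of z] by (simp add: r_def[abs_def] \<psi>_def)
  have "cnj (r z) = r z" for z by (simp add: r_def G_def cnj_L cnj_g_unit[OF u])
  \<comment> \<open>Reality of r and its first-order equation turn \<zeta> \<psi>^2 into -
    |\<psi>|^2, which makes Y real.\<close>
  then have "- \<zeta> z * \<psi> z = cnj (\<psi> z)" for z using wirt_real_valued[OF r open_UNIV] by simp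
  then have Y_alt: "Y z = - (\<psi> z * cnj (\<psi> z)) * G 2 z (\<zeta> z) / L z" for z
    unfolding Y_def by (metis mult_minus_left mult.commute mult.left_commute power2_eq_square minus_minus)
  have Y_real: "cnj (Y z) = Y z" for z
    unfolding Y_alt by (simp add: G_def cnj_L cnj_g_unit[OF u] mult.commute)
  have per_r: "r (z + o1) = r z" "r (z + o2) = r z" for z
    by (simp_all add: r_def G_def g_def \<zeta>_def periodic_circ periodic_L periodic_B periodic_C)
  have per_\<psi>: "\<psi> (z + c) = \<psi> z" if "\<And>y. r (y + c) = r y" for z c
  proof -
    have "((\<lambda>y. y + c) has_derivative (\<lambda>h. h)) (at z)" by (auto intro!: derivative_eq_intros)
    from has_derivative_compose[OF this r[unfolded wirt_def]]
    have "wirt r (\<psi> (z + c)) (- \<zeta> (z + c) * \<psi> (z + c)) z" unfolding wirt_def that .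
    from wirt_unique(1)[OF this r] show ?thesis .
  qed
  have per_Y: "Y (z + o1) = Y z" "Y (z + o2) = Y z" for z
    unfolding Y_def per_\<psi>[of o1, OF per_r(1)] per_\<psi>[of o2, OF per_r(2)]
    by (simp_all add: G_def g_def \<zeta>_def periodic_circ periodic_L periodic_B periodic_C)
  have CY: "C1 UNIV Y" using branch_riccati(1)[OF b] unfolding Y_def \<psi>_def by simp
  have "compact (range Y)"
    by (rule periodic_range_compact[of o1 o2]) (use periods in \<open>auto intro: per_Y C1_continuous[OF CY]\<close>)
  \<comment> \<open>The square treats a positive maximum and a negative minimum of Y alike.\<close>
  then have "compact (range (\<lambda>z. (Re (Y z))\<^sup>2))"
    using compact_continuous_image[of "range Y" "\<lambda>y. (Re y)\<^sup>2"] by (simp add: image_image continuous_intros)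
  then obtain z0 where z0: "\<And>z. (Re (Y z))\<^sup>2 \<le> (Re (Y z0))\<^sup>2"
    using compact_attains_sup[of "range (\<lambda>z. (Re (Y z))\<^sup>2)"] by auto
  obtain Yz Yb where Yw: "wirt Y Yz Yb z0" using CY unfolding C1_def by blast
  have Yb: "Yb = cnj Yz" using wirt_real_valued[OF Yw open_UNIV] Y_real by simp
  have "Re (Y z0) = 0"
  proof (rule ccontr)
    assume n0: "Re (Y z0) \<noteq> 0"
    have "((\<lambda>z. Re (Y z)) has_derivative (\<lambda>h. Re (Yz * h + Yb * cnj h))) (at z0)"
      using Yw by (rule has_derivative_Re_wirt)
    from has_derivative_power[OF this, of 2]
    have "((\<lambda>z. (Re (Y z))\<^sup>2) has_derivative (\<lambda>h. 2 * Re (Yz * h + Yb * cnj h) * Re (Y z0))) (at z0)"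
      by (rule has_derivative_eq_rhs) (simp add: fun_eq_iff)
    from differential_zero_maxmin[OF _ open_UNIV this] z0
    have "(\<lambda>h. 2 * Re (Yz * h + Yb * cnj h) * Re (Y z0)) = (\<lambda>h. 0)" by blast
    from fun_cong[OF this, of "cnj Yz"] have "Re (Yz * cnj Yz + cnj (Yz * cnj Yz)) = 0"
      using n0 by (simp add: Yb)
    then have "2 * (Re Yz * Re Yz) + 2 * (Im Yz * Im Yz) = 0" by simp
    then have "(Re Yz)\<^sup>2 + (Im Yz)\<^sup>2 = 0" unfolding power2_eq_square by linarith
    then have "Yz = 0" unfolding sum_power2_eq_zero_iff by (simp add: complex_eq_iff)
    then have "Yz = 0" "Yb = 0" using Yb by auto
    then have "(\<zeta> z0)\<^sup>2 * \<psi> z0 ^ 3 * G 3 z0 (\<zeta> z0) = 0"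
      using branch_riccati(2)[OF b, of z0 Yz Yb] Yw unfolding Y_def \<psi>_def by simp
    moreover have "\<zeta> z0 \<noteq> 0" using b by (simp add: branch_def)
    moreover have "G 3 z0 (\<zeta> z0) \<noteq> 0" using circ_G3[OF _ \<sigma> ne] by (simp add: EU \<zeta>_def)
    ultimately have "\<psi> z0 = 0" by simp
    then show False using n0 by (simp add: Y_def)
  qed
  then have "Re (Y z) = 0" using z0[of z] by simp
  then have "Y z = 0" using Y_real[of z] by (simp add: complex_eq_iff)
  moreover have "\<zeta> z \<noteq> 0" "crit_poly A (B z) (\<zeta> z) = 0" "crit_deriv A (B z) (\<zeta> z) \<noteq> 0"
    using b by (auto simp: branch_def)
  then have "G 2 z (\<zeta> z) \<noteq> 0" using g2_crit[of "\<zeta> z" z] L_nz[of z] by (auto simp: G_def)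
  ultimately have "\<psi> z = 0" using \<open>\<zeta> z \<noteq> 0\<close> L_nz[of z] by (simp add: Y_def)
  then show ?thesis by (simp add: \<psi>_def \<zeta>_def)
qed

text \<open>The z-derivative of the integral vanishes at all four critical points. Multiplied by
  \<zeta>^2 and reduced by the critical quartic, it is a cubic in \<zeta> with four zeros, and its
  constant term is 4 Lz cnj A.\<close>

lemma L_constant:
  assumes z0: "z0 \<in> E" and ne: "Im (G 0 z0 (w z0)) \<noteq> 0"
  shows "Lz z = 0"
proof -
  have EU: "E = UNIV" using elliptic_everywhere(1)[OF assms] by auto
  have ne': "Im (G 0 z (w z)) \<noteq> 0" for z using elliptic_everywhere(2)[OF assms] .
  then have nA: "Im (A * (w z)\<^sup>2) \<noteq> 0" for z using Im_value_zero_iff[of z] EU by auto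
  have z: "z \<in> E" using EU by simp
  define X where "X = {w z, inverse (cnj (w z)), circ 1 z, circ (- 1) z}"
  have w1: "cmod (w z) < 1" "w z \<noteq> 0" using w_root(1)[OF z] w_nz[OF z] by auto
  have w2: "cmod (inverse (cnj (w z))) > 1" using w1 by (simp add: norm_inverse one_less_inverse)
  have c: "cmod (circ 1 z) = 1" "cmod (circ (- 1) z) = 1" using circ_unit(1)[OF z] by auto
  have "al z * circ 1 z \<noteq> al z * circ (- 1) z" unfolding al_circ[OF z] using xi_pos[OF z]
    by (simp add: complex_eq_iff)
  then have "circ 1 z \<noteq> circ (- 1) z" by auto
  moreover have "w z \<noteq> inverse (cnj (w z))" "w z \<noteq> circ 1 z" "w z \<noteq> circ (- 1) z"
    "inverse (cnj (w z)) \<noteq> circ 1 z" "inverse (cnj (w z)) \<noteq> circ (- 1) z"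
    using w1 w2 c by auto
  ultimately have cX: "card X = 4" unfolding X_def by simp
  have \<psi>w: "Gz 0 z (w z) = 0" using value_locally_constant[OF z ne'] .
  then have "Gb 0 z (w z) = 0"
    using transport(1)[OF w1(2), of z] branch_g1[OF branch_w z] by simp
  \<comment> \<open>The integral is real on the circle, so reflection in the circle exchanges its
    two derivatives up to conjugation.\<close>
  moreover have "Gz 0 z (inverse (cnj (w z))) = cnj (Gb 0 z (w z))"
    unfolding Gz_def Gb_def g_def by (simp add: cnj_L cnj_C algebra_simps)
  ultimately have G0: "Gz 0 z \<zeta> = 0" if "\<zeta> \<in> X" for \<zeta>
    using that \<psi>w real_value_constant[OF EU nA, of 1 z] real_value_constant[OF EU nA, of "- 1" z]
    unfolding X_def by auto
  have "crit_poly A (B z) (inverse (cnj (w z))) = - (inverse (cnj (w z)) ^ 4 * cnj (crit_poly A (B z) (w z)))"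
    using w1(2) by (simp add: crit_poly_def field_simps power3_eq_cube power4_eq_xxxx)
  then have p0: "crit_poly A (B z) \<zeta> = 0" if "\<zeta> \<in> X" for \<zeta>
    using that w_root(2)[OF z] circ_root(1)[OF z, of 1] circ_root(1)[OF z, of "- 1"] unfolding X_def by auto
  have X0: "\<zeta> \<noteq> 0" if "\<zeta> \<in> X" for \<zeta> using that w1 c unfolding X_def by auto
  have "4 * Lz z * cnj A = 0"
  proof (rule cubic_four_roots[OF _ cX])
    fix \<zeta> assume \<zeta>: "\<zeta> \<in> X"
    define \<eta> where "\<eta> = inverse \<zeta>"
    have i: "\<eta> * \<zeta> = 1" using X0[OF \<zeta>] by (simp add: \<eta>_def)
    have "L z * (L z * (Bz z * \<zeta> + Cz z + cnj (Bb z) * \<eta>) + 2 * Lz z * (A * \<zeta>\<^sup>2 + B z * \<zeta> + C z + cnj (B z) * \<eta> + cnj A * \<eta>\<^sup>2)) = 0"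
      using G0[OF \<zeta>] unfolding Gz_def g_def \<eta>_def[symmetric] by (simp add: algebra_simps power2_eq_square)
    then have 1: "L z * (Bz z * \<zeta> + Cz z + cnj (Bb z) * \<eta>) + 2 * Lz z * (A * \<zeta>\<^sup>2 + B z * \<zeta> + C z + cnj (B z) * \<eta> + cnj A * \<eta>\<^sup>2) = 0"
      using L_nz[of z] by simp
    have 2: "2 * A * \<zeta> ^ 4 + B z * \<zeta> ^ 3 - cnj (B z) * \<zeta> - 2 * cnj A = 0"
      using p0[OF \<zeta>] by (simp add: crit_poly_def)
    show "4 * Lz z * cnj A + (3 * Lz z * cnj (B z) + L z * cnj (Bb z)) * \<zeta>
        + (2 * Lz z * C z + L z * Cz z) * \<zeta>\<^sup>2 + (Lz z * B z + L z * Bz z) * \<zeta> ^ 3 = 0"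
      using 1 2 i by algebra
  qed
  then show ?thesis using A_nz by simp
qed

end

subsection \<open>Separation of variables\<close>

definition frame :: "complex \<Rightarrow> real \<Rightarrow> real \<Rightarrow> complex" where
  "frame d u v = of_real u * (\<i> * d) + of_real v * d"

text \<open>A sum of a function of u and a function of v, expressed by vanishing mixed differences
  and thus without choosing the summands. Here v runs over all reals, because whole lines in the
  direction d will be available; only u is confined to J.\<close>

definition separates :: "(complex \<Rightarrow> complex) \<Rightarrow> complex \<Rightarrow> real set \<Rightarrow> bool" where
  "separates L d J \<longleftrightarrow> (\<forall>u\<in>J. \<forall>u'\<in>J. \<forall>v v'.
     L (frame d u v) + L (frame d u' v') = L (frame d u v') + L (frame d u' v))"

lemma frame_coords:
  assumes "cmod d = 1"
  shows "frame d (Im (z * cnj d)) (Re (z * cnj d)) = z" "Im (frame d u v * cnj d) = u"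
proof -
  have d: "d * cnj d = 1" using assms complex_norm_square[of d] by simp
  have "frame d (Im (z * cnj d)) (Re (z * cnj d)) = (of_real (Re (z * cnj d)) + \<i> * of_real (Im (z * cnj d))) * d"
    by (simp add: frame_def algebra_simps)
  also have "\<dots> = z * (d * cnj d)" unfolding complex_eq[of "z * cnj d", symmetric] by (simp add: mult.commute mult.left_commute)
  finally show "frame d (Im (z * cnj d)) (Re (z * cnj d)) = z" unfolding d by simp
  have "frame d u v * cnj d = (of_real v + \<i> * of_real u) * (d * cnj d)"
    by (simp add: frame_def algebra_simps)
  then show "Im (frame d u v * cnj d) = u" unfolding d by simp
qed

lemma frame_shift: "frame d u v + of_real t * d = frame d u (v + t)" "frame d u v + of_real t * (\<i> * d) = frame d (u + t) v"
  by (simp_all add: frame_def algebra_simps)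

lemma segment_constant:
  fixes f :: "complex \<Rightarrow> real"
  assumes J: "convex J" "s \<in> J" "t \<in> J"
    and f: "\<And>x. x \<in> J \<Longrightarrow> \<exists>D. (f has_derivative D) (at (z + of_real x * k)) \<and> D k = 0"
  shows "f (z + of_real s * k) = f (z + of_real t * k)"
proof -
  have "((\<lambda>x. f (z + of_real x * k)) has_derivative (\<lambda>h. 0)) (at x within J)" if x: "x \<in> J" for x
  proof -
    obtain D where D: "(f has_derivative D) (at (z + of_real x * k))" "D k = 0" using f[OF x] by blast
    have "((\<lambda>x. z + of_real x * k) has_derivative (\<lambda>h. h *\<^sub>R k)) (at x within J)"
      by (auto intro!: derivative_eq_intros simp: scaleR_conv_of_real)
    from has_derivative_compose[OF this D(1)] show ?thesis
      by (rule has_derivative_eq_rhs) (simp add: fun_eq_iff linear_cmul[OF has_derivative_linear[OF D(1)]] D(2))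
  qed
  from has_derivative_zero_constant[OF J(1) this]
  show ?thesis using J(2,3) by metis
qed

text \<open>\<open>f1\<close> depends on u alone and \<open>f2\<close> on v alone. Along d one moves
  on complete lines, along \<i> d only within the interval J.\<close>

lemma separates_if_potentials:
  fixes f1 f2 :: "complex \<Rightarrow> real"
  assumes d: "cmod d = 1" and J: "convex J"
    and strip: "\<And>u v. u \<in> J \<Longrightarrow> frame d u v \<in> S"
    and f1: "\<And>z. z \<in> S \<Longrightarrow> \<exists>D. (f1 has_derivative D) (at z) \<and> D d = 0"
    and f2: "\<And>z. z \<in> S \<Longrightarrow> \<exists>D. (f2 has_derivative D) (at z) \<and> D (\<i> * d) = 0"
    and L: "\<And>z. z \<in> S \<Longrightarrow> L z = of_real (f1 z + f2 z)"
  shows "separates L d J"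
proof -
  have 1: "f1 (frame d u v) = f1 (frame d u 0)" if "u \<in> J" for u v
    using segment_constant[of UNIV v 0 f1 "frame d u 0" d] f1 strip[OF that] by (simp add: frame_shift)
  have 2: "f2 (frame d u v) = f2 (frame d u' v)" if "u \<in> J" "u' \<in> J" for u u' v
    using segment_constant[of J u u' f2 "frame d 0 v" "\<i> * d"] J f2 strip that by (simp add: frame_shift)
  show ?thesis unfolding separates_def
  proof (intro ballI allI)
    fix u u' v v' assume u: "u \<in> J" "u' \<in> J"
    show "L (frame d u v) + L (frame d u' v') = L (frame d u v') + L (frame d u' v)"
      unfolding L[OF strip[OF u(1)]] L[OF strip[OF u(2)]]
      using 1[OF u(1), of v] 1[OF u(1), of v'] 1[OF u(2), of v] 1[OF u(2), of v'] 2[OF u, of v] 2[OF u, of v']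
      by simp
  qed
qed

context conformal_quartic
begin

context
  assumes real_value: "\<And>z. z \<in> E \<Longrightarrow> Im (G 0 z (w z)) = 0"
begin

text \<open>Reality gives - w r_z = cnj r_z; comparing moduli, |w| < 1 leaves only r_z = 0.\<close>

lemma value_stationary:
  assumes z: "z \<in> E"
  shows "Gz 0 z (w z) = 0"
proof -
  have "cnj (G 0 y (w y)) = G 0 y (w y)" if "y \<in> E" for y
    using real_value[OF that] by (simp add: complex_eq_iff)
  then have "- w z * Gz 0 z (w z) = cnj (Gz 0 z (w z))"
    using wirt_real_valued[OF branch_value[OF branch_w z] open_E z] by simp
  then have "cmod (w z) * cmod (Gz 0 z (w z)) = cmod (Gz 0 z (w z))"
    by (metis complex_mod_cnj norm_minus_cancel norm_mult)
  then show ?thesis using w_root(1)[OF z] by simp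
qed

text \<open>A real A w^2 determines the fourth power of sgn w, which leaves finitely many values for
  a continuous function on a connected set.\<close>

lemma sgn_w_constant:
  assumes T: "connected T" "T \<subseteq> E" and z: "z \<in> T" "z' \<in> T"
  shows "sgn (w z) = sgn (w z')"
proof -
  have fourth: "(sgn (w y)) ^ 4 = of_real ((cmod A)\<^sup>2) / A\<^sup>2" if "y \<in> E" for y
  proof -
    have "Im (A * (w y)\<^sup>2) = 0" using real_value[OF that] Im_value_zero_iff[OF that] by simp
    moreover have "cnj x = x" if "Im x = 0" for x using that by (simp add: complex_eq_iff)
    ultimately have c: "cnj (A * (w y)\<^sup>2) = A * (w y)\<^sup>2" by blast
    have "(A * (w y)\<^sup>2)\<^sup>2 = (A * (w y)\<^sup>2) * cnj (A * (w y)\<^sup>2)" unfolding c by (simp add: power2_eq_square)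
    also have "\<dots> = of_real ((cmod (A * (w y)\<^sup>2))\<^sup>2)" by (rule complex_norm_square[symmetric])
    also have "\<dots> = of_real ((cmod A)\<^sup>2) * of_real (cmod (w y)) ^ 4"
      by (simp add: norm_mult norm_power power_mult_distrib flip: power_mult)
    finally have "A\<^sup>2 * w y ^ 4 = of_real ((cmod A)\<^sup>2) * of_real (cmod (w y)) ^ 4"
      by (simp add: power_mult_distrib flip: power_mult)
    then show ?thesis using A_nz w_nz[OF that] by (simp add: sgn_eq field_simps)
  qed
  define p where "p = [:- (of_real ((cmod A)\<^sup>2) / A\<^sup>2), 0, 0, 0, 1:]"
  have "p \<noteq> 0" by (simp add: p_def)
  then have "finite {x. poly p x = 0}" by (rule poly_roots_finite)
  then have fin: "finite ((\<lambda>z. sgn (w z)) ` T)"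
    by (rule finite_subset[rotated]) (use T fourth in \<open>auto simp: p_def power4_eq_xxxx mult.assoc\<close>)
  have "continuous_on T (\<lambda>z. sgn (w z))"
    using continuous_on_subset[OF cont_w T(2)] w_nz T by (intro continuous_on_sgn) auto
  from continuous_finite_range_constant[OF T(1) this fin] z show ?thesis
    unfolding constant_on_def by metis
qed

text \<open>With R = |w|, the first-order equation of the branch reads dL / L = (1 + R) dR / (R (1 -
  R)) along d and dL / L = (1 - R) dR / (R (1 + R)) along \<i> d. Integrating the two by separation
  of variables gives \<open>F1\<close> and \<open>F2\<close>.\<close>

definition F1 :: "complex \<Rightarrow> real" where "F1 z = Re (L z) * (1 - cmod (w z))\<^sup>2 / cmod (w z)"
definition F2 :: "complex \<Rightarrow> real" where "F2 z = Re (L z) * (1 + cmod (w z))\<^sup>2 / cmod (w z)"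

lemma F1_pos: "z \<in> E \<Longrightarrow> F1 z > 0"
  using w_root(1)[of z] w_nz[of z] pos_L[of z] by (auto simp: F1_def)

lemma F1_boundary:
  assumes z0: "z0 \<notin> E" and c: "c > 0"
  shows "\<forall>\<^sub>F z in nhds z0. z \<in> E \<longrightarrow> F1 z < c"
proof -
  define M where "M = Re (L z0) + 1"
  have M: "M > 0" using pos_L[of z0] by (simp add: M_def)
  \<comment> \<open>k \<ge> 1/2 bounds 1 / |w| by 2, and 1 - k \<le> c / (4 M) then makes F1 at most
    c / 2.\<close>
  define k where "k = max (1/2) (1 - c / (4 * M))"
  have k: "k < 1" "k \<ge> 1/2" "1 - k \<le> c / (4 * M)" using M c by (auto simp: k_def)
  have "isCont (\<lambda>z. Re (L z)) z0" using wirt_continuous[OF wirt_L] by (rule isCont_Re)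
  then have "((\<lambda>z. Re (L z)) \<longlongrightarrow> Re (L z0)) (nhds z0)"
    unfolding isCont_def by (rule tendsto_at_iff_tendsto_nhds[THEN iffD1])
  then have "\<forall>\<^sub>F z in nhds z0. Re (L z) < M" by (rule order_tendstoD) (simp add: M_def)
  with w_modulus_boundary[OF z0 k(1)] show ?thesis
  proof eventually_elim
    case (elim z)
    show ?case
    proof
      assume z: "z \<in> E"
      define \<rho> where "\<rho> = cmod (w z)"
      have \<rho>: "k < \<rho>" "\<rho> < 1" using elim z w_root(1)[OF z] by (auto simp: \<rho>_def)
      have "(1 - \<rho>)\<^sup>2 \<le> (1 - \<rho>) * 1" unfolding power2_eq_square using \<rho> k by (intro mult_left_mono) auto
      also have "\<dots> \<le> (1 - k) * (2 * \<rho>)" using \<rho> k by (intro mult_mono) auto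
      finally have "(1 - \<rho>)\<^sup>2 / \<rho> \<le> 2 * (1 - k)" using \<rho> k by (subst pos_divide_le_eq) (simp_all add: mult_ac)
      then have "F1 z \<le> M * (2 * (1 - k))"
        using elim pos_L[of z] M \<rho> k unfolding F1_def \<rho>_def[symmetric] times_divide_eq_right[symmetric]
        by (intro mult_mono) auto
      also have "\<dots> \<le> M * (2 * (c / (4 * M)))" using M k by (intro mult_left_mono) auto
      also have "\<dots> < c" using M c by simp
      finally show "F1 z < c" .
    qed
  qed
qed

text \<open>
  A real critical value is stationary by its Beltrami equation, and its reality fixes the argument
  of \<open>w\<close>. The first-order equation of the branch \<open>w\<close> then splits into one real equation along \<open>d\<close>
  and one along \<open>\<i> d\<close>.
\<close>

lemma F_derivatives:
  assumes z: "z \<in> E" and d: "d\<^sup>2 = sgn (w z)"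
  shows "\<exists>D. (F1 has_derivative D) (at z) \<and> D d = 0" "\<exists>D. (F2 has_derivative D) (at z) \<and> D (\<i> * d) = 0"
proof -
  obtain e where e: "e > 0" "ball z e \<subseteq> E" using open_E z openE by blast
  let ?S = "ball z e"
  define \<omega> where "\<omega> = sgn (w z)"
  have \<omega>1: "cmod \<omega> = 1" using w_nz[OF z] by (simp add: \<omega>_def norm_sgn)
  then have \<omega>: "\<omega> * cnj \<omega> = 1" using complex_norm_square[of \<omega>] by simp
  have "cmod d ^ 2 = 1" using d \<omega>1 by (metis \<omega>_def norm_power)
  then have dd: "d * cnj d = 1" using complex_norm_square[of d] by (metis of_real_1)
  \<comment> \<open>Since sgn w is locally constant, this is |w| near z; being linear in w, it can
    be differentiated directly, and being real, it has conjugate derivatives.\<close>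
  define \<rho> where "\<rho> y = w y * cnj \<omega>" for y
  have \<rho>: "\<rho> y = of_real (cmod (w y))" if "y \<in> ?S" for y
  proof -
    have "sgn (w y) = \<omega>" unfolding \<omega>_def
      by (rule sgn_w_constant[of ?S]) (use e that in auto)
    moreover have "w y = of_real (cmod (w y)) * sgn (w y)" using w_nz[of y] e that by (auto simp: sgn_eq)
    ultimately have "w y = of_real (cmod (w y)) * \<omega>" by simp
    then have "w y * cnj \<omega> = of_real (cmod (w y)) * (\<omega> * cnj \<omega>)" by (metis mult.assoc)
    then show ?thesis unfolding \<rho>_def \<omega> by simp
  qed
  obtain a c where ac: "wirt w a c z" using branch_wirt[OF branch_w z] by blast
  have \<rho>w: "wirt \<rho> (a * cnj \<omega>) (c * cnj \<omega>) z"
    unfolding \<rho>_def by (rule wirt_cong[OF wirt_mult[OF ac wirt_const]]) auto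
  have "c * cnj \<omega> = cnj (a * cnj \<omega>)"
    by (rule wirt_real_valued[OF \<rho>w open_ball, of z]) (use e \<rho> in auto)
  define p where "p = a * cnj \<omega>"
  have p: "wirt \<rho> p (cnj p) z" using \<rho>w \<open>c * cnj \<omega> = cnj (a * cnj \<omega>)\<close> by (simp add: p_def)
  have ac': "a = p * \<omega>" "c = cnj p * \<omega>" "w z = \<rho> z * \<omega>"
    using \<omega> \<open>c * cnj \<omega> = cnj (a * cnj \<omega>)\<close> unfolding p_def \<rho>_def by algebra+
  define R where "R = cmod (w z)"
  have R: "0 < R" "R < 1" using w_root(1)[OF z] w_nz[OF z] by (auto simp: R_def)
  have \<rho>z: "\<rho> z = of_real R" using \<rho>[of z] e by (simp add: R_def)
  have \<rho>0: "\<rho> z \<noteq> 0" using R by (simp add: \<rho>z)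
  define l where "l = Re (L z)"
  have l: "L z = of_real l" using cnj_L[of z] by (simp add: l_def complex_eq_iff)
  have l0: "l > 0" using pos_L[of z] by (simp add: l_def)
  note fo = branch_first_order[OF branch_w z ac]
  have "G 2 z (w z) * (L z * (a + c * inverse (w z)) - (cnj (Lz z) - w z * Lz z)) = 0"
    using fo(4) value_stationary[OF z] by (simp add: algebra_simps)
  then have "L z * (a + c * inverse (w z)) = cnj (Lz z) - w z * Lz z" using fo(3) by simp
  then have "L z * (a * w z + c) = w z * (cnj (Lz z) - w z * Lz z)" using w_nz[OF z] by (simp add: field_simps)
  then have "\<omega> * (L z * (p * \<omega> * \<rho> z + cnj p)) = \<omega> * (\<rho> z * (cnj (Lz z) - \<rho> z * \<omega> * Lz z))"
    unfolding ac' by (simp add: algebra_simps)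
  then have "L z * (p * \<omega> * \<rho> z + cnj p) = \<rho> z * (cnj (Lz z) - \<rho> z * \<omega> * Lz z)" using \<omega>1 by auto
  then have "cnj d * (L z * (p * d\<^sup>2 * \<rho> z + cnj p)) = cnj d * (\<rho> z * (cnj (Lz z) - \<rho> z * d\<^sup>2 * Lz z))"
    unfolding d \<omega>_def by simp
  then have eq: "L z * (d * p * \<rho> z + cnj (d * p)) = \<rho> z * (cnj (d * Lz z) - \<rho> z * (d * Lz z))"
    using dd by simp algebra
  \<comment> \<open>2 Re x and - 2 Im x are the derivatives of \<rho> along d and \<i> d, and y
    plays the same part for L. So the real part of the equation concerns d and the imaginary part
    \<i> d.\<close>
  define x y where "x = d * p" and "y = d * Lz z"
  have eqR: "l * (Re x * (1 + R)) = R * (Re y * (1 - R))" and eqI: "l * (Im x * (1 - R)) = R * (Im y * (1 + R))"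
    using arg_cong[OF eq, of Re] arg_cong[OF eq, of Im] unfolding x_def[symmetric] y_def[symmetric] l \<rho>z
    by (simp_all add: algebra_simps)
  have FF: "(\<lambda>y. Re (L y * (1 - \<rho> y)\<^sup>2 / \<rho> y)) v = F1 v" "(\<lambda>y. Re (L y * (1 + \<rho> y)\<^sup>2 / \<rho> y)) v = F2 v" if "v \<in> ?S" for v
  proof -
    have Lv: "L v = of_real (Re (L v))" using cnj_L[of v] by (simp add: complex_eq_iff)
    have "L v * (1 - \<rho> v)\<^sup>2 / \<rho> v = of_real (F1 v)" "L v * (1 + \<rho> v)\<^sup>2 / \<rho> v = of_real (F2 v)"
      unfolding F1_def F2_def \<rho>[OF that] by (subst Lv, simp)+
    then show "(\<lambda>y. Re (L y * (1 - \<rho> y)\<^sup>2 / \<rho> y)) v = F1 v" "(\<lambda>y. Re (L y * (1 + \<rho> y)\<^sup>2 / \<rho> y)) v = F2 v" by simp_all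
  qed
  define a1 where "a1 = (Lz z * (1 - R)\<^sup>2 * R - l * (2 * (1 - R) * R + (1 - R)\<^sup>2) * p) / R\<^sup>2"
  define a2 where "a2 = (Lz z * (1 + R)\<^sup>2 * R + l * (2 * (1 + R) * R - (1 + R)\<^sup>2) * p) / R\<^sup>2"
  have w1: "wirt (\<lambda>y. L y * (1 - \<rho> y)\<^sup>2 / \<rho> y) a1 (cnj a1) z"
    by (rule wirt_cong[OF wirt_divide[OF wirt_mult[OF wirt_L wirt_power[OF wirt_diff[OF wirt_const p]]] p \<rho>0]])
       (use R in \<open>simp_all add: a1_def \<rho>z l field_simps\<close>)
  have w2: "wirt (\<lambda>y. L y * (1 + \<rho> y)\<^sup>2 / \<rho> y) a2 (cnj a2) z"
    by (rule wirt_cong[OF wirt_divide[OF wirt_mult[OF wirt_L wirt_power[OF wirt_add[OF wirt_const p]]] p \<rho>0]])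
       (use R in \<open>simp_all add: a2_def \<rho>z l field_simps\<close>)
  have 1: "(F1 has_derivative (\<lambda>h. Re (a1 * h + cnj a1 * cnj h))) (at z)"
    by (rule has_derivative_transform_within_open[OF has_derivative_Re_wirt[OF w1] open_ball[of z e]])
       (use e FF(1) in auto)
  have 2: "(F2 has_derivative (\<lambda>h. Re (a2 * h + cnj a2 * cnj h))) (at z)"
    by (rule has_derivative_transform_within_open[OF has_derivative_Re_wirt[OF w2] open_ball[of z e]])
       (use e FF(2) in auto)
  have "of_real (R\<^sup>2) * (a1 * d) = of_real ((1 - R)) * (of_real (R * (1 - R)) * y - of_real (l * (1 + R)) * x)"
    using R unfolding a1_def x_def y_def by (simp add: field_simps power2_eq_square)
  from arg_cong[OF this, of Re] have "R\<^sup>2 * Re (a1 * d) = (1 - R) * (R * (1 - R) * Re y - l * (1 + R) * Re x)" by simp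
  also have "\<dots> = 0" using eqR by (simp add: algebra_simps)
  finally have "Re (a1 * d) = 0" using R by simp
  then have "Re (a1 * d + cnj a1 * cnj d) = 0" by simp
  with 1 show "\<exists>D. (F1 has_derivative D) (at z) \<and> D d = 0" by blast
  have "of_real (R\<^sup>2) * (a2 * d) = of_real ((1 + R)) * (of_real (R * (1 + R)) * y - of_real (l * (1 - R)) * x)"
    using R unfolding a2_def x_def y_def by (simp add: field_simps power2_eq_square)
  from arg_cong[OF this, of Im] have "R\<^sup>2 * Im (a2 * d) = (1 + R) * (R * (1 + R) * Im y - l * (1 - R) * Im x)" by simp
  also have "\<dots> = 0" using eqI by (simp add: algebra_simps)
  finally have "Im (a2 * d) = 0" using R by simp
  then have "Re (a2 * (\<i> * d) + cnj a2 * cnj (\<i> * d)) = 0" by (simp add: algebra_simps)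
  with 2 show "\<exists>D. (F2 has_derivative D) (at z) \<and> D (\<i> * d) = 0" by blast
qed

lemma cont_F1: "continuous_on E F1"
  unfolding F1_def using w_nz wirt_continuous[OF wirt_L]
  by (intro continuous_intros cont_w continuous_at_imp_continuous_on) auto

text \<open>A line in direction \<open>d\<close> cannot leave \<open>E\<close>, because \<open>F1\<close> is constant along it and tends to zero at the boundary.\<close>

lemma line_in_E:
  assumes z0: "z0 \<in> E" and d: "d\<^sup>2 = sgn (w z0)"
  shows "z0 + of_real t * d \<in> E \<and> sgn (w (z0 + of_real t * d)) = sgn (w z0)"
proof -
  define q where "q t = z0 + of_real t * d" for t :: real
  define T where "T = {t. q t \<in> E \<and> sgn (w (q t)) = sgn (w z0) \<and> F1 (q t) = F1 z0}"
  have cq: "continuous_on UNIV q" unfolding q_def by (intro continuous_intros)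
  have opq: "open (q -` U)" if "open U" for U using open_vimage[OF that cq] .
  have "open T"
  proof (rule open_subopen[THEN iffD2], rule ballI)
    fix t assume t: "t \<in> T"
    have "open (q -` E)" "t \<in> q -` E" using t open_E opq by (auto simp: T_def)
    then obtain r where r: "r > 0" "ball t r \<subseteq> q -` E" by (meson openE)
    have "ball t r \<subseteq> T"
    proof
      fix s assume s: "s \<in> ball t r"
      have "connected (q ` ball t r)"
        using continuous_on_subset[OF cq] by (intro connected_continuous_image) auto
      then have sg: "sgn (w (q x)) = sgn (w (q t))" if "x \<in> ball t r" for x
        using r that by (intro sgn_w_constant[of "q ` ball t r"]) auto
      have "F1 (q s) = F1 (q t)" unfolding q_def
      proof (rule segment_constant[of "ball t r"])
        fix x assume x: "x \<in> ball t r"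
        have "d\<^sup>2 = sgn (w (q x))" using sg[OF x] t d by (simp add: T_def)
        then show "\<exists>D. (F1 has_derivative D) (at (z0 + of_real x * d)) \<and> D d = 0"
          using F_derivatives(1)[of "q x" d] r x by (auto simp: q_def)
      qed (use s r in auto)
      then show "s \<in> T" using s sg[OF s] r t by (auto simp: T_def)
    qed
    then show "\<exists>U. open U \<and> t \<in> U \<and> U \<subseteq> T" using r(1) by (intro exI[of _ "ball t r"]) auto
  qed
  moreover have "open (- T)"
  proof (rule open_subopen[THEN iffD2], rule ballI)
    fix t assume t: "t \<in> - T"
    show "\<exists>U. open U \<and> t \<in> U \<and> U \<subseteq> - T"
    proof (cases "q t \<in> E")
      case True
      have "continuous_on E (\<lambda>z. (sgn (w z), F1 z))"
        using w_nz by (intro continuous_on_Pair continuous_on_sgn cont_w cont_F1) auto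
      then have "open (E \<inter> (\<lambda>z. (sgn (w z), F1 z)) -` (- {(sgn (w z0), F1 z0)}))"
        by (rule continuous_open_preimage[OF _ open_E]) (intro open_Compl closed_singleton)
      from opq[OF this] show ?thesis
        using True t by (intro exI[of _ "q -` (E \<inter> (\<lambda>z. (sgn (w z), F1 z)) -` (- {(sgn (w z0), F1 z0)}))"])
          (auto simp: T_def)
    next
      case False
      from F1_boundary[OF False F1_pos[OF z0]] obtain U where
        U: "open U" "q t \<in> U" "\<forall>y\<in>U. y \<in> E \<longrightarrow> F1 y < F1 z0"
        unfolding eventually_nhds by blast
      then show ?thesis using opq[OF U(1)] by (intro exI[of _ "q -` U"]) (auto simp: T_def)
    qed
  qed
  ultimately have "T = {} \<or> T = UNIV" using clopen by (auto simp: closed_def)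
  moreover have "0 \<in> T" using z0 by (simp add: T_def q_def)
  ultimately have "t \<in> T" by auto
  then show ?thesis by (simp add: T_def q_def)
qed

text \<open>Two lines in \<open>E\<close> that are not parallel would meet.\<close>

lemma sgn_w_const:
  assumes z: "z \<in> E" "z' \<in> E"
  shows "sgn (w z) = sgn (w z')"
proof -
  define d d' where "d = csqrt (sgn (w z))" and "d' = csqrt (sgn (w z'))"
  have d: "d\<^sup>2 = sgn (w z)" "d'\<^sup>2 = sgn (w z')" by (simp_all add: d_def d'_def)
  show ?thesis
  \<comment> \<open>The minus sign lets the coordinates of z' - z be read as z + s d = z' + t d', a
    common point of the two lines. If the lines are parallel, d cnj d' is real of modulus 1 and the
    squares agree.\<close>
  proof (cases "Im (d * cnj (- d')) = 0")
    case True
    have n: "cmod d = 1" "cmod d' = 1" using w_nz[OF z(1)] w_nz[OF z(2)] by (simp_all add: d_def d'_def norm_sgn)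
    have "(d * cnj d')\<^sup>2 = (of_real (Re (d * cnj d')))\<^sup>2" using True by (simp add: complex_eq_iff)
    also have "\<dots> = of_real ((cmod (d * cnj d'))\<^sup>2)" using True unfolding cmod_power2 by simp
    finally have "d\<^sup>2 * (cnj d')\<^sup>2 = 1" by (simp add: norm_mult n power_mult_distrib)
    moreover have "d' * cnj d' = 1" using n(2) complex_norm_square[of d'] by simp
    ultimately have "d\<^sup>2 = d'\<^sup>2" by algebra
    then show ?thesis by (simp add: d)
  next
    case False
    then obtain s t :: real where "z' - z = of_real s * d + of_real t * (- d')" using period_coordinates by blast
    then have "z + of_real s * d = z' + of_real t * d'" by (simp add: algebra_simps)
    then show ?thesis using line_in_E[OF z(1) d(1), of s] line_in_E[OF z(2) d(2), of t] by metis
  qed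
qed

text \<open>The potentials are - F1 / 4 and F2 / 4, because (1 + R)^2 - (1 - R)^2 = 4 R. As sgn w is
  constant on E, one direction d serves all connected subsets.\<close>

lemma separates_real_case:
  assumes z0: "z0 \<in> E"
  shows "\<exists>d. cmod d = 1 \<and> (\<forall>C. connected C \<and> C \<subseteq> E \<longrightarrow> separates L d ((\<lambda>z. Im (z * cnj d)) ` C))"
proof -
  define d where "d = csqrt (sgn (w z0))"
  have d: "cmod d = 1" using w_nz[OF z0] by (simp add: d_def norm_sgn)
  have dE: "d\<^sup>2 = sgn (w z)" if "z \<in> E" for z using sgn_w_const[OF z0 that] by (simp add: d_def)
  have "separates L d ((\<lambda>z. Im (z * cnj d)) ` C)" if C: "connected C" "C \<subseteq> E" for C
  proof (rule separates_if_potentials[OF d, where S = E and ?f1.0 = "\<lambda>z. - F1 z / 4" and ?f2.0 = "\<lambda>z. F2 z / 4"])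
    have "connected ((\<lambda>z. Im (z * cnj d)) ` C)"
      by (rule connected_continuous_image[OF _ C(1)]) (intro continuous_intros)
    then show "convex ((\<lambda>z. Im (z * cnj d)) ` C)" by (simp flip: is_interval_connected_1 add: is_interval_convex_1)
    fix u v assume "u \<in> (\<lambda>z. Im (z * cnj d)) ` C"
    then obtain z where z: "z \<in> C" "u = Im (z * cnj d)" by auto
    have "frame d u (Re (z * cnj d)) = z" unfolding z(2) by (rule frame_coords[OF d])
    then have "frame d u v = z + of_real (v - Re (z * cnj d)) * d" by (simp add: frame_def algebra_simps)
    moreover have "z \<in> E" using z C by auto
    ultimately show "frame d u v \<in> E" using line_in_E[OF \<open>z \<in> E\<close> dE[OF \<open>z \<in> E\<close>]] by presburger
  next
    fix z assume z: "z \<in> E"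
    obtain D where D: "(F1 has_derivative D) (at z)" "D d = 0" using F_derivatives(1)[OF z dE[OF z]] by blast
    have "((\<lambda>z. - F1 z / 4) has_derivative (\<lambda>h. - D h / 4)) (at z)" using D(1) by (auto intro!: derivative_eq_intros)
    then show "\<exists>D. ((\<lambda>z. - F1 z / 4) has_derivative D) (at z) \<and> D d = 0"
      by (intro exI[of _ "\<lambda>h. - D h / 4"] conjI) (simp_all add: D(2))
    obtain D where D: "(F2 has_derivative D) (at z)" "D (\<i> * d) = 0" using F_derivatives(2)[OF z dE[OF z]] by blast
    have "((\<lambda>z. F2 z / 4) has_derivative (\<lambda>h. D h / 4)) (at z)" using D(1) by (auto intro!: derivative_eq_intros)
    then show "\<exists>D. ((\<lambda>z. F2 z / 4) has_derivative D) (at z) \<and> D (\<i> * d) = 0"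
      by (intro exI[of _ "\<lambda>h. D h / 4"] conjI) (simp_all add: D(2))
    have "L z = of_real (Re (L z))" using cnj_L[of z] by (simp add: complex_eq_iff)
    moreover have "- F1 z / 4 + F2 z / 4 = Re (L z)"
      using w_nz[OF z] unfolding F1_def F2_def by (simp add: field_simps power2_eq_square)
    ultimately show "L z = of_real (- F1 z / 4 + F2 z / 4)" by simp
  qed
  then show ?thesis using d by blast
qed

end

theorem separates_elliptic:
  assumes "E \<noteq> {}"
  shows "\<exists>d. cmod d = 1 \<and> (\<forall>C. connected C \<and> C \<subseteq> E \<longrightarrow> separates L d ((\<lambda>z. Im (z * cnj d)) ` C))"
proof (cases "\<exists>z\<in>E. Im (G 0 z (w z)) \<noteq> 0")
  case True
  then have "Lz z = 0" for z using L_constant by blast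
  then have "(L has_derivative (\<lambda>h. 0)) (at z within UNIV)" for z using wirt_L[of z] by (simp add: wirt_def)
  from has_derivative_zero_constant[OF convex_UNIV this] obtain c where "\<And>z. L z = c" by auto
  then show ?thesis by (intro exI[of _ 1]) (simp add: separates_def)
next
  case False
  then show ?thesis using separates_real_case assms by blast
qed

end

subsection \<open>The complex coordinate\<close>

definition V :: "complex \<Rightarrow> real^2" where "V z = vector [Re z, Im z]"

definition cplx :: "real^2 \<Rightarrow> complex" where "cplx q = Complex (q$1) (q$2)"

lemma V_nth [simp]: "V z $ 1 = Re z" "V z $ 2 = Im z"
  by (simp_all add: V_def)

lemma V_cplx [simp]: "V (cplx q) = q"
  by (simp add: vec_eq_iff forall_2 cplx_def)

lemma cplx_V [simp]: "cplx (V z) = z"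
  by (simp add: cplx_def)

lemma cplx_add: "cplx (q + r) = cplx q + cplx r"
  by (simp add: cplx_def complex_eq_iff)

lemma V_add: "V (z + w) = V z + V w"
  by (simp add: vec_eq_iff forall_2)

lemma V_axis: "V h = Re h *\<^sub>R axis 1 1 + Im h *\<^sub>R axis 2 1"
  by (simp add: vec_eq_iff forall_2 axis_def)

lemma bounded_linear_V: "bounded_linear V"
  unfolding V_axis[abs_def]
  by (intro bounded_linear_add bounded_linear_scaleR_const bounded_linear_Re bounded_linear_Im
      bounded_linear_scaleR_left[THEN bounded_linear_compose])

lemma continuous_cplx: "continuous_on S cplx"
proof -
  have "cplx = (\<lambda>q. of_real (q$1) + \<i> * of_real (q$2))" by (simp add: fun_eq_iff cplx_def complex_eq_iff)
  moreover have "continuous_on S (\<lambda>q::real^2. of_real (q$1) + \<i> * of_real (q$2) :: complex)"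
    by (intro continuous_intros)
  ultimately show ?thesis by metis
qed

lemma smoothD:
  assumes "smooth f"
  shows "f differentiable (at x)" "smooth (\<lambda>x. frechet_derivative f (at x) v)" "continuous_on UNIV f"
proof -
  have k: "Ck_on k f UNIV" for k using assms by (simp add: smooth_on_def)
  show "f differentiable (at x)" using k[of "Suc 0"] by simp
  show "smooth (\<lambda>x. frechet_derivative f (at x) v)"
    unfolding smooth_on_def using k[of "Suc _"] by simp
  show "continuous_on UNIV f" using k[of 0] by simp
qed

lemma smooth_partial: "smooth f \<Longrightarrow> smooth (partial i f)"
  unfolding partial_def[abs_def] by (rule smoothD)

definition lift :: "(real^2 \<Rightarrow> real) \<Rightarrow> complex \<Rightarrow> complex" where
  "lift f z = of_real (f (V z))"

definition dz :: "(real^2 \<Rightarrow> real) \<Rightarrow> complex \<Rightarrow> complex" where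
  "dz f z = (lift (partial 1 f) z - \<i> * lift (partial 2 f) z) / 2"

lemma frechet_partial:
  assumes "f differentiable (at q)"
  shows "frechet_derivative f (at q) h = h$1 * partial 1 f q + h$2 * partial 2 f q"
proof -
  have lin: "linear (frechet_derivative f (at q))"
    using assms by (rule linear_frechet_derivative)
  have "h = h$1 *\<^sub>R axis 1 1 + h$2 *\<^sub>R axis 2 1"
    by (simp add: vec_eq_iff forall_2 axis_def)
  then have "frechet_derivative f (at q) h = frechet_derivative f (at q) (h$1 *\<^sub>R axis 1 1 + h$2 *\<^sub>R axis 2 1)"
    by simp
  then show ?thesis by (simp add: linear_add[OF lin] linear_cmul[OF lin] partial_def)
qed

lemma wirt_lift:
  assumes "smooth f"
  shows "wirt (lift f) (dz f z) (cnj (dz f z)) z"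
proof -
  have d: "f differentiable (at (V z))" using smoothD[OF assms] by blast
  have "(V has_derivative V) (at z)" by (rule bounded_linear_imp_has_derivative[OF bounded_linear_V])
  from has_derivative_compose[OF this frechet_derivative_works[THEN iffD1, OF d]]
  have "((\<lambda>z. f (V z)) has_derivative (\<lambda>h. frechet_derivative f (at (V z)) (V h))) (at z)" .
  from has_derivative_of_real[OF this, where 'a = complex]
  show ?thesis unfolding wirt_def lift_def[abs_def]
    by (rule has_derivative_eq_rhs)
       (simp add: fun_eq_iff frechet_partial[OF d] dz_def lift_def complex_eq_iff field_simps)
qed

lemma cont_lift: "smooth f \<Longrightarrow> continuous_on UNIV (lift f)"
  by (rule continuous_at_imp_continuous_on) (auto intro: wirt_continuous[OF wirt_lift])

lemma C1_lift:
  assumes "smooth f"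
  shows "C1 UNIV (lift f)"
proof (rule C1I[OF wirt_lift[OF assms]])
  show "continuous_on UNIV (dz f)"
    unfolding dz_def by (intro continuous_intros cont_lift smooth_partial assms) auto
  then show "continuous_on UNIV (\<lambda>z. cnj (dz f z))" by (rule continuous_on_cnj)
qed

lemma C1_dz: "smooth f \<Longrightarrow> C1 UNIV (dz f)"
  unfolding dz_def by (intro C1_intros C1_lift smooth_partial) auto

lemma lift_periodic:
  assumes "periodic \<Gamma> f" "\<gamma> \<in> \<Gamma>"
  shows "lift f (z + cplx \<gamma>) = lift f z"
  using assms by (simp add: lift_def V_add periodic_def)

text \<open>The determinant is not zero, as otherwise b would equal its projection to the line of a.
  The generators are swapped if needed to make the orientation positive.\<close>

lemma lattice_periods:
  assumes "is_lattice \<Gamma>"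
  obtains o1 o2 where "Im (o1 * cnj o2) > 0" "V o1 \<in> \<Gamma>" "V o2 \<in> \<Gamma>" "0 \<in> \<Gamma>"
    "\<And>\<gamma>. \<gamma> \<in> \<Gamma> \<Longrightarrow> \<exists>i j. cplx \<gamma> = of_int i * o1 + of_int j * o2"
proof -
  obtain a b where ab: "a \<noteq> b" "independent {a, b}"
    "\<Gamma> = {of_int i *\<^sub>R a + of_int j *\<^sub>R b | i j. True}"
    using assms unfolding is_lattice_def by blast
  have 0: "0 \<in> \<Gamma>" unfolding ab(3) by (auto intro!: exI[of _ 0])
  have a: "a \<in> \<Gamma>" unfolding ab(3) by (intro CollectI exI[of _ 1] exI[of _ 0]) simp
  have b: "b \<in> \<Gamma>" unfolding ab(3) by (intro CollectI exI[of _ 0] exI[of _ 1]) simp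
  have cs: "cplx (x *\<^sub>R q) = of_real x * cplx q" for x q by (simp add: cplx_def complex_eq_iff)
  have gen: "\<exists>i j. cplx \<gamma> = of_int i * cplx a + of_int j * cplx b" if "\<gamma> \<in> \<Gamma>" for \<gamma>
  proof -
    obtain i j where "\<gamma> = of_int i *\<^sub>R a + of_int j *\<^sub>R b" using \<open>\<gamma> \<in> \<Gamma>\<close> unfolding ab(3) by blast
    then show ?thesis by (intro exI[of _ i] exI[of _ j]) (simp add: cplx_add cs)
  qed
  have "Im (cplx a * cnj (cplx b)) \<noteq> 0"
  proof
    assume 0: "Im (cplx a * cnj (cplx b)) = 0"
    then have det: "a$2 * b$1 = a$1 * b$2" by (simp add: cplx_def)
    have na: "a \<noteq> 0" using ab(2) dependent_zero by auto
    have "(a \<bullet> a) *\<^sub>R b = (a \<bullet> b) *\<^sub>R a"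
      using det by (simp add: vec_eq_iff forall_2 inner_vec_def sum_2) algebra
    then have "b = ((a \<bullet> b) / (a \<bullet> a)) *\<^sub>R a" using na by (simp add: vec_eq_iff field_simps)
    then have "b \<in> span {a}" by (metis span_base span_scale singletonI)
    moreover have "b \<notin> span {a}"
      using ab(1,2) unfolding insert_commute[of a b] independent_insert by auto
    ultimately show False by simp
  qed
  then consider "Im (cplx a * cnj (cplx b)) > 0" | "Im (cplx b * cnj (cplx a)) > 0"
    by (fastforce simp: algebra_simps)
  then show ?thesis
  proof cases
    case 1
    then show ?thesis using that[of "cplx a" "cplx b"] a b 0 gen by simp
  next
    case 2
    have "\<exists>i j. cplx \<gamma> = of_int i * cplx b + of_int j * cplx a" if "\<gamma> \<in> \<Gamma>" for \<gamma>
      using gen[OF that] by (metis add.commute)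
    with 2 show ?thesis using that[of "cplx b" "cplx a"] a b 0 by simp
  qed
qed

subsection \<open>The equations for the coefficients\<close>

text \<open>A binary quintic is determined by its values at six pairwise non-proportional
  points.\<close>

lemma quintic_zero:
  fixes r0 r1 r2 r3 r4 r5 :: real
  assumes "\<And>x y. r0 * x ^ 5 + r1 * x ^ 4 * y + r2 * x ^ 3 * y\<^sup>2 + r3 * x\<^sup>2 * y ^ 3 + r4 * x * y ^ 4 + r5 * y ^ 5 = 0"
  shows "r0 = 0" "r1 = 0" "r2 = 0" "r3 = 0" "r4 = 0" "r5 = 0"
  using assms[of 1 0] assms[of 0 1] assms[of 1 1] assms[of 1 "- 1"] assms[of 1 2] assms[of 1 "- 2"]
  by (simp_all; linarith)+

definition quartic_form :: "(nat \<Rightarrow> real) \<Rightarrow> real \<Rightarrow> real \<Rightarrow> real" where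
  "quartic_form c x y = (\<Sum>k\<le>4. c k * x ^ (4 - k) * y ^ k)"

lemma quartic_form_expand:
  "quartic_form c x y = c 0 * x ^ 4 + c 1 * x ^ 3 * y + c 2 * x\<^sup>2 * y\<^sup>2 + c 3 * x * y ^ 3 + c 4 * y ^ 4"
  by (simp add: quartic_form_def eval_nat_numeral)

lemma hamiltonian_conformal:
  assumes "\<rho> (fst z) = l *\<^sub>R mat 1" "l \<noteq> 0"
  shows "hamiltonian \<rho> z = ((snd z $ 1)\<^sup>2 + (snd z $ 2)\<^sup>2) / (2 * l)"
proof -
  have "matrix_inv (l *\<^sub>R mat 1 :: real^2^2) = (1 / l) *\<^sub>R mat 1"
    unfolding matrix_inv_def
  proof (rule some_equality)
    show "(l *\<^sub>R mat 1 :: real^2^2) ** (1 / l) *\<^sub>R mat 1 = mat 1 \<and> (1 / l) *\<^sub>R mat 1 ** (l *\<^sub>R mat 1 :: real^2^2) = mat 1"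
      using assms(2) by (simp add: matrix_scalar_ac flip: scalar_matrix_assoc)
    fix M assume "(l *\<^sub>R mat 1 :: real^2^2) ** M = mat 1 \<and> M ** l *\<^sub>R mat 1 = mat 1"
    then have "l *\<^sub>R M = mat 1" by (simp flip: scalar_matrix_assoc)
    then show "M = (1 / l) *\<^sub>R mat 1" using assms(2) by (metis divideR_right inverse_eq_divide)
  qed
  then show ?thesis unfolding hamiltonian_def assms(1) using assms(2)
    by (simp add: scaleR_matrix_vector_assoc[symmetric] inner_vec_def sum_2 power2_eq_square field_simps)
qed

lemma has_derivative_quartic:
  fixes p q :: "real^2"
  assumes c: "\<And>k. k \<le> 4 \<Longrightarrow> (c k) differentiable (at q)"
    and F: "\<And>q p. F (q, p) = quartic_form (\<lambda>k. c k q) (p$1) (p$2)"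
  shows "(F has_derivative (\<lambda>h. quartic_form (\<lambda>k. frechet_derivative (c k) (at q) (fst h)) (p$1) (p$2)
      + (4 * c 0 q * (p$1) ^ 3 + 3 * c 1 q * (p$1)\<^sup>2 * p$2 + 2 * c 2 q * p$1 * (p$2)\<^sup>2 + c 3 q * (p$2) ^ 3) * snd h $ 1
      + (c 1 q * (p$1) ^ 3 + 2 * c 2 q * (p$1)\<^sup>2 * p$2 + 3 * c 3 q * p$1 * (p$2)\<^sup>2 + 4 * c 4 q * (p$2) ^ 3) * snd h $ 2))
    (at (q, p))"
proof -
  have C: "((\<lambda>z. c k (fst z)) has_derivative (\<lambda>h. frechet_derivative (c k) (at q) (fst h))) (at (q, p))" if "k \<le> 4" for k
  proof -
    have "(fst has_derivative fst) (at (q, p))" by (rule bounded_linear_imp_has_derivative[OF bounded_linear_fst])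
    from has_derivative_compose[OF this, of "c k" "frechet_derivative (c k) (at q)"]
    show ?thesis using frechet_derivative_works[THEN iffD1, OF c[OF that]] by simp
  qed
  have P: "((\<lambda>z. snd z $ i) has_derivative (\<lambda>h. snd h $ i)) (at (q, p))" for i :: 2
    by (rule bounded_linear_imp_has_derivative) (intro bounded_linear_compose[OF bounded_linear_vec_nth bounded_linear_snd])
  have Feq: "F = (\<lambda>z. c 0 (fst z) * (snd z $ 1) ^ 4 + c 1 (fst z) * (snd z $ 1) ^ 3 * snd z $ 2
      + c 2 (fst z) * (snd z $ 1)\<^sup>2 * (snd z $ 2)\<^sup>2 + c 3 (fst z) * snd z $ 1 * (snd z $ 2) ^ 3 + c 4 (fst z) * (snd z $ 2) ^ 4)"
  proof
    fix z show "F z = c 0 (fst z) * (snd z $ 1) ^ 4 + c 1 (fst z) * (snd z $ 1) ^ 3 * snd z $ 2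
      + c 2 (fst z) * (snd z $ 1)\<^sup>2 * (snd z $ 2)\<^sup>2 + c 3 (fst z) * snd z $ 1 * (snd z $ 2) ^ 3 + c 4 (fst z) * (snd z $ 2) ^ 4"
      using F[of "fst z" "snd z"] by (simp add: quartic_form_expand)
  qed
  show ?thesis unfolding Feq
    by (rule has_derivative_eq_rhs[OF has_derivative_add[OF has_derivative_add[OF has_derivative_add[OF has_derivative_add[OF
        has_derivative_mult[OF C[of 0] has_derivative_power[OF P]]
        has_derivative_mult[OF has_derivative_mult[OF C[of 1] has_derivative_power[OF P]] P]]
        has_derivative_mult[OF has_derivative_mult[OF C[of 2] has_derivative_power[OF P]] has_derivative_power[OF P]]]
        has_derivative_mult[OF has_derivative_mult[OF C[of 3] P] has_derivative_power[OF P]]]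
        has_derivative_mult[OF C[of 4] has_derivative_power[OF P]]]])
       (simp_all add: fun_eq_iff quartic_form_expand algebra_simps power2_eq_square power3_eq_cube)
qed

text \<open>Substitute 2 x = p + cnj p and 2 y = - I (p - cnj p) for p = x + I y, whence the factor
  2^4. \<open>I\<close> is known only by its square, so the identity is purely algebraic.\<close>

lemma quartic_complex:
  fixes c0 c1 c2 c3 c4 x y I :: complex
  assumes "I\<^sup>2 = - 1"
  shows "16 * (c0 * x ^ 4 + c1 * x ^ 3 * y + c2 * x\<^sup>2 * y\<^sup>2 + c3 * x * y ^ 3 + c4 * y ^ 4)
    = (c0 - I * c1 - c2 + I * c3 + c4) * (x + I * y) ^ 4
      + (4 * c0 - 2 * I * c1 - 2 * I * c3 - 4 * c4) * (x + I * y) ^ 3 * (x - I * y)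
      + (6 * c0 + 2 * c2 + 6 * c4) * (x + I * y)\<^sup>2 * (x - I * y)\<^sup>2
      + (4 * c0 + 2 * I * c1 + 2 * I * c3 - 4 * c4) * (x + I * y) * (x - I * y) ^ 3
      + (c0 + I * c1 - c2 - I * c3 + c4) * (x - I * y) ^ 4"
  using assms by algebra

definition coeffA :: "(nat \<Rightarrow> complex) \<Rightarrow> complex" where
  "coeffA c = (c 0 - \<i> * c 1 - c 2 + \<i> * c 3 + c 4) / 16"
definition coeffB :: "(nat \<Rightarrow> complex) \<Rightarrow> complex" where
  "coeffB c = (4 * c 0 - 2 * \<i> * c 1 - 2 * \<i> * c 3 - 4 * c 4) / 16"
definition coeffC :: "(nat \<Rightarrow> complex) \<Rightarrow> complex" where
  "coeffC c = (6 * c 0 + 2 * c 2 + 6 * c 4) / 16"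

definition conformal_form :: "complex \<Rightarrow> complex \<Rightarrow> complex \<Rightarrow> complex \<Rightarrow> complex" where
  "conformal_form A B C p = A * p ^ 4 + B * p ^ 3 * cnj p + C * p\<^sup>2 * (cnj p)\<^sup>2 + cnj B * p * (cnj p) ^ 3 + cnj A * (cnj p) ^ 4"

lemma quartic_form_conformal:
  "of_real (quartic_form c x y) = conformal_form (coeffA (\<lambda>k. c k)) (coeffB (\<lambda>k. c k)) (coeffC (\<lambda>k. c k)) (Complex x y)"
proof -
  have "Complex x y = of_real x + \<i> * of_real y" "cnj (Complex x y) = of_real x - \<i> * of_real y"
    by (simp_all add: complex_eq_iff)
  then show ?thesis
    unfolding conformal_form_def coeffA_def coeffB_def coeffC_def quartic_form_expand
    using quartic_complex[of \<i> "of_real (c 0)" "of_real x" "of_real (c 1)" "of_real y" "of_real (c 2)" "of_real (c 3)" "of_real (c 4)"]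
    by (simp add: add_divide_distrib[symmetric] diff_divide_distrib[symmetric]; simp add: mult.commute)
qed

section \<open>Conformal metrics on the torus with a quartic integral\<close>

locale conformal_torus =
  fixes \<Gamma> :: "(real^2) set" and \<rho> :: "real^2 \<Rightarrow> real^2^2" and \<Lambda> :: "real^2 \<Rightarrow> real"
    and F :: "(real^2) \<times> (real^2) \<Rightarrow> real" and c :: "nat \<Rightarrow> real^2 \<Rightarrow> real"
  assumes lattice: "is_lattice \<Gamma>"
    and smooth_\<Lambda>: "smooth \<Lambda>" and periodic_\<Lambda>: "periodic \<Gamma> \<Lambda>" and pos_\<Lambda>: "\<And>q. \<Lambda> q > 0"
    and \<rho>: "\<And>q. \<rho> q = \<Lambda> q *\<^sub>R mat 1"
    and smooth_c: "\<And>k. k \<le> 4 \<Longrightarrow> smooth (c k)" and periodic_c: "\<And>k. k \<le> 4 \<Longrightarrow> periodic \<Gamma> (c k)"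
    and F: "\<And>q p. F (q, p) = quartic_form (\<lambda>k. c k q) (p$1) (p$2)"
    and integral: "first_integral \<rho> F"
begin

lemma hamiltonian_eq: "hamiltonian \<rho> = (\<lambda>z. ((snd z $ 1)\<^sup>2 + (snd z $ 2)\<^sup>2) / (2 * \<Lambda> (fst z)))"
proof
  fix z
  show "hamiltonian \<rho> z = ((snd z $ 1)\<^sup>2 + (snd z $ 2)\<^sup>2) / (2 * \<Lambda> (fst z))"
    by (rule hamiltonian_conformal[OF \<rho>]) (use pos_\<Lambda>[of "fst z"] in simp)
qed

lemma has_derivative_hamiltonian:
  "(hamiltonian \<rho> has_derivative (\<lambda>h. (p$1 * snd h $ 1 + p$2 * snd h $ 2) / \<Lambda> q
      - ((p$1)\<^sup>2 + (p$2)\<^sup>2) * frechet_derivative \<Lambda> (at q) (fst h) / (2 * (\<Lambda> q)\<^sup>2))) (at (q, p))"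
proof -
  have L: "((\<lambda>z. \<Lambda> (fst z)) has_derivative (\<lambda>h. frechet_derivative \<Lambda> (at q) (fst h))) (at (q, p))"
  proof -
    have "(fst has_derivative fst) (at (q, p))" by (rule bounded_linear_imp_has_derivative[OF bounded_linear_fst])
    from has_derivative_compose[OF this, of \<Lambda> "frechet_derivative \<Lambda> (at q)"]
    show ?thesis using frechet_derivative_works[THEN iffD1, OF smoothD(1)[OF smooth_\<Lambda>]] by simp
  qed
  have P: "((\<lambda>z. snd z $ i) has_derivative (\<lambda>h. snd h $ i)) (at (q, p))" for i :: 2
    by (rule bounded_linear_imp_has_derivative) (intro bounded_linear_compose[OF bounded_linear_vec_nth bounded_linear_snd])
  have nz: "\<Lambda> q \<noteq> 0" using pos_\<Lambda>[of q] by simp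
  have nz': "2 * \<Lambda> (fst (q, p)) \<noteq> 0" using nz by simp
  show ?thesis unfolding hamiltonian_eq
    by (rule has_derivative_eq_rhs, rule has_derivative_divide'[OF has_derivative_add[OF has_derivative_power[OF P] has_derivative_power[OF P]]
          has_derivative_mult_right[OF L] nz'])
       (use nz in \<open>simp add: fun_eq_iff field_simps power2_eq_square\<close>)
qed

text \<open>Multiplied by 2 l^2, the Poisson bracket is a homogeneous quintic in the momenta that
  vanishes identically; these are its six coefficients.\<close>

lemma coefficient_equations:
  fixes q :: "real^2"
  defines "l \<equiv> \<Lambda> q" and "l1 \<equiv> partial 1 \<Lambda> q" and "l2 \<equiv> partial 2 \<Lambda> q"
    and "a \<equiv> \<lambda>k. c k q" and "a1 \<equiv> \<lambda>k. partial 1 (c k) q" and "a2 \<equiv> \<lambda>k. partial 2 (c k) q"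
  shows "2 * l * a1 0 + 4 * a 0 * l1 + a 1 * l2 = 0"
    "2 * l * (a1 1 + a2 0) + 3 * a 1 * l1 + 2 * a 2 * l2 = 0"
    "2 * l * (a1 2 + a2 1) + (2 * a 2 + 4 * a 0) * l1 + (3 * a 3 + a 1) * l2 = 0"
    "2 * l * (a1 3 + a2 2) + (a 3 + 3 * a 1) * l1 + (4 * a 4 + 2 * a 2) * l2 = 0"
    "2 * l * (a1 4 + a2 3) + 2 * a 2 * l1 + 3 * a 3 * l2 = 0"
    "2 * l * a2 4 + a 3 * l1 + 4 * a 4 * l2 = 0"
proof -
  have diff: "(c k) differentiable (at q)" if "k \<le> 4" for k using smoothD(1)[OF smooth_c[OF that]] .
  have l: "l \<noteq> 0" using pos_\<Lambda>[of q] by (simp add: l_def)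
  have nth: "axis i (1::real) $ j = (if i = j then 1 else 0)" for i j :: 2 by (simp add: axis_def)
  have one2: "(1::2) \<noteq> 2" by simp
  have "(2 * l * a1 0 + 4 * a 0 * l1 + a 1 * l2) * x ^ 5
      + (2 * l * (a1 1 + a2 0) + 3 * a 1 * l1 + 2 * a 2 * l2) * x ^ 4 * y
      + (2 * l * (a1 2 + a2 1) + (2 * a 2 + 4 * a 0) * l1 + (3 * a 3 + a 1) * l2) * x ^ 3 * y\<^sup>2
      + (2 * l * (a1 3 + a2 2) + (a 3 + 3 * a 1) * l1 + (4 * a 4 + 2 * a 2) * l2) * x\<^sup>2 * y ^ 3
      + (2 * l * (a1 4 + a2 3) + 2 * a 2 * l1 + 3 * a 3 * l2) * x * y ^ 4
      + (2 * l * a2 4 + a 3 * l1 + 4 * a 4 * l2) * y ^ 5 = 0" for x y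
  proof -
    define p :: "real^2" where "p = vector [x, y]"
    have p: "p$1 = x" "p$2 = y" by (simp_all add: p_def)
    have fF: "frechet_derivative F (at (q, p)) = (\<lambda>h. quartic_form (\<lambda>k. frechet_derivative (c k) (at q) (fst h)) x y
        + (4 * a 0 * x ^ 3 + 3 * a 1 * x\<^sup>2 * y + 2 * a 2 * x * y\<^sup>2 + a 3 * y ^ 3) * snd h $ 1
        + (a 1 * x ^ 3 + 2 * a 2 * x\<^sup>2 * y + 3 * a 3 * x * y\<^sup>2 + 4 * a 4 * y ^ 3) * snd h $ 2)"
      using frechet_derivative_at[OF has_derivative_quartic[OF diff F, of p]] unfolding p a_def by simp
    have fH: "frechet_derivative (hamiltonian \<rho>) (at (q, p)) = (\<lambda>h. (x * snd h $ 1 + y * snd h $ 2) / l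
        - (x\<^sup>2 + y\<^sup>2) * frechet_derivative \<Lambda> (at q) (fst h) / (2 * l\<^sup>2))"
      using frechet_derivative_at[OF has_derivative_hamiltonian[of p q]] unfolding p l_def by simp
    have f0: "frechet_derivative (c k) (at q) 0 = 0" if "k \<le> 4" for k
      using linear_0[OF linear_frechet_derivative[OF diff[OF that]]] .
    have fl0: "frechet_derivative \<Lambda> (at q) 0 = 0"
      using linear_0[OF linear_frechet_derivative[OF smoothD(1)[OF smooth_\<Lambda>]]] .
    have clear: "2 * l * (U * x + W * y) + s * (f * l1 + k * l2) = 0"
      if "U * (x / l) + W * (y / l) - (f * (- (s * l1 / (2 * l\<^sup>2))) + k * (- (s * l2 / (2 * l\<^sup>2)))) = 0" for U W f k s
    proof -
      have "2 * l * (U * x + W * y) + s * (f * l1 + k * l2)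
          = 2 * l\<^sup>2 * (U * (x / l) + W * (y / l) - (f * (- (s * l1 / (2 * l\<^sup>2))) + k * (- (s * l2 / (2 * l\<^sup>2)))))"
        using l by (simp add: field_simps power2_eq_square)
      then show ?thesis unfolding that by simp
    qed
    have "dq F (q, p) $ 1 = quartic_form a1 x y" "dq F (q, p) $ 2 = quartic_form a2 x y"
      "dp F (q, p) $ 1 = 4 * a 0 * x ^ 3 + 3 * a 1 * x\<^sup>2 * y + 2 * a 2 * x * y\<^sup>2 + a 3 * y ^ 3"
      "dp F (q, p) $ 2 = a 1 * x ^ 3 + 2 * a 2 * x\<^sup>2 * y + 3 * a 3 * x * y\<^sup>2 + 4 * a 4 * y ^ 3"
      "dq (hamiltonian \<rho>) (q, p) $ 1 = - ((x\<^sup>2 + y\<^sup>2) * l1 / (2 * l\<^sup>2))"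
      "dq (hamiltonian \<rho>) (q, p) $ 2 = - ((x\<^sup>2 + y\<^sup>2) * l2 / (2 * l\<^sup>2))"
      "dp (hamiltonian \<rho>) (q, p) $ 1 = x / l" "dp (hamiltonian \<rho>) (q, p) $ 2 = y / l"
      unfolding dq_def dp_def fF fH a1_def a2_def l1_def l2_def partial_def
      by (simp_all add: nth quartic_form_expand f0 fl0)
    moreover have "poisson_bracket F (hamiltonian \<rho>) (q, p) = 0" using integral by (simp add: first_integral_def)
    ultimately have "quartic_form a1 x y * (x / l) + quartic_form a2 x y * (y / l)
      - ((4 * a 0 * x ^ 3 + 3 * a 1 * x\<^sup>2 * y + 2 * a 2 * x * y\<^sup>2 + a 3 * y ^ 3) * (- ((x\<^sup>2 + y\<^sup>2) * l1 / (2 * l\<^sup>2)))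
        + (a 1 * x ^ 3 + 2 * a 2 * x\<^sup>2 * y + 3 * a 3 * x * y\<^sup>2 + 4 * a 4 * y ^ 3) * (- ((x\<^sup>2 + y\<^sup>2) * l2 / (2 * l\<^sup>2)))) = 0"
      by (simp add: poisson_bracket_def inner_vec_def sum_2)
    from clear[OF this] have "2 * l * (quartic_form a1 x y * x + quartic_form a2 x y * y)
      + (x\<^sup>2 + y\<^sup>2) * ((4 * a 0 * x ^ 3 + 3 * a 1 * x\<^sup>2 * y + 2 * a 2 * x * y\<^sup>2 + a 3 * y ^ 3) * l1
        + (a 1 * x ^ 3 + 2 * a 2 * x\<^sup>2 * y + 3 * a 3 * x * y\<^sup>2 + 4 * a 4 * y ^ 3) * l2) = 0"
      .
    then show ?thesis unfolding quartic_form_expand by algebra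
  qed
  note z = quintic_zero[OF this]
  show
    "2 * l * a1 0 + 4 * a 0 * l1 + a 1 * l2 = 0"
    "2 * l * (a1 1 + a2 0) + 3 * a 1 * l1 + 2 * a 2 * l2 = 0"
    "2 * l * (a1 2 + a2 1) + (2 * a 2 + 4 * a 0) * l1 + (3 * a 3 + a 1) * l2 = 0"
    "2 * l * (a1 3 + a2 2) + (a 3 + 3 * a 1) * l1 + (4 * a 4 + 2 * a 2) * l2 = 0"
    "2 * l * (a1 4 + a2 3) + 2 * a 2 * l1 + 3 * a 3 * l2 = 0"
    "2 * l * a2 4 + a 3 * l1 + 4 * a 4 * l2 = 0" using z .
qed

end

lemma wirt_coeff:
  assumes f: "\<And>k. k \<le> 4 \<Longrightarrow> wirt (f k) (a k) (b k) z"
  shows "wirt (\<lambda>z. coeffA (\<lambda>k. f k z)) (coeffA a) (coeffA b) z"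
    "wirt (\<lambda>z. coeffB (\<lambda>k. f k z)) (coeffB a) (coeffB b) z"
    "wirt (\<lambda>z. coeffC (\<lambda>k. f k z)) (coeffC a) (coeffC b) z"
proof -
  have f': "wirt (f 0) (a 0) (b 0) z" "wirt (f 1) (a 1) (b 1) z" "wirt (f 2) (a 2) (b 2) z"
    "wirt (f 3) (a 3) (b 3) z" "wirt (f 4) (a 4) (b 4) z"
    by (simp_all add: f)
  show "wirt (\<lambda>z. coeffA (\<lambda>k. f k z)) (coeffA a) (coeffA b) z" unfolding coeffA_def
    by (rule wirt_cong[OF wirt_divide[OF wirt_add[OF wirt_add[OF wirt_diff[OF wirt_diff[OF f'(1)
        wirt_mult[OF wirt_const f'(2)]] f'(3)] wirt_mult[OF wirt_const f'(4)]] f'(5)] wirt_const]]) auto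
  show "wirt (\<lambda>z. coeffB (\<lambda>k. f k z)) (coeffB a) (coeffB b) z" unfolding coeffB_def
    by (rule wirt_cong[OF wirt_divide[OF wirt_diff[OF wirt_diff[OF wirt_diff[OF wirt_mult[OF wirt_const f'(1)]
        wirt_mult[OF wirt_const f'(2)]] wirt_mult[OF wirt_const f'(4)]] wirt_mult[OF wirt_const f'(5)]] wirt_const]]) auto
  show "wirt (\<lambda>z. coeffC (\<lambda>k. f k z)) (coeffC a) (coeffC b) z" unfolding coeffC_def
    by (rule wirt_cong[OF wirt_divide[OF wirt_add[OF wirt_add[OF wirt_mult[OF wirt_const f'(1)]
        wirt_mult[OF wirt_const f'(3)]] wirt_mult[OF wirt_const f'(5)]] wirt_const]]) auto
qed

lemma cnj_coeffC: "cnj (coeffC a) = coeffC (\<lambda>k. cnj (a k))"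
  by (simp add: coeffC_def)

lemma C1_coeff:
  assumes "\<And>k. k \<le> 4 \<Longrightarrow> C1 S (f k)"
  shows "C1 S (\<lambda>z. coeffA (\<lambda>k. f k z))" "C1 S (\<lambda>z. coeffB (\<lambda>k. f k z))" "C1 S (\<lambda>z. coeffC (\<lambda>k. f k z))"
proof -
  show "C1 S (\<lambda>z. coeffA (\<lambda>k. f k z))" unfolding coeffA_def
    by (intro C1_divide C1_add C1_diff C1_mult C1_const assms) auto
  show "C1 S (\<lambda>z. coeffB (\<lambda>k. f k z))" unfolding coeffB_def
    by (intro C1_divide C1_add C1_diff C1_mult C1_const assms) auto
  show "C1 S (\<lambda>z. coeffC (\<lambda>k. f k z))" unfolding coeffC_def
    by (intro C1_divide C1_add C1_diff C1_mult C1_const assms) auto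
qed

lemma antiholomorphic_periodic_constant:
  assumes f: "\<And>z. wirt f 0 (b z) z" and o: "Im (o1 * cnj o2) \<noteq> 0"
    and per: "\<And>z. f (z + o1) = f z" "\<And>z. f (z + o2) = f z"
  obtains k where "\<And>z. f z = k"
proof -
  have "compact (range f)"
    by (rule periodic_range_compact[OF o per])
       (auto intro!: continuous_at_imp_continuous_on wirt_continuous[OF f])
  then have "bounded (range (\<lambda>z. cnj (f z)))"
    by (auto simp: bounded_iff dest!: compact_imp_bounded)
  moreover have "(\<lambda>z. cnj (f z)) holomorphic_on UNIV"
  proof (rule holomorphic_onI)
    fix z
    have "((\<lambda>z. cnj (f z)) has_field_derivative cnj (b z)) (at z)"
      using wirt_cnj[OF f[of z]] unfolding wirt_def has_field_derivative_def by simp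
    then show "(\<lambda>z. cnj (f z)) field_differentiable at z within UNIV"
      by (auto simp: field_differentiable_def)
  qed
  ultimately have "(\<lambda>z. cnj (f z)) constant_on UNIV" by (intro Liouville_theorem)
  then obtain k where "\<And>z. cnj (f z) = k" by (auto simp: constant_on_def)
  then have "f z = cnj k" for z by (metis complex_cnj_cnj)
  then show ?thesis by (rule that)
qed

text \<open>With real C there are five real unknowns, and the values at five momenta determine
  them.\<close>

lemma conformal_form_unique:
  assumes eq: "\<And>p. conformal_form A B C p = conformal_form A' B' C' p" and C: "cnj C = C" "cnj C' = C'"
  shows "A = A'" "B = B'"
proof -
  have r: "Im C = 0" "Im C' = 0" using C by (metis Im_complex_of_real Reals_cnj_iff Reals_cases)+
  have e: "Re (conformal_form A B C p) = Re (conformal_form A' B' C' p)" for p using eq by simp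
  note d = conformal_form_def power2_eq_square power3_eq_cube power4_eq_xxxx
  have "Re A = Re A'" "Im A = Im A'" "Re B = Re B'" "Im B = Im B'"
    using e[of 1] e[of \<i>] e[of "Complex 1 1"] e[of "Complex 1 (- 1)"] e[of "Complex 2 1"] r
    by (simp_all add: d algebra_simps)
  then show "A = A'" "B = B'" by (simp_all add: complex_eq_iff)
qed

text \<open>Written in p and cnj p, the six real equations become three complex ones together with
  their conjugates.\<close>

lemma complex_coefficient_equations:
  fixes a a1 a2 :: "nat \<Rightarrow> real" and l l1 l2 :: real
  assumes "2 * l * a1 0 + 4 * a 0 * l1 + a 1 * l2 = 0"
    "2 * l * (a1 1 + a2 0) + 3 * a 1 * l1 + 2 * a 2 * l2 = 0"
    "2 * l * (a1 2 + a2 1) + (2 * a 2 + 4 * a 0) * l1 + (3 * a 3 + a 1) * l2 = 0"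
    "2 * l * (a1 3 + a2 2) + (a 3 + 3 * a 1) * l1 + (4 * a 4 + 2 * a 2) * l2 = 0"
    "2 * l * (a1 4 + a2 3) + 2 * a 2 * l1 + 3 * a 3 * l2 = 0"
    "2 * l * a2 4 + a 3 * l1 + 4 * a 4 * l2 = 0"
  defines "d \<equiv> \<lambda>k. Complex (a1 k / 2) (- (a2 k / 2))" and "lz \<equiv> Complex (l1 / 2) (- (l2 / 2))"
  shows "l * coeffA d = 0"
    "l * coeffB d + coeffB (\<lambda>k. a k) * lz + l * coeffA (\<lambda>k. cnj (d k)) + 4 * coeffA (\<lambda>k. a k) * cnj lz = 0"
    "l * coeffC d + 2 * coeffC (\<lambda>k. a k) * lz + l * coeffB (\<lambda>k. cnj (d k)) + 3 * coeffB (\<lambda>k. a k) * cnj lz = 0"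
proof -
  note e = assms(1-6)[simplified distrib_left distrib_right]
  show "l * coeffA d = 0"
    by (rule complex_eqI; simp add: coeffA_def d_def algebra_simps) (use e in \<open>simp_all add: algebra_simps\<close>)
  show "l * coeffB d + coeffB (\<lambda>k. a k) * lz + l * coeffA (\<lambda>k. cnj (d k)) + 4 * coeffA (\<lambda>k. a k) * cnj lz = 0"
    by (rule complex_eqI; insert e; simp add: coeffA_def coeffB_def d_def lz_def field_simps; algebra)
  show "l * coeffC d + 2 * coeffC (\<lambda>k. a k) * lz + l * coeffB (\<lambda>k. cnj (d k)) + 3 * coeffB (\<lambda>k. a k) * cnj lz = 0"
    by (rule complex_eqI; insert e; simp add: coeffB_def coeffC_def d_def lz_def field_simps; algebra)
qed

context conformal_torus
begin

definition Ac :: "complex \<Rightarrow> complex" where "Ac z = coeffA (\<lambda>k. lift (c k) z)"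
definition Bc :: "complex \<Rightarrow> complex" where "Bc z = coeffB (\<lambda>k. lift (c k) z)"
definition Cc :: "complex \<Rightarrow> complex" where "Cc z = coeffC (\<lambda>k. lift (c k) z)"

lemma wirt_coeffs:
  "wirt Ac (coeffA (\<lambda>k. dz (c k) z)) (coeffA (\<lambda>k. cnj (dz (c k) z))) z"
  "wirt Bc (coeffB (\<lambda>k. dz (c k) z)) (coeffB (\<lambda>k. cnj (dz (c k) z))) z"
  "wirt Cc (coeffC (\<lambda>k. dz (c k) z)) (coeffC (\<lambda>k. cnj (dz (c k) z))) z"
  unfolding Ac_def[abs_def] Bc_def[abs_def] Cc_def[abs_def]
  by (intro wirt_coeff wirt_lift smooth_c; assumption)+

lemma F_conformal: "of_real (F (V z, V p)) = conformal_form (Ac z) (Bc z) (Cc z) p"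
proof -
  have "Complex (Re p) (Im p) = p" by simp
  then show ?thesis unfolding F quartic_form_conformal Ac_def Bc_def Cc_def lift_def by simp
qed

lemma conformal_equations:
  "lift \<Lambda> z * coeffA (\<lambda>k. dz (c k) z) = 0"
  "lift \<Lambda> z * coeffB (\<lambda>k. dz (c k) z) + Bc z * dz \<Lambda> z + lift \<Lambda> z * coeffA (\<lambda>k. cnj (dz (c k) z))
    + 4 * Ac z * cnj (dz \<Lambda> z) = 0"
  "lift \<Lambda> z * coeffC (\<lambda>k. dz (c k) z) + 2 * Cc z * dz \<Lambda> z + lift \<Lambda> z * coeffB (\<lambda>k. cnj (dz (c k) z))
    + 3 * Bc z * cnj (dz \<Lambda> z) = 0"
proof -
  have d: "dz f z = Complex (partial 1 f (V z) / 2) (- (partial 2 f (V z) / 2))" for f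
    by (simp add: dz_def lift_def complex_eq_iff)
  note e = complex_coefficient_equations[OF coefficient_equations[of "V z"]]
  show "lift \<Lambda> z * coeffA (\<lambda>k. dz (c k) z) = 0"
    "lift \<Lambda> z * coeffB (\<lambda>k. dz (c k) z) + Bc z * dz \<Lambda> z + lift \<Lambda> z * coeffA (\<lambda>k. cnj (dz (c k) z))
      + 4 * Ac z * cnj (dz \<Lambda> z) = 0"
    "lift \<Lambda> z * coeffC (\<lambda>k. dz (c k) z) + 2 * Cc z * dz \<Lambda> z + lift \<Lambda> z * coeffB (\<lambda>k. cnj (dz (c k) z))
      + 3 * Bc z * cnj (dz \<Lambda> z) = 0"
    using e unfolding d Ac_def Bc_def Cc_def lift_def by blast+
qed

lemma L_nz: "lift \<Lambda> z \<noteq> 0"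
  using pos_\<Lambda>[of "V z"] by (simp add: lift_def)

lemma wirt_A: "wirt Ac 0 (coeffA (\<lambda>k. cnj (dz (c k) z))) z"
  using wirt_coeffs(1)[of z] conformal_equations(1)[of z] L_nz[of z] by simp

lemma periodic_lifts:
  assumes "V \<omega> \<in> \<Gamma>"
  shows "lift \<Lambda> (z + \<omega>) = lift \<Lambda> z" "Ac (z + \<omega>) = Ac z" "Bc (z + \<omega>) = Bc z" "Cc (z + \<omega>) = Cc z"
proof -
  show "lift \<Lambda> (z + \<omega>) = lift \<Lambda> z" using lift_periodic[OF periodic_\<Lambda> assms] by simp
  have "lift (c k) (z + \<omega>) = lift (c k) z" if "k \<le> 4" for k
    using lift_periodic[OF periodic_c[OF that] assms] by simp
  then show "Ac (z + \<omega>) = Ac z" "Bc (z + \<omega>) = Bc z" "Cc (z + \<omega>) = Cc z"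
    by (simp_all add: Ac_def Bc_def Cc_def coeffA_def coeffB_def coeffC_def)
qed

lemma A_constant: obtains A where "\<And>z. Ac z = A"
proof -
  obtain o1 o2 where o: "Im (o1 * cnj o2) > 0" "V o1 \<in> \<Gamma>" "V o2 \<in> \<Gamma>"
    using lattice_periods[OF lattice] by metis
  show ?thesis
    by (rule antiholomorphic_periodic_constant[OF wirt_A, of o1 o2]) (use o that in \<open>auto simp: periodic_lifts\<close>)
qed

lemma wirt_A_zero:
  assumes "\<And>z. Ac z = A"
  shows "coeffA (\<lambda>k. cnj (dz (c k) z)) = 0"
proof -
  have "Ac = (\<lambda>z. A)" using assms by auto
  then show ?thesis using wirt_unique(2)[OF wirt_A] wirt_const by metis
qed

lemma cnj_Cc: "cnj (Cc z) = Cc z"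
  by (simp add: Cc_def cnj_coeffC lift_def)

text \<open>
  If the leading coefficient vanishes, the integral is the product of the energy and a
  quadratic integral, so the metric is a Liouville metric on the whole torus.
\<close>

lemma separates_quadratic:
  assumes A0: "\<And>z. Ac z = 0" and indep: "differentials_independent F (hamiltonian \<rho>) z0"
  shows "\<exists>d. cmod d = 1 \<and> separates (lift \<Lambda>) d UNIV"
proof -
  obtain o1 o2 where o: "Im (o1 * cnj o2) > 0" "V o1 \<in> \<Gamma>" "V o2 \<in> \<Gamma>"
    using lattice_periods[OF lattice] by metis
  note wL = wirt_lift[OF smooth_\<Lambda>]
  have e2: "lift \<Lambda> z * coeffB (\<lambda>k. dz (c k) z) + Bc z * dz \<Lambda> z = 0" for z
    using conformal_equations(2)[of z] wirt_A_zero[OF A0, of z] A0[of z] by simp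
  \<comment> \<open>With A = 0, the second equation says that B L has no z-derivative; being
    periodic and antiholomorphic, it is constant.\<close>
  have wBL: "wirt (\<lambda>z. Bc z * lift \<Lambda> z) 0 (coeffB (\<lambda>k. cnj (dz (c k) z)) * lift \<Lambda> z + Bc z * cnj (dz \<Lambda> z)) z" for z
    by (rule wirt_cong[OF wirt_mult[OF wirt_coeffs(2) wL]]) (use e2[of z] in \<open>auto simp: mult.commute\<close>)
  obtain \<beta> where \<beta>: "\<And>z. Bc z * lift \<Lambda> z = \<beta>"
    by (rule antiholomorphic_periodic_constant[OF wBL, of o1 o2]) (use o in \<open>auto simp: periodic_lifts\<close>)
  have b: "coeffB (\<lambda>k. cnj (dz (c k) z)) * lift \<Lambda> z + Bc z * cnj (dz \<Lambda> z) = 0" for z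
  proof -
    have "(\<lambda>z. Bc z * lift \<Lambda> z) = (\<lambda>z. \<beta>)" using \<beta> by auto
    then show ?thesis using wirt_unique(2)[OF wBL] wirt_const by metis
  qed
  define W where "W z = Cc z * (lift \<Lambda> z)\<^sup>2" for z
  have W_real: "cnj (W z) = W z" for z by (simp add: W_def cnj_Cc lift_def)
  have wW0: "wirt W (- 2 * \<beta> * cnj (dz \<Lambda> z)) (coeffC (\<lambda>k. cnj (dz (c k) z)) * (lift \<Lambda> z)\<^sup>2 + Cc z * (2 * lift \<Lambda> z * cnj (dz \<Lambda> z))) z" for z
  proof -
    have "coeffC (\<lambda>k. dz (c k) z) * (lift \<Lambda> z)\<^sup>2 + Cc z * (2 * lift \<Lambda> z * dz \<Lambda> z) = - 2 * \<beta> * cnj (dz \<Lambda> z)"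
      using conformal_equations(3)[of z] b[of z] \<beta>[of z] by algebra
    then show ?thesis unfolding W_def
      by (intro wirt_cong[OF wirt_mult[OF wirt_coeffs(3) wirt_power[OF wL]]]) auto
  qed
  have wW: "wirt W (- 2 * \<beta> * cnj (dz \<Lambda> z)) (cnj (- 2 * \<beta> * cnj (dz \<Lambda> z))) z" for z
    using wW0[of z] wirt_real_valued[OF wW0 open_UNIV] W_real by simp
  \<comment> \<open>\<beta> = 0 would give B = 0 and make C L^2 constant, so F would be a multiple
    of the squared energy, which independence of the differentials at z0 excludes.\<close>
  have "\<beta> \<noteq> 0"
  proof
    assume \<beta>0: "\<beta> = 0"
    have "(W has_derivative (\<lambda>h. 0)) (at z within UNIV)" for z using wW[of z] by (simp add: wirt_def \<beta>0)
    from has_derivative_zero_constant[OF convex_UNIV this] obtain K where K: "\<And>z. W z = K" by auto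
    have FH: "F z = 4 * Re K * (hamiltonian \<rho> z)\<^sup>2" for z
    proof -
      define y p where "y = cplx (fst z)" and "p = cplx (snd z)"
      have z: "z = (V y, V p)" by (simp add: y_def p_def)
      have B0: "Bc y = 0" using \<beta>[of y] \<beta>0 L_nz[of y] by simp
      define l where "l = \<Lambda> (V y)"
      have l: "l \<noteq> 0" using pos_\<Lambda>[of "V y"] by (simp add: l_def)
      have "complex_of_real (F z) = Cc y * (p * cnj p)\<^sup>2"
        unfolding z F_conformal conformal_form_def A0 B0 by (simp add: power_mult_distrib)
      also have "\<dots> = K / (of_real l)\<^sup>2 * (of_real ((cmod p)\<^sup>2))\<^sup>2"
        using K[of y] l unfolding W_def complex_norm_square[symmetric] lift_def l_def[symmetric] by (simp add: field_simps)
      finally have "F z = Re K / l\<^sup>2 * ((cmod p)\<^sup>2)\<^sup>2"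
        by (metis (no_types, lifting) Re_complex_of_real Re_divide_of_real times_complex.sel(1) Im_complex_of_real mult_zero_right diff_zero of_real_power)
      moreover have "hamiltonian \<rho> z = (cmod p)\<^sup>2 / (2 * l)"
        unfolding hamiltonian_eq z l_def cmod_power2 by simp
      ultimately show ?thesis using l by (simp add: power_divide power_mult_distrib)
    qed
    obtain q p where z0: "z0 = (q, p)" by (cases z0)
    define H' :: "(real^2) \<times> (real^2) \<Rightarrow> real" where "H' = (\<lambda>h. (p$1 * snd h $ 1 + p$2 * snd h $ 2) / \<Lambda> q
      - ((p$1)\<^sup>2 + (p$2)\<^sup>2) * frechet_derivative \<Lambda> (at q) (fst h) / (2 * (\<Lambda> q)\<^sup>2))"
    have dH: "(hamiltonian \<rho> has_derivative H') (at z0)"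
      unfolding z0 H'_def by (rule has_derivative_hamiltonian)
    have "((\<lambda>z. 4 * Re K * (hamiltonian \<rho> z)\<^sup>2) has_derivative (\<lambda>h. 4 * Re K * (2 * H' h * hamiltonian \<rho> z0))) (at z0)"
      by (rule has_derivative_eq_rhs[OF has_derivative_mult_right[OF has_derivative_power[OF dH]]]) (simp add: fun_eq_iff)
    then have dF: "(F has_derivative (\<lambda>h. 4 * Re K * (2 * H' h * hamiltonian \<rho> z0))) (at z0)"
      by (simp add: FH[abs_def])
    have "1 * frechet_derivative F (at z0) v + (- 8 * Re K * hamiltonian \<rho> z0) * frechet_derivative (hamiltonian \<rho>) (at z0) v = 0" for v
      unfolding frechet_derivative_at[OF dF, symmetric] frechet_derivative_at[OF dH, symmetric] by simp
    then have "(1::real) = 0" using indep unfolding differentials_independent_def by blast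
    then show False by simp
  qed
  define m where "m = cmod \<beta>"
  have m: "m > 0" using \<open>\<beta> \<noteq> 0\<close> by (simp add: m_def)
  \<comment> \<open>With this d, \<beta> = - m (cnj d)^2, so the derivative of W is 2 m times that
    of the conformal factor along d and - 2 m times it along \<i> d. Hence half the conformal factor
    minus W / (4 m) is constant along d, and with plus along \<i> d.\<close>
  define d where "d = csqrt (- cnj \<beta> / of_real m)"
  have d1: "cmod d = 1" using m by (simp add: d_def norm_divide m_def)
  have d2: "d\<^sup>2 = - cnj \<beta> / of_real m" by (simp add: d_def)
  have dd: "d * cnj d = 1" using complex_norm_square[of d] d1 by simp
  have "(cnj d)\<^sup>2 = - \<beta> / of_real m" using arg_cong[OF d2, of cnj] by simp
  then have \<beta>d: "\<beta> = - of_real m * (cnj d)\<^sup>2" using m by simp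
  have Wd: "- 2 * \<beta> * cnj (dz \<Lambda> z) * d = of_real (2 * m) * cnj (d * dz \<Lambda> z)" for z
  proof -
    have "(cnj d)\<^sup>2 * d = cnj d" using dd by algebra
    then show ?thesis unfolding \<beta>d by simp
  qed
  have dW: "((\<lambda>z. Re (W z)) has_derivative (\<lambda>h. Re (- 2 * \<beta> * cnj (dz \<Lambda> z) * h + cnj (- 2 * \<beta> * cnj (dz \<Lambda> z)) * cnj h))) (at z)" for z
    by (rule has_derivative_Re_wirt[OF wW])
  have dL: "((\<lambda>z. Re (lift \<Lambda> z)) has_derivative (\<lambda>h. Re (dz \<Lambda> z * h + cnj (dz \<Lambda> z) * cnj h))) (at z)" for z
    by (rule has_derivative_Re_wirt[OF wL])
  have r: "Re (- 2 * \<beta> * cnj (dz \<Lambda> z) * h + cnj (- 2 * \<beta> * cnj (dz \<Lambda> z)) * cnj h) = 2 * Re (- 2 * \<beta> * cnj (dz \<Lambda> z) * h)"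
    "Re (dz \<Lambda> z * h + cnj (dz \<Lambda> z) * cnj h) = 2 * Re (dz \<Lambda> z * h)" for z h
    by (simp_all add: algebra_simps)
  have "separates (lift \<Lambda>) d UNIV"
  proof (rule separates_if_potentials[OF d1 convex_UNIV, where S = UNIV
        and ?f1.0 = "\<lambda>z. - inverse (4 * m) * Re (W z) + 1 / 2 * Re (lift \<Lambda> z)"
        and ?f2.0 = "\<lambda>z. inverse (4 * m) * Re (W z) + 1 / 2 * Re (lift \<Lambda> z)"])
    fix z
    define D1 where "D1 h = 2 * Re (- 2 * \<beta> * cnj (dz \<Lambda> z) * h)" for h
    define D2 where "D2 h = 2 * Re (dz \<Lambda> z * h)" for h
    have D: "((\<lambda>z. Re (W z)) has_derivative D1) (at z)" "((\<lambda>z. Re (lift \<Lambda> z)) has_derivative D2) (at z)"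
      using dW[of z] dL[of z] unfolding r D1_def[abs_def] D2_def[abs_def] by auto
    note F1 = has_derivative_add[OF has_derivative_mult_right[OF D(1), of "- inverse (4 * m)"] has_derivative_mult_right[OF D(2), of "1 / 2"]]
    have "D1 d = 2 * m * D2 d" unfolding D1_def D2_def Wd by simp
    then have "- inverse (4 * m) * D1 d + 1 / 2 * D2 d = 0" using m by (simp add: field_simps)
    with F1 show "\<exists>D. ((\<lambda>z. - inverse (4 * m) * Re (W z) + 1 / 2 * Re (lift \<Lambda> z)) has_derivative D) (at z) \<and> D d = 0"
      by (intro exI[of _ "\<lambda>h. - inverse (4 * m) * D1 h + 1 / 2 * D2 h"] conjI)
    note F2 = has_derivative_add[OF has_derivative_mult_right[OF D(1), of "inverse (4 * m)"] has_derivative_mult_right[OF D(2), of "1 / 2"]]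
    have "- 2 * \<beta> * cnj (dz \<Lambda> z) * (\<i> * d) = \<i> * (of_real (2 * m) * cnj (d * dz \<Lambda> z))"
      using Wd[of z] by (metis mult.commute mult.left_commute)
    then have "D1 (\<i> * d) = 2 * Re (\<i> * (of_real (2 * m) * cnj (d * dz \<Lambda> z)))" unfolding D1_def by (rule arg_cong)
    moreover have "D2 (\<i> * d) = 2 * Re (\<i> * (d * dz \<Lambda> z))" unfolding D2_def by (rule arg_cong[where f = "\<lambda>w. 2 * Re w"]) (simp only: ac_simps)
    moreover have "Re (\<i> * (of_real (2 * m) * cnj X)) = - (2 * m * Re (\<i> * X))" for X by simp
    ultimately have "D1 (\<i> * d) = - (2 * m * D2 (\<i> * d))" by (simp only: mult.left_commute mult_minus_right)
    then have "inverse (4 * m) * D1 (\<i> * d) + 1 / 2 * D2 (\<i> * d) = 0" using m by (simp add: field_simps)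
    with F2 show "\<exists>D. ((\<lambda>z. inverse (4 * m) * Re (W z) + 1 / 2 * Re (lift \<Lambda> z)) has_derivative D) (at z) \<and> D (\<i> * d) = 0"
      by (intro exI[of _ "\<lambda>h. inverse (4 * m) * D1 h + 1 / 2 * D2 h"] conjI)
    show "lift \<Lambda> z = of_real (- inverse (4 * m) * Re (W z) + 1 / 2 * Re (lift \<Lambda> z) + (inverse (4 * m) * Re (W z) + 1 / 2 * Re (lift \<Lambda> z)))"
      by (simp add: lift_def)
  qed auto
  then show ?thesis using d1 by blast
qed

text \<open>The set \<open>E\<close> of the quartic locale, named here because the periods needed to
  interpret that locale are only obtained inside a proof.\<close>

definition Ell :: "complex \<Rightarrow> complex set" where
  "Ell A = {z. \<exists>\<zeta>. cmod \<zeta> < 1 \<and> crit_poly A (Bc z) \<zeta> = 0}"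

lemma separates_Ell:
  assumes A: "\<And>z. Ac z = A" "A \<noteq> 0"
  shows "open (Ell A)"
    "Ell A \<noteq> {} \<Longrightarrow> \<exists>d. cmod d = 1 \<and> (\<forall>C. connected C \<and> C \<subseteq> Ell A \<longrightarrow> separates (lift \<Lambda>) d ((\<lambda>z. Im (z * cnj d)) ` C))"
proof -
  obtain o1 o2 where o: "Im (o1 * cnj o2) > 0" "V o1 \<in> \<Gamma>" "V o2 \<in> \<Gamma>"
    using lattice_periods[OF lattice] by metis
  interpret Q: conformal_quartic A "lift \<Lambda>" Bc Cc "dz \<Lambda>" "\<lambda>z. coeffB (\<lambda>k. dz (c k) z)"
    "\<lambda>z. coeffB (\<lambda>k. cnj (dz (c k) z))" "\<lambda>z. coeffC (\<lambda>k. dz (c k) z)" o1 o2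
  proof
    fix z
    show "wirt (lift \<Lambda>) (dz \<Lambda> z) (cnj (dz \<Lambda> z)) z" by (rule wirt_lift[OF smooth_\<Lambda>])
    show "wirt Bc (coeffB (\<lambda>k. dz (c k) z)) (coeffB (\<lambda>k. cnj (dz (c k) z))) z" by (rule wirt_coeffs)
    show "wirt Cc (coeffC (\<lambda>k. dz (c k) z)) (cnj (coeffC (\<lambda>k. dz (c k) z))) z"
      unfolding cnj_coeffC by (rule wirt_coeffs)
    show "C1 UNIV (dz \<Lambda>)" by (rule C1_dz[OF smooth_\<Lambda>])
    show "C1 UNIV (\<lambda>z. coeffB (\<lambda>k. dz (c k) z))" by (rule C1_coeff) (rule C1_dz[OF smooth_c])
    show "C1 UNIV (\<lambda>z. coeffB (\<lambda>k. cnj (dz (c k) z)))"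
      by (rule C1_coeff) (rule C1_cnj[OF C1_dz[OF smooth_c]])
    show "C1 UNIV (\<lambda>z. coeffC (\<lambda>k. dz (c k) z))" by (rule C1_coeff) (rule C1_dz[OF smooth_c])
    show "cnj (lift \<Lambda> z) = lift \<Lambda> z" "Re (lift \<Lambda> z) > 0" using pos_\<Lambda> by (simp_all add: lift_def)
    show "cnj (Cc z) = Cc z" by (rule cnj_Cc)
    show "lift \<Lambda> z * coeffB (\<lambda>k. dz (c k) z) + Bc z * dz \<Lambda> z + 4 * A * cnj (dz \<Lambda> z) = 0"
      using conformal_equations(2)[of z] by (simp add: wirt_A_zero[OF A(1)] A(1))
    show "lift \<Lambda> z * coeffC (\<lambda>k. dz (c k) z) + 2 * Cc z * dz \<Lambda> z + lift \<Lambda> z * coeffB (\<lambda>k. cnj (dz (c k) z))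
        + 3 * Bc z * cnj (dz \<Lambda> z) = 0" by (rule conformal_equations)
  qed (use o A(2) in \<open>auto simp: periodic_lifts\<close>)
  have E: "Ell A = Q.E" by (simp add: Ell_def Q.E_def)
  show "open (Ell A)" unfolding E by (rule Q.open_E)
  show "\<exists>d. cmod d = 1 \<and> (\<forall>C. connected C \<and> C \<subseteq> Ell A \<longrightarrow> separates (lift \<Lambda>) d ((\<lambda>z. Im (z * cnj d)) ` C))"
    if "Ell A \<noteq> {}" using Q.separates_elliptic that unfolding E .
qed

lemma Ell_periodic:
  assumes "V \<omega> \<in> \<Gamma>" "z \<in> Ell A"
  shows "z + \<omega> \<in> Ell A"
  using assms by (simp add: Ell_def periodic_lifts)

end

subsection \<open>Elliptic points in semi-geodesic coordinates\<close>

text \<open>This is the critical quartic at \<zeta> = (1 + I s) / (1 - I s) with denominators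
  cleared. For \<zeta> = exp (2 \<i> \<phi>), s is tan \<phi>, the slope of the momentum; the
  bracket on the right is the polynomial that governs the eigenvalues.\<close>

lemma critical_quartic_complex:
  fixes c0 c1 c2 c3 c4 s I :: complex
  assumes "I\<^sup>2 = - 1"
  shows "2 * (c0 - I * c1 - c2 + I * c3 + c4) * (1 + I * s) ^ 4
      + (4 * c0 - 2 * I * c1 - 2 * I * c3 - 4 * c4) * (1 + I * s) ^ 3 * (1 - I * s)
      - (4 * c0 + 2 * I * c1 + 2 * I * c3 - 4 * c4) * (1 + I * s) * (1 - I * s) ^ 3
      - 2 * (c0 + I * c1 - c2 - I * c3 + c4) * (1 - I * s) ^ 4
    = - 8 * I * (c1 + (2 * c2 - 4 * c0) * s + (3 * c3 - 3 * c1) * s\<^sup>2 + (4 * c4 - 2 * c2) * s ^ 3 - c3 * s ^ 4)"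
  using assms by algebra

lemma vector_4:
  "(vector [x, y, z, w] :: 'a::zero^4) $ 1 = x" "(vector [x, y, z, w] :: 'a::zero^4) $ 2 = y"
  "(vector [x, y, z, w] :: 'a::zero^4) $ 3 = z" "(vector [x, y, z, w] :: 'a::zero^4) $ 4 = w"
  unfolding vector_def by simp_all

text \<open>The entries of an eigenvector are eliminated row by row; the last one is not zero, since
  otherwise the rows with a 3 would annihilate the others. What remains is the characteristic
  equation in s, up to a power of a 3.\<close>

lemma quartic_matrix_eigenvalue:
  fixes a :: "nat \<Rightarrow> real" and \<mu> s :: complex
  assumes "\<mu> \<in> complex_eigenvalues (quartic_matrix a)" and a3: "a 3 \<noteq> 0"
  defines "s \<equiv> \<mu> / a 3"
  shows "a 1 + (2 * a 2 - 4 * a 0) * s + (3 * a 3 - 3 * a 1) * s\<^sup>2 + (4 * a 4 - 2 * a 2) * s ^ 3 - a 3 * s ^ 4 = 0"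
proof -
  obtain v where v: "v \<noteq> 0" "(\<chi> i j. complex_of_real (quartic_matrix a $ i $ j)) *v v = \<mu> *s v"
    using assms(1) unfolding complex_eigenvalues_def by blast
  have row: "(\<Sum>j\<in>UNIV. complex_of_real (quartic_matrix a $ i $ j) * v $ j) = \<mu> * v $ i" for i
    using arg_cong[OF v(2), of "\<lambda>x. x $ i"] by (simp add: matrix_vector_mult_def)
  have r: "a 1 * v $ 4 = \<mu> * v $ 1"
    "a 3 * v $ 1 + (2 * a 2 - 4 * a 0) * v $ 4 = \<mu> * v $ 2"
    "a 3 * v $ 2 + (3 * a 3 - 3 * a 1) * v $ 4 = \<mu> * v $ 3"
    "a 3 * v $ 3 + (4 * a 4 - 2 * a 2) * v $ 4 = \<mu> * v $ 4"
    using row[of 1] row[of 2] row[of 3] row[of 4] by (simp_all add: sum_4 quartic_matrix_def vector_4)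
  have a3': "complex_of_real (a 3) \<noteq> 0" using a3 by simp
  have "v $ 4 \<noteq> 0"
  proof
    assume 4: "v $ 4 = 0"
    then have "v $ 3 = 0" using r(4) a3' by simp
    then have "v $ 2 = 0" using r(3) 4 a3' by simp
    then have "v $ 1 = 0" using r(2) 4 a3' by simp
    with 4 \<open>v $ 3 = 0\<close> \<open>v $ 2 = 0\<close> have "v = 0" by (simp add: vec_eq_iff forall_4)
    with v(1) show False by simp
  qed
  have \<mu>: "\<mu> = a 3 * s" using a3' by (simp add: s_def)
  have "(complex_of_real (a 3)) ^ 3 * v $ 4 * (a 1 + (2 * a 2 - 4 * a 0) * s + (3 * a 3 - 3 * a 1) * s\<^sup>2 + (4 * a 4 - 2 * a 2) * s ^ 3 - a 3 * s ^ 4) = 0"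
    using r unfolding \<mu> by algebra
  then show ?thesis using a3' \<open>v $ 4 \<noteq> 0\<close> by (metis (no_types, lifting) mult_eq_0_iff power_eq_0_iff)
qed

text \<open>A non-real eigenvalue gives a non-real s, whose Cayley transform lies off the unit
  circle; if it lies outside, its reflection 1 / cnj \<zeta> is the root in the disc. The sign
  \<sigma> allows for either orientation of the semi-geodesic frame.\<close>

lemma elliptic_crit_root:
  fixes a :: "nat \<Rightarrow> real" and \<sigma> :: real
  assumes ell: "elliptic_matrix (quartic_matrix a)" and a3: "a 3 \<noteq> 0" and \<sigma>: "\<sigma>\<^sup>2 = 1"
  defines "A \<equiv> coeffA (\<lambda>k. of_real (\<sigma> ^ k * a k))" and "B \<equiv> coeffB (\<lambda>k. of_real (\<sigma> ^ k * a k))"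
  assumes A: "A \<noteq> 0"
  shows "\<exists>\<zeta>. cmod \<zeta> < 1 \<and> crit_poly A B \<zeta> = 0"
proof -
  obtain \<mu> where \<mu>: "\<mu> \<in> complex_eigenvalues (quartic_matrix a)" "\<mu> \<notin> \<real>"
    using ell unfolding elliptic_matrix_def by blast
  define s where "s = of_real \<sigma> * (\<mu> / a 3)"
  have \<sigma>0: "\<sigma> \<noteq> 0" using \<sigma> by auto
  have Ims: "Im s \<noteq> 0"
    using \<mu>(2) a3 \<sigma>0 by (simp add: s_def complex_is_Real_iff)
  have \<sigma>2: "(complex_of_real \<sigma>)\<^sup>2 = 1" using \<sigma> by (metis of_real_1 of_real_power)
  define c where "c k = complex_of_real (\<sigma> ^ k * a k)" for k
  have c: "c 0 = a 0" "c 1 = \<sigma> * a 1" "c 2 = a 2" "c 3 = \<sigma> * a 3" "c 4 = a 4"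
    using \<sigma> \<sigma>2 by (simp_all add: c_def power3_eq_cube power4_eq_xxxx power2_eq_square)
  have e: "c 1 + (2 * c 2 - 4 * c 0) * s + (3 * c 3 - 3 * c 1) * s\<^sup>2 + (4 * c 4 - 2 * c 2) * s ^ 3 - c 3 * s ^ 4 = 0"
  proof -
    define S where "S = \<mu> / a 3"
    have s: "s = \<sigma> * S" by (simp add: s_def S_def)
    have s2: "s\<^sup>2 = S\<^sup>2" unfolding s power_mult_distrib \<sigma>2 by simp
    have s34: "s ^ 3 = \<sigma> * S ^ 3" "s ^ 4 = S ^ 4" using \<sigma>2 unfolding s by algebra+
    have "c 1 + (2 * c 2 - 4 * c 0) * s + (3 * c 3 - 3 * c 1) * s\<^sup>2 + (4 * c 4 - 2 * c 2) * s ^ 3 - c 3 * s ^ 4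
        = \<sigma> * (a 1 + (2 * a 2 - 4 * a 0) * S + (3 * a 3 - 3 * a 1) * S\<^sup>2 + (4 * a 4 - 2 * a 2) * S ^ 3 - a 3 * S ^ 4)"
      unfolding s2 s34 unfolding c s by (simp add: algebra_simps)
    then show ?thesis unfolding S_def quartic_matrix_eigenvalue[OF \<mu>(1) a3] by simp
  qed
  have cA: "16 * A = c 0 - \<i> * c 1 - c 2 + \<i> * c 3 + c 4" "16 * B = 4 * c 0 - 2 * \<i> * c 1 - 2 * \<i> * c 3 - 4 * c 4"
    by (simp_all add: A_def B_def coeffA_def coeffB_def c_def)
  have cr: "cnj (c k) = c k" for k by (simp add: c_def)
  have cA': "16 * cnj A = c 0 + \<i> * c 1 - c 2 - \<i> * c 3 + c 4" "16 * cnj B = 4 * c 0 + 2 * \<i> * c 1 + 2 * \<i> * c 3 - 4 * c 4"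
    using arg_cong[OF cA(1), of cnj] arg_cong[OF cA(2), of cnj] by (simp_all add: cr)
  define X Y where "X = 1 + \<i> * s" and "Y = 1 - \<i> * s"
  have "16 * (2 * A * X ^ 4 + B * X ^ 3 * Y - cnj B * X * Y ^ 3 - 2 * cnj A * Y ^ 4)
      = 2 * (16 * A) * X ^ 4 + (16 * B) * X ^ 3 * Y - (16 * cnj B) * X * Y ^ 3 - 2 * (16 * cnj A) * Y ^ 4"
    by (simp add: algebra_simps)
  also have "\<dots> = 0" unfolding cA cA' X_def Y_def critical_quartic_complex[OF power2_i] e by simp
  finally have XY: "2 * A * X ^ 4 + B * X ^ 3 * Y - cnj B * X * Y ^ 3 - 2 * cnj A * Y ^ 4 = 0"
    unfolding mult_eq_0_iff[of 16] by simp
  have sum: "X + Y = 2" by (simp add: X_def Y_def)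
  \<comment> \<open>If Y were 0, then X = 2 and the equation would read 32 A = 0.\<close>
  have Y0: "Y \<noteq> 0" using XY sum A by auto
  define \<zeta> where "\<zeta> = X / Y"
  have root: "crit_poly A B \<zeta> = 0"
  proof -
    have "Y ^ 4 * crit_poly A B \<zeta> = 0"
      using XY Y0 unfolding crit_poly_def \<zeta>_def by (simp add: field_simps power3_eq_cube power4_eq_xxxx)
    then show ?thesis using Y0 by simp
  qed
  have \<zeta>0: "\<zeta> \<noteq> 0" using root A by (auto simp: crit_poly_def)
  have "(cmod X)\<^sup>2 \<noteq> (cmod Y)\<^sup>2" using Ims unfolding cmod_power2 X_def Y_def
    by (simp add: power2_eq_square algebra_simps)
  then have "cmod \<zeta> \<noteq> 1" using Y0 by (auto simp: \<zeta>_def norm_divide)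
  then consider "cmod \<zeta> < 1" | "cmod \<zeta> > 1" by linarith
  then show ?thesis
  proof cases
    case 1 then show ?thesis using root by blast
  next
    case 2
    have "crit_poly A B (inverse (cnj \<zeta>)) = - (inverse (cnj \<zeta>) ^ 4 * cnj (crit_poly A B \<zeta>))"
      using \<zeta>0 by (simp add: crit_poly_def field_simps power3_eq_cube power4_eq_xxxx)
    moreover have "cmod (inverse (cnj \<zeta>)) < 1" using 2 by (simp add: norm_inverse inverse_less_1_iff)
    ultimately show ?thesis using root by (intro exI[of _ "inverse (cnj \<zeta>)"]) simp
  qed
qed

text \<open>On the circle bundle \<zeta> is p / cnj p, so turning the momentum by k turns \<zeta> by
  k^2.\<close>

lemma crit_poly_rotate:
  assumes "cmod k = 1" "A = A' * k ^ 4" "B = B' * k\<^sup>2"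
  shows "crit_poly A B (\<zeta> / k\<^sup>2) = cnj k ^ 4 * crit_poly A' B' \<zeta>"
proof -
  have k: "k * cnj k = 1" using complex_norm_square[of k] assms(1) by simp
  have "k \<noteq> 0" using assms(1) by auto
  then have i: "\<zeta> / k\<^sup>2 = \<zeta> * (cnj k)\<^sup>2" using k by (simp add: field_simps) algebra
  show ?thesis unfolding i crit_poly_def assms(2,3) using k by simp algebra
qed

text \<open>j1 and j2 stand for the columns of the Jacobian. They are orthogonal of lengths h / sqrt
  l and 1 / sqrt l, hence, after dividing j1 by h, a scaled orthonormal frame; k is its rotation and
  \<sigma> its orientation.\<close>

lemma orthogonal_frame:
  fixes j1 j2 :: complex and l h :: real
  assumes "l > 0" "h > 0" "l * (cmod j1)\<^sup>2 = h\<^sup>2" "l * (cmod j2)\<^sup>2 = 1" "Re (j1 * cnj j2) = 0"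
  obtains k \<sigma> where "cmod k = 1" "\<sigma>\<^sup>2 = (1::real)"
    "\<And>p. Re (cnj j1 * p) / h = Re (k * p) / sqrt l" "\<And>p. Re (cnj j2 * p) = \<sigma> * Im (k * p) / sqrt l"
proof -
  define k where "k = of_real (sqrt l / h) * cnj j1"
  define k2 where "k2 = of_real (sqrt l) * cnj j2"
  have sl: "sqrt l > 0" "(sqrt l)\<^sup>2 = l" using assms(1) by auto
  have "(cmod k)\<^sup>2 = 1" "(cmod k2)\<^sup>2 = 1"
    using assms sl by (simp_all add: k_def k2_def norm_mult norm_divide power_mult_distrib power_divide)
  then have k: "cmod k = 1" "cmod k2 = 1"
    using norm_ge_zero[of k] norm_ge_zero[of k2] by (auto simp: power2_eq_1_iff)
  define \<sigma> where "\<sigma> = Im (k * cnj k2)"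
  have "Re (k * cnj k2) = sqrt l / h * sqrt l * Re (j1 * cnj j2)"
    by (simp add: k_def k2_def algebra_simps add_divide_distrib)
  then have re: "Re (k * cnj k2) = 0" using assms(5) by simp
  then have kk: "k * cnj k2 = \<i> * of_real \<sigma>" by (simp add: \<sigma>_def complex_eq_iff)
  have "cmod (k * cnj k2) = 1" using k by (simp add: norm_mult)
  then have \<sigma>: "\<sigma>\<^sup>2 = 1" unfolding kk by (simp add: norm_mult power2_eq_1_iff abs_if split: if_splits)
  have "k2 * cnj k2 = 1" using complex_norm_square[of k2] k by simp
  then have hk: "k = \<i> * of_real \<sigma> * k2" using kk by (metis mult.assoc mult.commute mult.right_neutral)
  have "(of_real \<sigma>)\<^sup>2 = (1 :: complex)" using \<sigma> by (metis of_real_1 of_real_power)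
  then have "- \<i> * of_real \<sigma> * (\<i> * of_real \<sigma> * k2) = k2" using power2_i by algebra
  then have k2: "k2 = - \<i> * of_real \<sigma> * k" unfolding hk[symmetric] by (rule sym)
  show ?thesis
  proof (rule that[OF k(1) \<sigma>])
    fix p
    show "Re (cnj j1 * p) / h = Re (k * p) / sqrt l" using sl assms(2) by (simp add: k_def field_simps)
    have "Re (k2 * p) = \<sigma> * Im (k * p)" unfolding k2 by (simp add: algebra_simps)
    moreover have "Re (k2 * p) = sqrt l * Re (cnj j2 * p)" by (simp add: k2_def algebra_simps)
    ultimately show "Re (cnj j2 * p) = \<sigma> * Im (k * p) / sqrt l" using sl by (simp add: field_simps)
  qed
qed

lemma conformal_form_rotate:
  assumes "cmod k = 1"
  shows "conformal_form A B C (k * p) = conformal_form (A * k ^ 4) (B * k\<^sup>2) C p"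
proof -
  have k: "k * cnj k = 1" using complex_norm_square[of k] assms by simp
  show ?thesis unfolding conformal_form_def using k by simp algebra
qed

context conformal_torus
begin

text \<open>On the fibre over \<Phi> y, the integral is written both in conformal and in
  semi-geodesic momenta. Uniqueness of the coefficients identifies (A, B) with (A', B') up to the
  rotation k and the factor l^2, so the root found for (A', B') can be turned back.\<close>

lemma elliptic_in_Ell:
  fixes a :: "nat \<Rightarrow> real^2 \<Rightarrow> real" and h :: real
  assumes A: "\<And>z. Ac z = A" "A \<noteq> 0"
    and pull: "pullback_metric \<Phi> \<rho> y = vector [vector [h\<^sup>2, 0], vector [0, 1]]" and h: "h > 0"
    and form: "\<And>p. let P = transpose (jacobian \<Phi> (at y)) *v p in
        F (\<Phi> y, p) = (\<Sum>k\<le>4. a k y * ((P$1) ^ (4 - k) / h ^ (4 - k)) * (P$2) ^ k)"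
    and a3: "a 3 y \<noteq> 0" and ell: "elliptic_matrix (quartic_matrix (\<lambda>k. a k y))"
  shows "cplx (\<Phi> y) \<in> Ell A"
proof -
  define z where "z = cplx (\<Phi> y)"
  have Vz: "V z = \<Phi> y" by (simp add: z_def)
  define l where "l = \<Lambda> (\<Phi> y)"
  have l: "l > 0" using pos_\<Lambda> by (simp add: l_def)
  define J where "J = jacobian \<Phi> (at y)"
  define j1 j2 where "j1 = Complex (J$1$1) (J$2$1)" and "j2 = Complex (J$1$2) (J$2$2)"
  have M: "transpose J ** (l *\<^sub>R mat 1) ** J = vector [vector [h\<^sup>2, 0], vector [0, 1]]"
    using pull unfolding pullback_metric_def \<rho> J_def l_def .
  have M': "l *\<^sub>R (transpose J ** J) = vector [vector [h\<^sup>2, 0], vector [0, 1]]"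
    using M by (simp add: matrix_scalar_ac scalar_matrix_assoc)
  have "l * (cmod j1)\<^sup>2 = h\<^sup>2" "l * (cmod j2)\<^sup>2 = 1" "l * Re (j1 * cnj j2) = 0"
    using arg_cong[OF M', of "\<lambda>N. N $ 1 $ 1"] arg_cong[OF M', of "\<lambda>N. N $ 2 $ 2"] arg_cong[OF M', of "\<lambda>N. N $ 1 $ 2"]
    unfolding cmod_power2 j1_def j2_def
    by (simp_all add: matrix_matrix_mult_def transpose_def sum_2 power2_eq_square)
  then obtain k \<sigma> where k: "cmod k = 1" "\<sigma>\<^sup>2 = (1::real)"
    "\<And>p. Re (cnj j1 * p) / h = Re (k * p) / sqrt l" "\<And>p. Re (cnj j2 * p) = \<sigma> * Im (k * p) / sqrt l"
    using orthogonal_frame[OF l h, of j1 j2] l by auto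
  define b where "b i = \<sigma> ^ i * a i y" for i
  define A' B' C' where "A' = coeffA (\<lambda>k. of_real (b k))" and "B' = coeffB (\<lambda>k. of_real (b k))" and "C' = coeffC (\<lambda>k. of_real (b k))"
  have sl: "sqrt l ^ 4 = l\<^sup>2" using l by (metis power_even_eq[of "sqrt l" 2] real_sqrt_pow2 less_imp_le mult_2 numeral_Bit0)
  have eq: "F (V z, V p) * l\<^sup>2 = quartic_form b (Re (k * p)) (Im (k * p))" for p
  proof -
    define P where "P = transpose J *v V p"
    have P: "P $ 1 = Re (cnj j1 * p)" "P $ 2 = Re (cnj j2 * p)"
      by (simp_all add: P_def matrix_vector_mult_def transpose_def sum_2 j1_def j2_def)
    have "F (V z, V p) = quartic_form (\<lambda>k. a k y) (P $ 1 / h) (P $ 2)"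
      using form[of "V p"] unfolding Let_def quartic_form_def Vz P_def J_def by (simp add: power_divide)
    also have "\<dots> = quartic_form b (Re (k * p)) (Im (k * p)) / sqrt l ^ 4"
      unfolding P k quartic_form_def b_def sum_divide_distrib
    proof (rule sum.cong[OF refl])
      fix i :: nat assume i: "i \<in> {..4}"
      have "sqrt l ^ 4 = sqrt l ^ (4 - i) * sqrt l ^ i" using i by (simp flip: power_add)
      then show "a i y * (Re (k * p) / sqrt l) ^ (4 - i) * (\<sigma> * Im (k * p) / sqrt l) ^ i
          = \<sigma> ^ i * a i y * Re (k * p) ^ (4 - i) * Im (k * p) ^ i / sqrt l ^ 4"
        by (simp add: power_divide power_mult_distrib)
    qed
    finally show ?thesis using l unfolding sl by simp
  qed
  have "conformal_form (A * of_real (l\<^sup>2)) (Bc z * of_real (l\<^sup>2)) (Cc z * of_real (l\<^sup>2)) p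
      = conformal_form (A' * k ^ 4) (B' * k\<^sup>2) C' p" for p
  proof -
    have "conformal_form (A * of_real (l\<^sup>2)) (Bc z * of_real (l\<^sup>2)) (Cc z * of_real (l\<^sup>2)) p = of_real (F (V z, V p)) * of_real (l\<^sup>2)"
      unfolding F_conformal A(1) conformal_form_def by (simp add: algebra_simps)
    also have "\<dots> = of_real (quartic_form b (Re (k * p)) (Im (k * p)))" unfolding eq[symmetric] by simp
    also have "\<dots> = conformal_form A' B' C' (k * p)"
      unfolding quartic_form_conformal A'_def B'_def C'_def complex_surj ..
    finally show ?thesis unfolding conformal_form_rotate[OF k(1)] .
  qed
  from conformal_form_unique[OF this]
  have AB: "A * of_real (l\<^sup>2) = A' * k ^ 4" "Bc z * of_real (l\<^sup>2) = B' * k\<^sup>2"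
    by (simp_all add: cnj_Cc C'_def cnj_coeffC)
  have "A' \<noteq> 0" using AB(1) A(2) l by auto
  then obtain \<zeta> where \<zeta>: "cmod \<zeta> < 1" "crit_poly A' B' \<zeta> = 0"
    using elliptic_crit_root[OF ell a3 k(2)] unfolding A'_def B'_def b_def by blast
  have "crit_poly (A * of_real (l\<^sup>2)) (Bc z * of_real (l\<^sup>2)) (\<zeta> / k\<^sup>2) = 0"
    unfolding crit_poly_rotate[OF k(1) AB] \<zeta>(2) by simp
  then have "of_real (l\<^sup>2) * crit_poly A (Bc z) (\<zeta> / k\<^sup>2) = 0"
    unfolding crit_poly_def by (simp add: algebra_simps)
  then have "crit_poly A (Bc z) (\<zeta> / k\<^sup>2) = 0" using l by simp
  moreover have "cmod (\<zeta> / k\<^sup>2) < 1" using \<zeta>(1) k(1) by (simp add: norm_divide norm_power)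
  ultimately show ?thesis unfolding z_def[symmetric] Ell_def by blast
qed

end

subsection \<open>Functions of one variable\<close>

lemma smooth_on_line:
  fixes f :: "real^2 \<Rightarrow> real"
  assumes "smooth f"
  shows "smooth_on (\<lambda>x. f (p + x *\<^sub>R n) + k) S"
proof -
  have line: "((\<lambda>x. g (p + x *\<^sub>R n)) has_derivative (\<lambda>v. v * frechet_derivative g (at (p + x *\<^sub>R n)) n)) (at x)"
    if "g differentiable (at (p + x *\<^sub>R n))" for g :: "real^2 \<Rightarrow> real" and x
  proof -
    have "((\<lambda>x. p + x *\<^sub>R n) has_derivative (\<lambda>v. v *\<^sub>R n)) (at x)" by (auto intro!: derivative_eq_intros)
    from has_derivative_compose[OF this frechet_derivative_works[THEN iffD1, OF that]]
    show ?thesis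
      by (rule has_derivative_eq_rhs)
         (simp add: fun_eq_iff linear_cmul[OF linear_frechet_derivative[OF that]])
  qed
  \<comment> \<open>The scalar c is carried along because each derivative in a direction v
    contributes the factor v.\<close>
  have Ck: "Ck_on m (\<lambda>x. c * g (p + x *\<^sub>R n)) S" if "smooth g" for m c and g :: "real^2 \<Rightarrow> real"
    using that
  proof (induction m arbitrary: g c)
    case 0
    have "continuous_on S (\<lambda>x. g (p + x *\<^sub>R n))"
      by (rule continuous_on_compose2[OF smoothD(3)[OF 0]]) (auto intro!: continuous_intros)
    then show ?case by (auto intro!: continuous_intros)
  next
    case (Suc m)
    have d: "((\<lambda>x. c * g (p + x *\<^sub>R n)) has_derivative (\<lambda>v. c * (v * frechet_derivative g (at (p + x *\<^sub>R n)) n))) (at x)" for x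
      by (intro has_derivative_mult_right line smoothD(1)[OF Suc.prems])
    have "(\<lambda>x. frechet_derivative (\<lambda>x. c * g (p + x *\<^sub>R n)) (at x) v) = (\<lambda>x. (c * v) * frechet_derivative g (at (p + x *\<^sub>R n)) n)" for v
      using frechet_derivative_at[OF d] by (simp add: fun_eq_iff mult.assoc)
    then show ?case
      using Suc.IH[OF smoothD(2)[OF Suc.prems]] differentiableI[OF d] by auto
  qed
  show ?thesis unfolding smooth_on_def
  proof
    fix m
    show "Ck_on m (\<lambda>x. f (p + x *\<^sub>R n) + k) S"
    proof (cases m)
      case 0
      have "continuous_on S (\<lambda>x. f (p + x *\<^sub>R n))"
        by (rule continuous_on_compose2[OF smoothD(3)[OF assms]]) (auto intro!: continuous_intros)
      then show ?thesis unfolding 0 by (auto intro!: continuous_intros)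
    next
      case (Suc m')
      have d: "((\<lambda>x. f (p + x *\<^sub>R n) + k) has_derivative (\<lambda>v. v * frechet_derivative f (at (p + x *\<^sub>R n)) n)) (at x)" for x
        using has_derivative_add[OF line[OF smoothD(1)[OF assms], of x] has_derivative_const[of k]] by simp
      have "(\<lambda>x. frechet_derivative (\<lambda>x. f (p + x *\<^sub>R n) + k) (at x) v) = (\<lambda>x. v * frechet_derivative f (at (p + x *\<^sub>R n)) n)" for v
        using frechet_derivative_at[OF d] by (simp add: fun_eq_iff)
      then show ?thesis
        using Ck[OF smoothD(2)[OF assms]] differentiableI[OF d] unfolding Suc by auto
    qed
  qed
qed

lemma V_frame: "V (frame d u v) = (v *\<^sub>R V d) + u *\<^sub>R V (\<i> * d)" "V (frame d u v) = u *\<^sub>R V (\<i> * d) + v *\<^sub>R V d"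
  by (simp_all add: vec_eq_iff forall_2 frame_def)

text \<open>The mixed difference against (u0, 0) gives f (u, v) = (f (u, 0) - f (u0, 0)) + f (u0,
  v). The summands are restrictions of f to full lines, hence smooth on the whole real line.\<close>

lemma separated_along_if_separates:
  assumes f: "smooth f" and d: "cmod d = 1" and sep: "separates (lift f) d J"
    and S: "\<And>q. q \<in> S \<Longrightarrow> Im (cplx q * cnj d) \<in> J" "S \<noteq> {}"
  shows "separated_along f (- Im d) (Re d) (Re d) (Im d) S"
proof -
  obtain q0 where q0: "q0 \<in> S" using S(2) by auto
  define u0 where "u0 = Im (cplx q0 * cnj d)"
  define g1 where "g1 x = f (0 + x *\<^sub>R V (\<i> * d)) + (- f (V (frame d u0 0)))" for x
  define g2 where "g2 x = f (u0 *\<^sub>R V (\<i> * d) + x *\<^sub>R V d) + 0" for x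
  have "f q = g1 (- Im d * q$1 + Re d * q$2) + g2 (Re d * q$1 + Im d * q$2)" if q: "q \<in> S" for q
  proof -
    define u v where "u = Im (cplx q * cnj d)" and "v = Re (cplx q * cnj d)"
    have uv: "- Im d * q$1 + Re d * q$2 = u" "Re d * q$1 + Im d * q$2 = v"
      by (simp_all add: u_def v_def cplx_def)
    have qf: "V (frame d u v) = q" unfolding u_def v_def frame_coords(1)[OF d] by simp
    have "lift f (frame d u v) + lift f (frame d u0 0) = lift f (frame d u 0) + lift f (frame d u0 v)"
      using sep S(1)[OF q] S(1)[OF q0] unfolding separates_def u_def u0_def by blast
    then have "f (V (frame d u v)) + f (V (frame d u0 0)) = f (V (frame d u 0)) + f (V (frame d u0 v))"
      unfolding lift_def by (metis of_real_add of_real_eq_iff)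
    then show ?thesis unfolding uv g1_def g2_def by (simp add: qf V_frame(2)) (simp add: qf V_frame(2)[symmetric])
  qed
  then show ?thesis unfolding separated_along_def
    using smooth_on_line[OF f] unfolding g1_def[abs_def] g2_def[abs_def] by blast
qed

lemma orthogonal_directions_frame:
  assumes "cmod d = 1" shows "orthogonal_directions (- Im d) (Re d) (Re d) (Im d)"
proof -
  have "d \<noteq> 0" using assms by auto
  then show ?thesis by (auto simp: orthogonal_directions_def complex_eq_iff)
qed

subsection \<open>Analytic continuation\<close>

text \<open>The double series is regrouped along the diagonals i + j = k, which unconditional
  summation permits. Dividing r by norm n + 1 keeps the points in the ball, also for n = 0.\<close>

lemma real_analytic_line:
  assumes f: "real_analytic f"
  shows "\<exists>r>0. \<exists>a. \<forall>t. \<bar>t - t0\<bar> < r \<longrightarrow> (\<lambda>k. a k * (t - t0) ^ k) sums f (p + t *\<^sub>R n)"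
proof -
  define x where "x = p + t0 *\<^sub>R n"
  obtain r c where r: "r > 0" and c: "\<And>y. y \<in> ball x r \<Longrightarrow>
      ((\<lambda>(i, j). c i j * (y$1 - x$1) ^ i * (y$2 - x$2) ^ j) has_sum f y) UNIV"
    using f unfolding real_analytic_def by meson
  define R where "R = r / (norm n + 1)"
  have n1: "norm n + 1 > 0" by (smt (verit) norm_ge_zero)
  have R: "R > 0" using r n1 by (simp add: R_def)
  define a where "a k = (\<Sum>i\<le>k. c i (k - i) * (n$1) ^ i * (n$2) ^ (k - i))" for k
  have "(\<lambda>k. a k * (t - t0) ^ k) sums f (p + t *\<^sub>R n)" if t: "\<bar>t - t0\<bar> < R" for t
  proof -
    define y where "y = p + t *\<^sub>R n"
    define \<tau> where "\<tau> = t - t0"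
    have yx: "y - x = \<tau> *\<^sub>R n" by (simp add: y_def x_def \<tau>_def algebra_simps)
    have "norm (y - x) = \<bar>\<tau>\<bar> * norm n" unfolding yx by simp
    also have "\<dots> \<le> \<bar>\<tau>\<bar> * (norm n + 1)" by (intro mult_left_mono) auto
    also have "\<dots> < R * (norm n + 1)" using t n1 by (simp add: \<tau>_def)
    also have "\<dots> = r" using n1 by (simp add: R_def)
    finally have "y \<in> ball x r" by (simp add: dist_norm norm_minus_commute)
    from c[OF this] have "((\<lambda>(i, j). c i j * (\<tau> * n$1) ^ i * (\<tau> * n$2) ^ j) has_sum f y) UNIV"
      using arg_cong[OF yx, of "\<lambda>v. v$1"] arg_cong[OF yx, of "\<lambda>v. v$2"] by simp
    moreover have bij: "bij_betw (\<lambda>(k, i). (i, k - i)) (Sigma UNIV (\<lambda>k::nat. {..k})) UNIV"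
      by (rule bij_betwI[where g = "\<lambda>(i, j). (i + j, i)"]) auto
    ultimately have "((\<lambda>ki. case (case ki of (k, i) \<Rightarrow> (i, k - i)) of (i, j) \<Rightarrow> c i j * (\<tau> * n$1) ^ i * (\<tau> * n$2) ^ j)
        has_sum f y) (Sigma UNIV (\<lambda>k::nat. {..k}))"
      using has_sum_reindex_bij_betw[OF bij, of "\<lambda>(i, j). c i j * (\<tau> * n$1) ^ i * (\<tau> * n$2) ^ j" "f y"] by simp
    then have "((\<lambda>(k, i). c i (k - i) * (\<tau> * n$1) ^ i * (\<tau> * n$2) ^ (k - i)) has_sum f y) (Sigma UNIV (\<lambda>k::nat. {..k}))"
      by (simp add: case_prod_unfold)
    note sigma = this
    have "((\<lambda>k. a k * \<tau> ^ k) has_sum f y) UNIV"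
    proof (rule has_sum_SigmaD[OF sigma])
      fix k :: nat
      have "(\<Sum>i\<le>k. c i (k - i) * (\<tau> * n$1) ^ i * (\<tau> * n$2) ^ (k - i)) = a k * \<tau> ^ k"
        unfolding a_def sum_distrib_right
        by (rule sum.cong) (auto simp: power_mult_distrib simp flip: power_add)
      then show "((\<lambda>i. case (k, i) of (k, i) \<Rightarrow> c i (k - i) * (\<tau> * n$1) ^ i * (\<tau> * n$2) ^ (k - i)) has_sum a k * \<tau> ^ k) {..k}"
        by (simp add: has_sum_finiteI)
    qed
    then show ?thesis unfolding y_def \<tau>_def by (rule has_sum_imp_sums)
  qed
  then show ?thesis using R by blast
qed

text \<open>The interior of the zero set is closed: where zeros accumulate, a non-zero higher
  coefficient would isolate them, so only the constant term is left, and it vanishes by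
  continuity.\<close>

lemma power_series_identity:
  fixes h :: "real \<Rightarrow> real"
  assumes ps: "\<And>u. \<exists>r>0. \<exists>a. \<forall>t. \<bar>t - u\<bar> < r \<longrightarrow> (\<lambda>k. a k * (t - u) ^ k) sums h t"
    and cont: "continuous_on UNIV h"
    and ab: "a < b" "\<And>t. t \<in> {a<..<b} \<Longrightarrow> h t = 0"
  shows "h t = 0"
proof -
  define S where "S = {u. \<exists>e>0. \<forall>t. \<bar>t - u\<bar> < e \<longrightarrow> h t = 0}"
  have "open S"
  proof (rule open_subopen[THEN iffD2], rule ballI)
    fix u assume "u \<in> S"
    then obtain e where e: "e > 0" "\<And>t. \<bar>t - u\<bar> < e \<Longrightarrow> h t = 0" by (auto simp: S_def)
    have "ball u (e/2) \<subseteq> S"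
    proof
      fix v assume "v \<in> ball u (e/2)"
      then show "v \<in> S" unfolding S_def using e
        by (intro CollectI exI[of _ "e/2"]) (auto simp: dist_real_def abs_if split: if_splits intro!: e(2))
    qed
    then show "\<exists>T. open T \<and> u \<in> T \<and> T \<subseteq> S" using e(1) by (intro exI[of _ "ball u (e/2)"]) auto
  qed
  moreover have "closed S"
    unfolding closed_limpt
  proof (intro allI impI)
    fix u assume u: "u islimpt S"
    have near: "\<exists>v. v \<noteq> u \<and> \<bar>v - u\<bar> < e \<and> h v = 0" if e: "e > 0" for e
    proof -
      obtain v where v: "v \<in> S" "v \<noteq> u" "dist v u < e" using u e unfolding islimpt_approachable by blast
      then have "h v = 0" unfolding S_def by force
      then show ?thesis using v by (auto simp: dist_real_def)
    qed
    have hu: "h u = 0"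
    proof (rule ccontr)
      assume "h u \<noteq> 0"
      moreover have "isCont h u" using cont by (simp add: continuous_on_eq_continuous_at)
      ultimately obtain e where "e > 0" "\<And>v. dist u v < e \<Longrightarrow> h v \<noteq> 0"
        using continuous_at_avoid[of u h 0] by blast
      then show False using near[of e] by (auto simp: dist_real_def abs_minus_commute)
    qed
    obtain r a where r: "r > 0" "\<And>t. \<bar>t - u\<bar> < r \<Longrightarrow> (\<lambda>k. a k * (t - u) ^ k) sums h t"
      using ps[of u] by blast
    show "u \<in> S"
    proof (cases "\<exists>m>0. a m \<noteq> 0")
      case True
      then obtain m where m: "a m \<noteq> 0" "m > 0" by blast
      obtain s where s: "0 < s" "\<And>z. z \<in> cball u s - {u} \<Longrightarrow> h z \<noteq> 0"
        using powser_0_nonzero[of r u a h m] r hu m by (auto simp: real_norm_def)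
      obtain v where "v \<noteq> u" "\<bar>v - u\<bar> < s" "h v = 0" using near[OF s(1)] by blast
      then have False using s(2)[of v] by (auto simp: dist_real_def abs_minus_commute)
      then show ?thesis ..
    next
      case False
      then have a0: "a k = 0" if "k \<noteq> 0" for k using that by blast
      have "h t = 0" if "\<bar>t - u\<bar> < r" for t
      proof -
        have "(\<lambda>k. a k * (t - u) ^ k) = (\<lambda>k. if k = 0 then a 0 else 0)" using a0 by (auto simp: fun_eq_iff)
        then have "h t = a 0" using sums_unique2[OF r(2)[OF that]] sums_single[of 0 "\<lambda>k. a 0"] by simp
        moreover have "(\<lambda>k. a k * (u - u) ^ k) = (\<lambda>k. if k = 0 then a 0 else 0)" by auto
        then have "h u = a 0" using sums_unique2[OF r(2)[of u]] sums_single[of 0 "\<lambda>k. a 0"] r(1) by simp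
        ultimately show ?thesis using hu by simp
      qed
      then show ?thesis using r(1) by (auto simp: S_def)
    qed
  qed
  moreover have "(a + b) / 2 \<in> S"
    unfolding S_def using ab by (intro CollectI exI[of _ "(b - a) / 2"]) (auto intro!: ab(2) simp: abs_less_iff field_simps)
  ultimately have "S = UNIV" using clopen by blast
  then have "t \<in> S" by simp
  then show ?thesis by (auto simp: S_def)
qed

text \<open>For fixed v and v', the difference of f at (u, v) and (u, v') is locally a power series
  in u. It does not depend on u in (a, b), hence nowhere.\<close>

lemma separates_continuation:
  assumes f: "real_analytic f" "smooth f" and sep: "separates (lift f) d J" and J: "{a<..<b} \<subseteq> J" "a < b"
  shows "separates (lift f) d UNIV"
proof -
  define u0 where "u0 = (a + b) / 2"
  have u0: "u0 \<in> {a<..<b}" using J(2) by (simp add: u0_def field_simps)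
  have key: "f (V (frame d u v)) - f (V (frame d u v')) = f (V (frame d u0 v)) - f (V (frame d u0 v'))" for u v v'
  proof -
    define k where "k = f (V (frame d u0 v)) - f (V (frame d u0 v'))"
    define h where "h u = f (v *\<^sub>R V d + u *\<^sub>R V (\<i> * d)) - f (v' *\<^sub>R V d + u *\<^sub>R V (\<i> * d)) - k" for u
    have "h u = 0"
    proof (rule power_series_identity[where a = a and b = b and h = h and t = u])
      fix u
      obtain r1 a1 where 1: "r1 > 0" "\<And>t. \<bar>t - u\<bar> < r1 \<Longrightarrow> (\<lambda>i. a1 i * (t - u) ^ i) sums f (v *\<^sub>R V d + t *\<^sub>R V (\<i> * d))"
        using real_analytic_line[OF f(1), of u "v *\<^sub>R V d" "V (\<i> * d)"] by blast
      obtain r2 a2 where 2: "r2 > 0" "\<And>t. \<bar>t - u\<bar> < r2 \<Longrightarrow> (\<lambda>i. a2 i * (t - u) ^ i) sums f (v' *\<^sub>R V d + t *\<^sub>R V (\<i> * d))"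
        using real_analytic_line[OF f(1), of u "v' *\<^sub>R V d" "V (\<i> * d)"] by blast
      have "(\<lambda>i. (a1 i - a2 i - (if i = 0 then k else 0)) * (t - u) ^ i) sums h t" if "\<bar>t - u\<bar> < min r1 r2" for t
      proof -
        have "(\<lambda>i. if i = 0 then k else 0) sums k" using sums_single[of 0 "\<lambda>_. k"] by simp
        from sums_diff[OF sums_diff[OF 1(2) 2(2)] this, of t] that
        have "(\<lambda>i. a1 i * (t - u) ^ i - a2 i * (t - u) ^ i - (if i = 0 then k else 0)) sums h t" by (simp add: h_def)
        moreover have "(\<lambda>i. a1 i * (t - u) ^ i - a2 i * (t - u) ^ i - (if i = 0 then k else 0))
            = (\<lambda>i. (a1 i - a2 i - (if i = 0 then k else 0)) * (t - u) ^ i)" by (auto simp: fun_eq_iff algebra_simps)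
        ultimately show ?thesis by simp
      qed
      then show "\<exists>r>0. \<exists>a. \<forall>t. \<bar>t - u\<bar> < r \<longrightarrow> (\<lambda>k. a k * (t - u) ^ k) sums h t"
        using 1(1) 2(1) by (intro exI[of _ "min r1 r2"] conjI exI[of _ "\<lambda>i. a1 i - a2 i - (if i = 0 then k else 0)"]) auto
    next
      have "continuous_on UNIV (\<lambda>u. f (x + u *\<^sub>R y))" for x y
        by (rule continuous_on_compose2[OF smoothD(3)[OF f(2)]]) (auto intro!: continuous_intros)
      then show "continuous_on UNIV h" unfolding h_def by (intro continuous_intros)
    next
      fix t assume t: "t \<in> {a<..<b}"
      have "lift f (frame d t v) + lift f (frame d u0 v') = lift f (frame d t v') + lift f (frame d u0 v)"
        using sep t u0 J(1) unfolding separates_def by blast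
      then have "f (V (frame d t v)) + f (V (frame d u0 v')) = f (V (frame d t v')) + f (V (frame d u0 v))"
        unfolding lift_def by (metis of_real_add of_real_eq_iff)
      then show "h t = 0" unfolding h_def k_def V_frame(1)[symmetric] by simp
    qed (rule J)
    then show ?thesis unfolding h_def k_def V_frame(1)[symmetric] by simp
  qed
  show ?thesis unfolding separates_def lift_def
  proof (intro ballI allI)
    fix u u' v v'
    have "f (V (frame d u v)) + f (V (frame d u' v')) = f (V (frame d u v')) + f (V (frame d u' v))"
      using key[of u v v'] key[of u' v v'] by simp
    then show "complex_of_real (f (V (frame d u v))) + of_real (f (V (frame d u' v'))) = of_real (f (V (frame d u v'))) + of_real (f (V (frame d u' v)))"
      by (metis of_real_add)
  qed
qed

lemma open_contains_strip:
  assumes "open E" "E \<noteq> {}" and d: "cmod d = 1"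
  obtains C a b where "connected C" "C \<subseteq> E" "a < b" "{a<..<b} \<subseteq> (\<lambda>z. Im (z * cnj d)) ` C"
proof -
  obtain z0 e where z0: "e > 0" "ball z0 e \<subseteq> E" using assms(1,2) by (meson all_not_in_conv openE)
  define u v where "u = Im (z0 * cnj d)" and "v = Re (z0 * cnj d)"
  have "{u - e<..<u + e} \<subseteq> (\<lambda>z. Im (z * cnj d)) ` ball z0 e"
  proof
    fix t assume t: "t \<in> {u - e<..<u + e}"
    have "z0 = frame d u v" unfolding u_def v_def frame_coords(1)[OF d] ..
    then have "frame d t v - z0 = of_real (t - u) * (\<i> * d)" by (simp add: frame_def algebra_simps)
    then have "cmod (frame d t v - z0) = \<bar>t - u\<bar>" using d by (simp add: norm_mult del: of_real_diff)
    then have "frame d t v \<in> ball z0 e" using t by (auto simp: dist_norm norm_minus_commute)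
    then show "t \<in> (\<lambda>z. Im (z * cnj d)) ` ball z0 e"
      using frame_coords(2)[OF d, of t v] by (metis image_eqI)
  qed
  then show ?thesis using that[of "ball z0 e" "u - e" "u + e"] z0 by simp
qed

section \<open>Proof of the theorem on the torus\<close>

lemma smooth_bounded_linear:
  fixes f :: "'a::real_normed_vector \<Rightarrow> 'b::real_normed_vector" and T :: "'b \<Rightarrow> 'c::real_normed_vector"
  assumes "bounded_linear T" "smooth f"
  shows "smooth (\<lambda>x. T (f x))"
proof -
  have "Ck_on k (\<lambda>x. T (f x)) UNIV" if "smooth f" for k and f :: "'a \<Rightarrow> 'b"
    using that
  proof (induction k arbitrary: f)
    case 0
    then show ?case
      using bounded_linear.continuous_on[OF assms(1) smoothD(3)[OF 0]] by simp
  next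
    case (Suc k)
    have d: "((\<lambda>x. T (f x)) has_derivative (\<lambda>v. T (frechet_derivative f (at x) v))) (at x)" for x
      using bounded_linear.has_derivative[OF assms(1) frechet_derivative_works[THEN iffD1, OF smoothD(1)[OF Suc.prems]]] .
    have "(\<lambda>x. frechet_derivative (\<lambda>x. T (f x)) (at x) v) = (\<lambda>x. T (frechet_derivative f (at x) v))" for v
      using frechet_derivative_at[OF d] by (simp add: fun_eq_iff)
    then show ?case
      using Suc.IH[OF smoothD(2)[OF Suc.prems]] differentiableI[OF d] by auto
  qed
  then show ?thesis using assms(2) by (simp add: smooth_on_def)
qed

theorem corollary2:
  fixes \<Gamma> :: "(real^2) set"
    and \<rho> :: "real^2 \<Rightarrow> real^2^2" and \<Lambda> :: "real^2 \<Rightarrow> real"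
    and F :: "(real^2) \<times> (real^2) \<Rightarrow> real" and L :: "((real^2) \<times> (real^2)) set"
    and \<Phi> :: "real^2 \<Rightarrow> real^2" and g :: "real^2 \<Rightarrow> real" and a :: "nat \<Rightarrow> real^2 \<Rightarrow> real"
    and \<Omega> :: "(real^2) set set"
  assumes lattice: "is_lattice \<Gamma>"
    and metric: "torus_metric \<Gamma> \<rho>"
    and conformal: "\<And>q. \<Lambda> q > 0" "\<And>q. \<rho> q = \<Lambda> q *\<^sub>R mat 1"
    and quartic: "momentum_polynomial \<Gamma> 4 F"
    and integral: "first_integral \<rho> F"
    and coordinates: "normalized_semigeodesic_coordinates \<Gamma> \<rho> F 4 L \<Phi> g a"
    and region: "elliptic_region \<Gamma> \<Phi> a \<Omega>"
  shows "(flat_on \<rho> (torus_proj \<Gamma> -` \<Omega>) \<or>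
          (\<exists>m\<^sub>1 n\<^sub>1 m\<^sub>2 n\<^sub>2. orthogonal_directions m\<^sub>1 n\<^sub>1 m\<^sub>2 n\<^sub>2 \<and>
             (\<forall>C\<in>lifts \<Gamma> \<Omega>. separated_along \<Lambda> m\<^sub>1 n\<^sub>1 m\<^sub>2 n\<^sub>2 C))) \<and>
         (real_analytic_metric \<rho> \<longrightarrow>
          (\<exists>m\<^sub>1 n\<^sub>1 m\<^sub>2 n\<^sub>2. orthogonal_directions m\<^sub>1 n\<^sub>1 m\<^sub>2 n\<^sub>2 \<and>
             separated_along \<Lambda> m\<^sub>1 n\<^sub>1 m\<^sub>2 n\<^sub>2 UNIV))"
proof -
  obtain c where c: "\<And>k. k \<le> 4 \<Longrightarrow> smooth (c k)" "\<And>k. k \<le> 4 \<Longrightarrow> periodic \<Gamma> (c k)"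
    "\<And>q p. F (q, p) = (\<Sum>k\<le>4. c k q * (p$1) ^ (4 - k) * (p$2) ^ k)"
    using quartic unfolding momentum_polynomial_def by blast
  have \<rho>11: "\<rho> q $ 1 $ 1 = \<Lambda> q" for q unfolding conformal(2) by (simp add: mat_def)
  have smooth: "smooth \<Lambda>"
    using smooth_bounded_linear[OF bounded_linear_compose[OF bounded_linear_vec_nth[of 1] bounded_linear_vec_nth[of 1]], of \<rho>]
      metric unfolding torus_metric_def \<rho>11 by simp
  have periodic: "periodic \<Gamma> \<Lambda>"
    using metric unfolding torus_metric_def periodic_def \<rho>11[symmetric] by simp
  interpret conformal_torus \<Gamma> \<rho> \<Lambda> F c
    by unfold_locales (use lattice smooth periodic conformal c integral in \<open>auto simp: quartic_form_def\<close>)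
  have coords: "liouville_torus_graph \<Gamma> \<rho> F L" "bij \<Phi>" "\<And>y. g y > 0"
    "\<And>y. pullback_metric \<Phi> \<rho> y = vector [vector [(g y)\<^sup>2, 0], vector [0, 1]]"
    "\<And>y p. let P = transpose (jacobian \<Phi> (at y)) *v p in
        F (\<Phi> y, p) = (\<Sum>k\<le>4. a k y * ((P$1) ^ (4 - k) / (g y) ^ (4 - k)) * (P$2) ^ k)"
    and a3: "\<And>y. a 3 y = g y"
    using coordinates
    unfolding normalized_semigeodesic_coordinates_def semigeodesic_coordinates_def global_coordinates_def by auto
  obtain z0 where z0: "differentials_independent F (hamiltonian \<rho>) z0"
    using coords(1) unfolding liouville_torus_graph_def by blast
  have region': "\<Omega> \<noteq> {}" "\<Omega> \<subseteq> elliptic_set \<Gamma> \<Phi> a"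
    using nonempty_connected_components_of[OF region[unfolded elliptic_region_def]]
      connected_components_of_subset[OF region[unfolded elliptic_region_def]]
    by simp_all
  have C: "connected C" "C \<noteq> {}" "C \<subseteq> torus_proj \<Gamma> -` \<Omega>" if "C \<in> lifts \<Gamma> \<Omega>" for C
    by (rule in_components_connected in_components_nonempty in_components_subset,
        rule that[unfolded lifts_def])+
  obtain A where A: "\<And>z. Ac z = A" using A_constant by blast
  \<comment> \<open>The separated form is the alternative proved in every case; a constant conformal
    factor has it trivially. One direction d serves all lifts and, for an analytic metric, the whole
    plane.\<close>
  have conclusion: ?thesis if d: "cmod d = 1"
    and lifts: "\<And>C. C \<in> lifts \<Gamma> \<Omega> \<Longrightarrow> separated_along \<Lambda> (- Im d) (Re d) (Re d) (Im d) C"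
    and analytic: "real_analytic_metric \<rho> \<Longrightarrow> separated_along \<Lambda> (- Im d) (Re d) (Re d) (Im d) UNIV" for d
  proof (intro conjI disjI2 impI)
    note d = orthogonal_directions_frame[OF d]
    have "orthogonal_directions (- Im d) (Re d) (Re d) (Im d) \<and>
        (\<forall>C\<in>lifts \<Gamma> \<Omega>. separated_along \<Lambda> (- Im d) (Re d) (Re d) (Im d) C)"
      using d lifts by simp
    then show "\<exists>m\<^sub>1 n\<^sub>1 m\<^sub>2 n\<^sub>2. orthogonal_directions m\<^sub>1 n\<^sub>1 m\<^sub>2 n\<^sub>2 \<and>
        (\<forall>C\<in>lifts \<Gamma> \<Omega>. separated_along \<Lambda> m\<^sub>1 n\<^sub>1 m\<^sub>2 n\<^sub>2 C)"
      by (intro exI)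
    assume "real_analytic_metric \<rho>"
    then have "orthogonal_directions (- Im d) (Re d) (Re d) (Im d) \<and>
        separated_along \<Lambda> (- Im d) (Re d) (Re d) (Im d) UNIV"
      using d analytic by simp
    then show "\<exists>m\<^sub>1 n\<^sub>1 m\<^sub>2 n\<^sub>2. orthogonal_directions m\<^sub>1 n\<^sub>1 m\<^sub>2 n\<^sub>2 \<and>
        separated_along \<Lambda> m\<^sub>1 n\<^sub>1 m\<^sub>2 n\<^sub>2 UNIV"
      by (intro exI)
  qed
  show ?thesis
  proof (cases "A = 0")
    case True
    then obtain d where d: "cmod d = 1" "separates (lift \<Lambda>) d UNIV"
      using separates_quadratic[OF _ z0] A by auto
    have "separated_along \<Lambda> (- Im d) (Re d) (Re d) (Im d) C" if "C \<noteq> {}" for C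
      using separated_along_if_separates[OF smooth d _ that] by simp
    with C(2) show ?thesis by (intro conclusion[OF d(1)]) auto
  next
    case False
    \<comment> \<open>A point over the region differs by a lattice vector from a point \<Phi> y at
      which the matrix is elliptic, and \<open>Ell A\<close> is periodic.\<close>
    have preimage: "cplx q \<in> Ell A" if q: "q \<in> torus_proj \<Gamma> -` \<Omega>" for q
    proof -
      obtain y where y: "torus_proj \<Gamma> q = torus_proj \<Gamma> (\<Phi> y)" "elliptic_matrix (quartic_matrix (\<lambda>k. a k y))"
        using q region'(2) unfolding elliptic_set_def by blast
      have "0 \<in> \<Gamma>" using lattice_periods[OF lattice] by metis
      then have "q \<in> torus_proj \<Gamma> q" unfolding torus_proj_def by (metis add.right_neutral image_eqI)
      then have "q \<in> torus_proj \<Gamma> (\<Phi> y)" by (simp only: y(1))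
      then obtain \<gamma> where \<gamma>: "\<gamma> \<in> \<Gamma>" "q = \<Phi> y + \<gamma>" unfolding torus_proj_def by blast
      have a3': "a 3 y \<noteq> 0" using a3 coords(3)[of y] by simp
      have "cplx (\<Phi> y) \<in> Ell A"
        by (rule elliptic_in_Ell[where a = a and h = "g y"]; fact A False coords(3-5) a3' y(2))
      then show ?thesis using Ell_periodic[of "cplx \<gamma>"] \<gamma> by (simp add: cplx_add)
    qed
    obtain q where "torus_proj \<Gamma> q \<in> \<Omega>"
      using region' unfolding elliptic_set_def by blast
    then have ne: "Ell A \<noteq> {}" using preimage by blast
    obtain d where d: "cmod d = 1"
      "\<And>C. connected C \<Longrightarrow> C \<subseteq> Ell A \<Longrightarrow> separates (lift \<Lambda>) d ((\<lambda>z. Im (z * cnj d)) ` C)"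
      using separates_Ell(2)[OF A False ne] by blast
    have "separated_along \<Lambda> (- Im d) (Re d) (Re d) (Im d) C" if "C \<in> lifts \<Gamma> \<Omega>" for C
    proof (rule separated_along_if_separates[OF smooth d(1) _ _ C(2)[OF that]])
      show "separates (lift \<Lambda>) d ((\<lambda>z. Im (z * cnj d)) ` cplx ` C)"
        using C[OF that] preimage by (intro d(2) connected_continuous_image continuous_cplx) auto
    qed auto
    moreover have "separated_along \<Lambda> (- Im d) (Re d) (Re d) (Im d) UNIV" if "real_analytic_metric \<rho>"
    proof -
      have "real_analytic \<Lambda>" using that unfolding real_analytic_metric_def by (metis (no_types, lifting) \<rho>11 ext)
      moreover obtain C s t where "connected C" "C \<subseteq> Ell A" "s < t" "{s<..<t} \<subseteq> (\<lambda>z. Im (z * cnj d)) ` C"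
        using open_contains_strip[OF separates_Ell(1)[OF A False] ne d(1)] by blast
      ultimately have "separates (lift \<Lambda>) d UNIV"
        using separates_continuation[OF _ smooth d(2)] by blast
      then show ?thesis using separated_along_if_separates[OF smooth d(1)] by blast
    qed
    ultimately show ?thesis by (rule conclusion[OF d(1)])
  qed
qed

end
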